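(* There is a polynomial-time algorithm that, given a graph $G=(V,E)$ and $k\in \mathbb{Z}_{>0}$, decides whether $G$ is a $k$-trail, and if so, outputs a $k$-tree $H=(W,F)$ and an onto function $\phi:W\rightarrow V$ such that $G$ is the homomorphic image of $H$ by $\phi$.
   Context: All graphs are undirected, connected, may have loops and parallel edges, and have at least $2$ vertices. A graph $G=(V,E)$ is the homomorphic image of a graph $H=(W,F)$ by an onto function $\phi:W\rightarrow V$ if for any two vertices $u,v\in V$ (possibly $u=v$), the number of edges of $G$ between $u$ and $v$ equals the number of edges of $H$ whose endpoints are mapped by $\phi$ to $\{u,v\}$ (an edge of $H$ with both endpoints mapped to $v$ corresponds to a loop at $v$). $G$ is a $k$-trail if it is the homomorphic image of a connected graph of maximum degree at most $k$. A $k$-tree is a tree of maximum degree at most $k$. *)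

theory Defs
  imports
    "HOL-Library.Multiset"
    "HOL-Library.Uprod"
    "HOL-Computational_Algebra.Polynomial"
begin

section \<open>Undirected multigraphs\<close>

text \<open>
  The edges form a finite multiset of unordered pairs: parallel edges are
  repeated elements, and a loop at v is the pair Upair v v.
\<close>

record 'a multigraph =
  verts :: "'a set"
  edges :: "'a uprod multiset"

definition adj :: "'a multigraph \<Rightarrow> ('a \<times> 'a) set" where
  "adj G = {(u, v). Upair u v \<in># edges G}"

definition connected_graph :: "'a multigraph \<Rightarrow> bool" where
  "connected_graph G \<longleftrightarrow> (\<forall>u\<in>verts G. \<forall>v\<in>verts G. (u, v) \<in> (adj G)\<^sup>*)"

definition is_graph :: "'a multigraph \<Rightarrow> bool" where
  "is_graph G \<longleftrightarrow>
     finite (verts G) \<and> 2 \<le> card (verts G) \<and>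
     (\<forall>e\<in>#edges G. set_uprod e \<subseteq> verts G) \<and>
     connected_graph G"

text \<open>A loop contributes 2 to the degree of its vertex.\<close>

definition vdegree :: "'a multigraph \<Rightarrow> 'a \<Rightarrow> nat" where
  "vdegree G v = size {#e \<in># edges G. v \<in> set_uprod e#} + count (edges G) (Upair v v)"

definition max_degree_le :: "'a multigraph \<Rightarrow> nat \<Rightarrow> bool" where
  "max_degree_le G k \<longleftrightarrow> (\<forall>v\<in>verts G. vdegree G v \<le> k)"

text \<open>
  A cycle is given by its distinct vertices in cyclic order. Its edges are taken
  with multiplicity, so that a loop is a cycle of length 1, a pair of parallel
  edges is a cycle of length 2, and a single non-loop edge traversed back and
  forth is not a cycle.
\<close>

definition is_cycle :: "'a multigraph \<Rightarrow> 'a list \<Rightarrow> bool" where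
  "is_cycle G vs \<longleftrightarrow> vs \<noteq> [] \<and> distinct vs \<and> set vs \<subseteq> verts G \<and>
     mset (map2 Upair vs (rotate1 vs)) \<subseteq># edges G"

definition is_tree :: "'a multigraph \<Rightarrow> bool" where
  "is_tree G \<longleftrightarrow> is_graph G \<and> (\<nexists>vs. is_cycle G vs)"

definition k_tree :: "nat \<Rightarrow> 'a multigraph \<Rightarrow> bool" where
  "k_tree k H \<longleftrightarrow> is_tree H \<and> max_degree_le H k"

definition hom_image :: "'v multigraph \<Rightarrow> 'w multigraph \<Rightarrow> ('w \<Rightarrow> 'v) \<Rightarrow> bool" where
  "hom_image G H \<phi> \<longleftrightarrow>
     \<phi> ` verts H = verts G \<and>
     (\<forall>u\<in>verts G. \<forall>v\<in>verts G.
        count (edges G) (Upair u v) = size {#f \<in># edges H. map_uprod \<phi> f = Upair u v#})"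

text \<open>
  Graphs being finite, it is no restriction to take the vertices of the
  preimage H to be natural numbers.
\<close>

definition k_trail :: "nat \<Rightarrow> 'v multigraph \<Rightarrow> bool" where
  "k_trail k G \<longleftrightarrow>
     (\<exists>(H :: nat multigraph) \<phi>. is_graph H \<and> max_degree_le H k \<and> hom_image G H \<phi>)"

section \<open>The machine model\<close>

text \<open>
  Jones's WHILE language (Computability and Complexity from a Programming
  Perspective, 1997): a program manipulates finitely many variables ranging over
  binary trees. Instead of charging one unit per operation, we charge for reading
  a variable the size of the tree it holds, as if it were copied. Every tree that
  is built thus has size at most the time spent on it, and Turing machines
  and WHILE programs simulate each other with polynomial overhead (also when
  computing functions, where unit cost with sharing would allow outputs of
  exponential size).

  The number of DCons nodes of a tree d is the generated function size d.
\<close>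

datatype data = DNil | DCons data data

fun dhd :: "data \<Rightarrow> data" where
  "dhd DNil = DNil"
| "dhd (DCons a b) = a"

fun dtl :: "data \<Rightarrow> data" where
  "dtl DNil = DNil"
| "dtl (DCons a b) = b"

datatype exp = Var nat | Nil_exp | Cons_exp exp exp | Hd_exp exp | Tl_exp exp

type_synonym store = "nat \<Rightarrow> data"

fun eval_exp :: "exp \<Rightarrow> store \<Rightarrow> data" where
  "eval_exp (Var x) s = s x"
| "eval_exp Nil_exp s = DNil"
| "eval_exp (Cons_exp a b) s = DCons (eval_exp a s) (eval_exp b s)"
| "eval_exp (Hd_exp a) s = dhd (eval_exp a s)"
| "eval_exp (Tl_exp a) s = dtl (eval_exp a s)"

fun exp_cost :: "exp \<Rightarrow> store \<Rightarrow> nat" where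
  "exp_cost (Var x) s = 1 + size (s x)"
| "exp_cost Nil_exp s = 1"
| "exp_cost (Cons_exp a b) s = 1 + exp_cost a s + exp_cost b s"
| "exp_cost (Hd_exp a) s = 1 + exp_cost a s"
| "exp_cost (Tl_exp a) s = 1 + exp_cost a s"

datatype com =
    Skip
  | Assign nat exp
  | Seq com com
  | Cond exp com com
  | While exp com

text \<open>
  exec c s t s' means: started in store s, the program c halts after time t in
  store s'. In tests, DNil is false and everything else is true.
\<close>

inductive exec :: "com \<Rightarrow> store \<Rightarrow> nat \<Rightarrow> store \<Rightarrow> bool" where
  Skip: "exec Skip s 1 s"
| Assign: "exec (Assign x e) s (1 + exp_cost e s) (s(x := eval_exp e s))"
| Seq: "exec c1 s1 t1 s2 \<Longrightarrow> exec c2 s2 t2 s3 \<Longrightarrow> exec (Seq c1 c2) s1 (1 + t1 + t2) s3"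
| IfTrue: "eval_exp e s \<noteq> DNil \<Longrightarrow> exec c1 s t s' \<Longrightarrow>
    exec (Cond e c1 c2) s (1 + exp_cost e s + t) s'"
| IfFalse: "eval_exp e s = DNil \<Longrightarrow> exec c2 s t s' \<Longrightarrow>
    exec (Cond e c1 c2) s (1 + exp_cost e s + t) s'"
| WhileFalse: "eval_exp e s = DNil \<Longrightarrow> exec (While e c) s (1 + exp_cost e s) s"
| WhileTrue: "eval_exp e s1 \<noteq> DNil \<Longrightarrow> exec c s1 t1 s2 \<Longrightarrow> exec (While e c) s2 t2 s3 \<Longrightarrow>
    exec (While e c) s1 (1 + exp_cost e s1 + t1 + t2) s3"

inductive_cases SkipE: "exec Skip s t s'"
inductive_cases AssignE: "exec (Assign x e) s t s'"
inductive_cases SeqE: "exec (Seq c1 c2) s t s'"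
inductive_cases IfE: "exec (Cond e c1 c2) s t s'"
inductive_cases WhileE: "exec (While e c) s t s'"

lemma exec_deterministic:
  "exec c s t s' \<Longrightarrow> exec c s u s'' \<Longrightarrow> u = t \<and> s'' = s'"
proof (induction arbitrary: u s'' rule: exec.induct)
  case (Skip s)
  then show ?case by (rule SkipE) simp
next
  case (Assign x e s)
  then show ?case by (rule AssignE) simp
next
  case (Seq c1 s1 t1 s2 c2 t2 s3)
  from Seq.prems obtain u1 u2 r where
    "exec c1 s1 u1 r" "exec c2 r u2 s''" "u = 1 + u1 + u2"
    by (rule SeqE) simp
  with Seq.IH(1)[of u1 r] Seq.IH(2)[of u2 s''] show ?case by simp
next
  case (IfTrue e s c1 t s' c2)
  from IfTrue.prems IfTrue.hyps(1) obtain v where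
    "exec c1 s v s''" "u = 1 + exp_cost e s + v"
    by (elim IfE) simp_all
  with IfTrue.IH[of v s''] show ?case by simp
next
  case (IfFalse e s c2 t s' c1)
  from IfFalse.prems IfFalse.hyps(1) obtain v where
    "exec c2 s v s''" "u = 1 + exp_cost e s + v"
    by (elim IfE) simp_all
  with IfFalse.IH[of v s''] show ?case by simp
next
  case (WhileFalse e s c)
  from WhileFalse.prems show ?case by (cases rule: WhileE) (use WhileFalse.hyps in auto)
next
  case (WhileTrue e s1 c t1 s2 t2 s3)
  from WhileTrue.prems obtain u1 u2 r where
    "exec c s1 u1 r" "exec (While e c) r u2 s''" "u = 1 + exp_cost e s1 + u1 + u2"
    by (cases rule: WhileE) (use WhileTrue.hyps(1) in auto)
  with WhileTrue.IH(1)[of u1 r] WhileTrue.IH(2)[of u2 s''] show ?case by simp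
qed

text \<open>Input and output are passed in variable 0; all other variables start as DNil.\<close>

definition computes :: "com \<Rightarrow> data \<Rightarrow> nat \<Rightarrow> data \<Rightarrow> bool" where
  "computes c x t y \<longleftrightarrow> (\<exists>s. exec c ((\<lambda>_. DNil)(0 := x)) t s \<and> s 0 = y)"

text \<open>
  The search problem that asks, for each instance i in D, for some
  answer a with R i a, is solvable in polynomial time in the size of the
  encoded instance.
\<close>

definition poly_time_solvable ::
  "('i \<Rightarrow> data) \<Rightarrow> ('o \<Rightarrow> data) \<Rightarrow> 'i set \<Rightarrow> ('i \<Rightarrow> 'o \<Rightarrow> bool) \<Rightarrow> bool" where
  "poly_time_solvable enc_in enc_out D R \<longleftrightarrow>
     (\<exists>(c :: com) (p :: nat poly). \<forall>i\<in>D. \<exists>t a.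
        computes c (enc_in i) t (enc_out a) \<and> t \<le> poly p (size (enc_in i)) \<and> R i a)"

section \<open>Encodings\<close>

text \<open>Natural numbers are written in binary, least significant bit first.\<close>

fun enc_nat :: "nat \<Rightarrow> data" where
  "enc_nat n = (if n = 0 then DNil
     else DCons (if odd n then DCons DNil DNil else DNil) (enc_nat (n div 2)))"

declare enc_nat.simps [simp del]

fun enc_prod :: "('a \<Rightarrow> data) \<Rightarrow> ('b \<Rightarrow> data) \<Rightarrow> 'a \<times> 'b \<Rightarrow> data" where
  "enc_prod f g (a, b) = DCons (f a) (g b)"

fun enc_list :: "('a \<Rightarrow> data) \<Rightarrow> 'a list \<Rightarrow> data" where
  "enc_list f [] = DNil"
| "enc_list f (x # xs) = DCons (f x) (enc_list f xs)"

fun enc_option :: "('a \<Rightarrow> data) \<Rightarrow> 'a option \<Rightarrow> data" where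
  "enc_option f None = DNil"
| "enc_option f (Some x) = DCons DNil (f x)"

lemma enc_nat_0: "enc_nat 0 = DNil"
  by (subst enc_nat.simps) simp

lemma enc_nat_pos:
  "n > 0 \<Longrightarrow> enc_nat n = DCons (if odd n then DCons DNil DNil else DNil) (enc_nat (n div 2))"
  by (subst enc_nat.simps) simp

lemma inj_enc_nat: "inj enc_nat"
proof (rule injI)
  show "enc_nat m = enc_nat n \<Longrightarrow> m = n" for m n
  proof (induction m arbitrary: n rule: less_induct)
    case (less m)
    consider "m = 0" | "n = 0" | "m > 0" "n > 0" by blast
    then show ?case
    proof cases
      case 1
      with less.prems show ?thesis by (cases "n = 0") (simp_all add: enc_nat_0 enc_nat_pos)
    next
      case 2
      with less.prems show ?thesis by (cases "m = 0") (simp_all add: enc_nat_0 enc_nat_pos)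
    next
      case 3
      have "(if odd m then DCons DNil DNil else DNil) = (if odd n then DCons DNil DNil else DNil)"
        and div_eq: "enc_nat (m div 2) = enc_nat (n div 2)"
        using less.prems unfolding enc_nat_pos[OF 3(1)] enc_nat_pos[OF 3(2)] by simp_all
      then have "odd m = odd n" by (simp split: if_splits)
      moreover have "m div 2 = n div 2" using 3(1) less.IH[OF _ div_eq] by simp
      ultimately show ?thesis by presburger
    qed
  qed
qed

lemma inj_enc_prod: "inj f \<Longrightarrow> inj g \<Longrightarrow> inj (enc_prod f g)"
  by (rule injI) (auto dest: injD)

lemma inj_enc_list: "inj f \<Longrightarrow> inj (enc_list f)"
proof (rule injI)
  show "enc_list f xs = enc_list f ys \<Longrightarrow> xs = ys" if "inj f" for xs ys
  proof (induction xs arbitrary: ys)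
    case Nil
    then show ?case by (cases ys) auto
  next
    case (Cons x xs)
    then show ?case using that by (cases ys) (auto dest: injD)
  qed
qed

lemma inj_enc_option: "inj f \<Longrightarrow> inj (enc_option f)"
proof (rule injI)
  show "enc_option f x = enc_option f y \<Longrightarrow> x = y" if "inj f" for x y
    using that by (cases x; cases y) (auto dest: injD)
qed

text \<open>
  A concrete graph lists its vertices (labelled by natural numbers) and its edges,
  parallel edges being listed separately.
\<close>

type_synonym pres = "nat list \<times> (nat \<times> nat) list"

fun graph_of :: "pres \<Rightarrow> nat multigraph" where
  "graph_of (vs, es) = \<lparr>verts = set vs, edges = mset (map (\<lambda>(u, v). Upair u v) es)\<rparr>"

definition valid_pres :: "pres \<Rightarrow> bool" where
  "valid_pres P \<longleftrightarrow> distinct (fst P) \<and> is_graph (graph_of P)"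

definition enc_pres :: "pres \<Rightarrow> data" where
  "enc_pres = enc_prod (enc_list enc_nat) (enc_list (enc_prod enc_nat enc_nat))"

text \<open>A function with a finite domain is given by the list of its argument-value pairs.\<close>

type_synonym fun_table = "(nat \<times> nat) list"

definition is_table_on :: "nat set \<Rightarrow> fun_table \<Rightarrow> bool" where
  "is_table_on W tab \<longleftrightarrow> distinct (map fst tab) \<and> set (map fst tab) = W"

definition table_fun :: "fun_table \<Rightarrow> nat \<Rightarrow> nat" where
  "table_fun tab w = the (map_of tab w)"

definition enc_instance :: "pres \<times> nat \<Rightarrow> data" where
  "enc_instance = enc_prod enc_pres enc_nat"

definition enc_answer :: "(pres \<times> fun_table) option \<Rightarrow> data" where
  "enc_answer = enc_option (enc_prod enc_pres (enc_list (enc_prod enc_nat enc_nat)))"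

lemma inj_enc_pres: "inj enc_pres"
  unfolding enc_pres_def by (intro inj_enc_prod inj_enc_list inj_enc_nat)

lemma inj_enc_instance: "inj enc_instance"
  unfolding enc_instance_def by (intro inj_enc_prod inj_enc_pres inj_enc_nat)

lemma inj_enc_answer: "inj enc_answer"
  unfolding enc_answer_def
  by (intro inj_enc_option inj_enc_prod inj_enc_list inj_enc_pres inj_enc_nat)

end

theory Submission
  imports Defs
begin

text \<open>
  Fix a vertex r. If G is the image of a connected graph H, root H at a preimage of r and orient its
  edges away from the root. The arcs of G inherit an orientation in which everything is reachable from
  r, and the number z v of preimages of v is at most the number of arcs entering v, plus 1 if v = r;
  so deg v is at most k * z v for this bound z v. Conversely, given such an orientation, let every arc
  create one copy of its head. A spanning arborescence tells where to attach the copies so that they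
  form a tree, and the degrees of the copies of v, whose average is at most k, can be evened out by
  moving subtrees from a copy to another one.

  To find the orientation, start with any one in which everything is reachable from r and reverse a
  path from a vertex with deficit to a vertex with surplus as long as reachability survives. In a
  reachable orientation every nonempty vertex set X satisfies z X >= i X + 1, where i X is the number of
  edges inside X, and this inequality alone decides reachability. As i is supermodular, the sets with
  equality are closed under intersecting unions; if no reversal helps, the surplus is confined to such
  sets, which no other orientation can undercut, and there is no solution.

  Polynomial running time comes from a small class of functions on encodable types that is closed under
  composition, pairing, case distinction and iterations whose intermediate results stay small.
\<close>

section \<open>Polynomial-time functions on encodable types\<close>

text \<open>The degree bound is given in binary and may be exponential in the input size, and the
  machine has no arithmetic. Both obstacles are met by computing with list lengths: numbers are
  compared by shortening lists and multiplied by forming products of lists, and the bound becomes a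
  list of units cut off at 1 + 2|E|. The cut is harmless because no degree exceeds 2|E| and every
  vertex has at least one copy. The preimage has |E| + 1 vertices whatever the bound is, one per
  edge and one for the root. Their names must be numbers, so edges are tagged with numbers 2^i - 1:
  their binary form is a list of i ones, which can be produced without addition. Both local searches
  lower a sum of excess degrees that is at most 2|E|, so a fixed number of rounds suffices. That the
  preimage is a tree needs no test for cycles: every copy except the root copy is entered by exactly
  one arc, and then reachability from the root copy already excludes cycles.\<close>

class encodable =
  fixes enc :: "'a \<Rightarrow> data"
  assumes inj_enc: "inj enc"

lemma enc_eq_iff [simp]: "enc x = enc y \<longleftrightarrow> x = y" for x y :: "'a::encodable"
  using inj_enc by (auto dest: injD)

instantiation data :: encodable
begin
definition enc_data :: "data \<Rightarrow> data" where [simp]: "enc_data d = d"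
instance by standard (simp add: inj_def)
end

instantiation unit :: encodable
begin
definition enc_unit :: "unit \<Rightarrow> data" where [simp]: "enc_unit d = DNil"
instance by standard (simp add: inj_def)
end

instantiation bool :: encodable
begin
definition enc_bool :: "bool \<Rightarrow> data" where [simp]: "enc_bool b = (if b then DCons DNil DNil else DNil)"
instance by standard (simp add: inj_def)
end

instantiation nat :: encodable
begin
definition enc_nat_def': "(enc :: nat \<Rightarrow> data) = enc_nat"
instance by standard (simp add: enc_nat_def' inj_enc_nat)
end

instantiation prod :: (encodable, encodable) encodable
begin
definition enc_prod_def': "(enc :: 'a \<times> 'b \<Rightarrow> data) = enc_prod enc enc"
instance by standard (simp add: enc_prod_def' inj_enc_prod inj_enc)
end

instantiation list :: (encodable) encodable
begin
definition enc_list_def': "(enc :: 'a list \<Rightarrow> data) = enc_list enc"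
instance by standard (simp add: enc_list_def' inj_enc_list inj_enc)
end

instantiation option :: (encodable) encodable
begin
definition enc_option_def': "(enc :: 'a option \<Rightarrow> data) = enc_option enc"
instance by standard (simp add: enc_option_def' inj_enc_option inj_enc)
end

lemma enc_Pair [simp]: "enc (a, b) = DCons (enc a) (enc b)"
  by (simp add: enc_prod_def')

lemma enc_Nil [simp]: "enc [] = DNil"
  and enc_Cons [simp]: "enc (x # xs) = DCons (enc x) (enc xs)"
  by (simp_all add: enc_list_def')

lemma enc_list_eq_DNil [simp]: "enc xs = DNil \<longleftrightarrow> xs = []" for xs :: "'a::encodable list"
  by (cases xs) auto

lemma enc_None [simp]: "enc None = DNil"
  and enc_Some [simp]: "enc (Some x) = DCons DNil (enc x)"
  by (simp_all add: enc_option_def')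

section \<open>Sizes and polynomial bounds\<close>

abbreviation esize :: "'a::encodable \<Rightarrow> nat" where
  "esize x \<equiv> size (enc x)"

text \<open>A base of at least 2 lets the exponent alone absorb constants and sums, so a single
  number describes a bound. General polynomials enter only at the very end.\<close>

definition pb :: "('a::encodable \<Rightarrow> nat) \<Rightarrow> bool" where
  "pb T \<longleftrightarrow> (\<exists>d. \<forall>x. T x \<le> (esize x + 2) ^ d)"

lemma pb_mono: "pb T \<Longrightarrow> (\<And>x. S x \<le> T x) \<Longrightarrow> pb S"
  unfolding pb_def using order_trans by blast

lemma pb_esize: "pb esize"
  unfolding pb_def by (rule exI[of _ 1]) simp

lemma pb_const: "pb (\<lambda>_. c)"
proof -
  have "c \<le> (esize (x::'a) + 2) ^ c" for x
  proof -
    have "c < 2 ^ c" by (rule less_exp)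
    also have "\<dots> \<le> (esize x + 2) ^ c" by (rule power_mono) auto
    finally show ?thesis by simp
  qed
  then show ?thesis unfolding pb_def by blast
qed

lemma pb_mult:
  assumes "pb S" "pb T"
  shows "pb (\<lambda>x. S x * T x)"
proof -
  obtain a b where "\<And>x. S x \<le> (esize x + 2) ^ a" "\<And>x. T x \<le> (esize x + 2) ^ b"
    using assms unfolding pb_def by blast
  then have "S x * T x \<le> (esize x + 2) ^ (a + b)" for x
    by (simp add: power_add mult_le_mono)
  then show ?thesis unfolding pb_def by blast
qed

lemma pb_add:
  assumes "pb S" "pb T"
  shows "pb (\<lambda>x. S x + T x)"
proof (rule pb_mono)
  show "pb (\<lambda>x. (S x + 1) * (T x + 1))"
  proof -
    have *: "pb (\<lambda>x. U x + 1)" if U: "pb U" for U :: "'a \<Rightarrow> nat"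
    proof -
      obtain a where a: "\<And>x. U x \<le> (esize x + 2) ^ a"
        using U unfolding pb_def by blast
      have "U x + 1 \<le> (esize x + 2) ^ (a + 1)" for x
      proof -
        have "(1::nat) \<le> (esize x + 2) ^ a" by simp
        then have "U x + 1 \<le> 2 * (esize x + 2) ^ a" using a[of x] by linarith
        also have "\<dots> \<le> (esize x + 2) ^ (a + 1)" by simp
        finally show ?thesis .
      qed
      then show ?thesis unfolding pb_def by blast
    qed
    show ?thesis using assms by (intro pb_mult *)
  qed
qed simp

lemma pb_power: "pb T \<Longrightarrow> pb (\<lambda>x. T x ^ d)"
  by (induction d) (auto intro: pb_const pb_mult)

lemma pb_comp:
  assumes "pb T" "pb (\<lambda>x. esize (f x))"
  shows "pb (\<lambda>x. T (f x))"
proof -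
  obtain d where "\<And>x. T x \<le> (esize x + 2) ^ d"
    using assms(1) unfolding pb_def by blast
  then show ?thesis
    by (intro pb_mono[OF pb_power[OF pb_add[OF assms(2) pb_const]]])
qed

text \<open>A bounded \<open>T\<close> need not be monotone. The monotone bound is for arguments
  that are intermediate values, of which only the size is controlled.\<close>

lemma pb_majorant:
  assumes "pb T"
  obtains d where "\<And>x b. esize x \<le> b \<Longrightarrow> T x \<le> (b + 2) ^ d"
proof -
  obtain d where d: "\<And>x. T x \<le> (esize x + 2) ^ d"
    using assms unfolding pb_def by blast
  show ?thesis
  proof
    show "T x \<le> (b + 2) ^ d" if "esize x \<le> b" for x b
      using that by (intro order_trans[OF d] power_mono) auto
  qed
qed

text \<open>
  The workspace of a subprogram is the set of all variables from some n on: it finds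
  its argument in variable n, leaves its result there and does not touch smaller variables.
\<close>

definition runs :: "com \<Rightarrow> nat \<Rightarrow> store \<Rightarrow> nat \<Rightarrow> data \<Rightarrow> bool" where
  "runs c n s T y \<longleftrightarrow> (\<exists>t s'. exec c s t s' \<and> s' n = y \<and> (\<forall>m<n. s' m = s m) \<and> t \<le> T)"

definition FP :: "('a::encodable \<Rightarrow> 'b::encodable) \<Rightarrow> bool" where
  "FP f \<longleftrightarrow> (\<exists>T. pb T \<and> (\<forall>n. \<exists>c. \<forall>s x. s n = enc x \<longrightarrow> runs c n s (T x) (enc (f x))))"

lemma FP_I:
  assumes "pb T" "\<And>n. \<exists>c. \<forall>s x. s n = enc x \<longrightarrow> runs c n s (T x) (enc (f x))"
  shows "FP f"
  using assms unfolding FP_def by blast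

lemma FP_E:
  assumes "FP f"
  obtains T c where "pb T" "\<And>n s x. s n = enc x \<Longrightarrow> runs (c n) n s (T x) (enc (f x))"
proof -
  obtain T where T: "pb T" "\<forall>n. \<exists>c. \<forall>s x. s n = enc x \<longrightarrow> runs c n s (T x) (enc (f x))"
    using assms unfolding FP_def by blast
  from T(2) obtain c where "\<forall>n. \<forall>s x. s n = enc x \<longrightarrow> runs (c n) n s (T x) (enc (f x))"
    by metis
  with T(1) show ?thesis using that by blast
qed

lemma size_dhd: "size (dhd d) \<le> size d" and size_dtl: "size (dtl d) \<le> size d"
  by (cases d; simp)+

lemma size_eval_exp: "size (eval_exp e s) \<le> exp_cost e s"
proof (induction e)
  case (Hd_exp e)
  then show ?case using size_dhd[of "eval_exp e s"] by simp
next
  case (Tl_exp e)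
  then show ?case using size_dtl[of "eval_exp e s"] by simp
qed auto

text \<open>Reading a variable costs its size, so nothing grows faster than time passes. Hence
  functions in \<open>FP\<close> have outputs of polynomial size, on which composition
  depends.\<close>

lemma exec_size: "exec c s t s' \<Longrightarrow> size (s' v) \<le> size (s v) + t"
proof (induction arbitrary: v rule: exec.induct)
  case (Assign x e s)
  then show ?case using size_eval_exp[of e s] by auto
next
  case (Seq c1 s1 t1 s2 c2 t2 s3)
  from Seq.IH(1)[of v] Seq.IH(2)[of v] show ?case by linarith
next
  case (WhileTrue e s1 c t1 s2 t2 s3)
  from WhileTrue.IH(1)[of v] WhileTrue.IH(2)[of v] show ?case by linarith
next
  case (IfTrue e s c1 t s' c2)
  from IfTrue.IH[of v] show ?case by linarith
next
  case (IfFalse e s c2 t s' c1)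
  from IfFalse.IH[of v] show ?case by linarith
qed auto

lemma FP_size:
  assumes "FP f"
  shows "pb (\<lambda>x. esize (f x))"
proof -
  obtain T c where T: "pb T" and c: "\<And>n s x. s n = enc x \<Longrightarrow> runs (c n) n s (T x) (enc (f x))"
    using FP_E[OF assms] by blast
  have "esize (f x) \<le> esize x + T x" for x
  proof -
    have "runs (c 0) 0 (\<lambda>_. enc x) (T x) (enc (f x))" by (rule c) simp
    then obtain t s' where "exec (c 0) (\<lambda>_. enc x) t s'" "s' 0 = enc (f x)" "t \<le> T x"
      unfolding runs_def by blast
    with exec_size[of "c 0" "\<lambda>_. enc x" t s' 0] show ?thesis by simp
  qed
  then show ?thesis by (rule pb_mono[OF pb_add[OF pb_esize T]])
qed

text \<open>\<open>FP\<close> sees only encodings, so a change of result type is free: a nonempty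
  list is encoded like a pair, \<open>Some\<close> like a pair with first component
  \<open>False\<close>, a number like the list of its bits.\<close>

lemma FP_coerce: "FP f \<Longrightarrow> (\<And>x. enc (f x) = enc (g x)) \<Longrightarrow> FP g"
  unfolding FP_def by simp

lemma FP_comp:
  assumes "FP f" "FP g"
  shows "FP (\<lambda>x. g (f x))"
proof -
  obtain T c where T: "pb T" and c: "\<And>n s x. s n = enc x \<Longrightarrow> runs (c n) n s (T x) (enc (f x))"
    using FP_E[OF assms(1)] by blast
  obtain U b where U: "pb U" and b: "\<And>n s x. s n = enc x \<Longrightarrow> runs (b n) n s (U x) (enc (g x))"
    using FP_E[OF assms(2)] by blast
  show ?thesis
  proof (rule FP_I)
    show "pb (\<lambda>x. 1 + T x + U (f x))"
      by (intro pb_add pb_const T pb_comp[OF U FP_size[OF assms(1)]])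
    fix n
    have "runs (Seq (c n) (b n)) n s (1 + T x + U (f x)) (enc (g (f x)))" if s: "s n = enc x" for s x
    proof -
      obtain t s' where 1: "exec (c n) s t s'" "s' n = enc (f x)" "\<forall>m<n. s' m = s m" "t \<le> T x"
        using c[of s n x, OF s] unfolding runs_def by blast
      obtain t2 s2 where 2: "exec (b n) s' t2 s2" "s2 n = enc (g (f x))" "\<forall>m<n. s2 m = s' m" "t2 \<le> U (f x)"
        using b[of s' n "f x", OF 1(2)] unfolding runs_def by blast
      show ?thesis unfolding runs_def
        using exec.Seq[OF 1(1) 2(1)] 1 2 by (intro exI[of _ "1 + t + t2"] exI[of _ s2]) auto
    qed
    then show "\<exists>c. \<forall>s x. s n = enc x \<longrightarrow> runs c n s (1 + T x + U (f x)) (enc (g (f x)))" by blast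
  qed
qed

lemma FP_assign:
  assumes "\<And>n s x. s n = enc x \<Longrightarrow> eval_exp (e n) s = enc (f x) \<and> exp_cost (e n) s \<le> T x" "pb T"
  shows "FP f"
proof (rule FP_I)
  show "pb (\<lambda>x. 1 + T x)" by (intro pb_add pb_const assms(2))
  fix n
  have "runs (Assign n (e n)) n s (1 + T x) (enc (f x))" if s: "s n = enc x" for s x
    unfolding runs_def using exec.Assign[of n "e n" s] assms(1)[of s n x, OF s]
    by (intro exI[of _ "1 + exp_cost (e n) s"] exI[of _ "s(n := eval_exp (e n) s)"]) auto
  then show "\<exists>c. \<forall>s x. s n = enc x \<longrightarrow> runs c n s (1 + T x) (enc (f x))" by blast
qed

section \<open>Projections, pairs and case distinction\<close>

lemma FP_id: "FP (\<lambda>x. x)"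
  by (rule FP_assign[where e = Var and T = "\<lambda>x. 1 + esize x"]) (simp, intro pb_add pb_const pb_esize)

lemma FP_dhd: assumes "\<And>x. enc (f x) = dhd (enc x)" shows "FP f"
  by (rule FP_assign[where e = "\<lambda>n. Hd_exp (Var n)" and T = "\<lambda>x. 2 + esize x"])
    (simp add: assms, intro pb_add pb_const pb_esize)

lemma FP_dtl: assumes "\<And>x. enc (f x) = dtl (enc x)" shows "FP f"
  by (rule FP_assign[where e = "\<lambda>n. Tl_exp (Var n)" and T = "\<lambda>x. 2 + esize x"])
    (simp add: assms, intro pb_add pb_const pb_esize)

fun data_exp :: "data \<Rightarrow> exp" where
  "data_exp DNil = Nil_exp"
| "data_exp (DCons a b) = Cons_exp (data_exp a) (data_exp b)"

lemma FP_const: "FP (\<lambda>_. y)"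
proof (rule FP_assign[where e = "\<lambda>_. data_exp (enc y)" and T = "\<lambda>_. exp_cost (data_exp (enc y)) (\<lambda>_. DNil)"])
  have "eval_exp (data_exp d) s = d" "exp_cost (data_exp d) s = exp_cost (data_exp d) s'" for d s s'
    by (induction d) auto
  then show "eval_exp (data_exp (enc y)) s = enc y \<and>
      exp_cost (data_exp (enc y)) s \<le> exp_cost (data_exp (enc y)) (\<lambda>_. DNil)" for s
    by (metis order_refl)
qed (rule pb_const)

lemma FP_fst: "FP f \<Longrightarrow> FP (\<lambda>x. fst (f x))"
  by (rule FP_comp, assumption, rule FP_dhd) (auto split: prod.split)

lemma FP_snd: "FP f \<Longrightarrow> FP (\<lambda>x. snd (f x))"
  by (rule FP_comp, assumption, rule FP_dtl) (auto split: prod.split)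

lemma FP_tl: "FP f \<Longrightarrow> FP (\<lambda>x. tl (f x))"
proof (rule FP_comp, assumption, rule FP_dtl)
  show "enc (tl xs) = dtl (enc xs)" for xs :: "'b list" by (cases xs) auto
qed

lemma runs_copy:
  assumes "FP f"
  obtains T c where "pb T" "\<And>n s x. s n = enc x \<Longrightarrow>
    \<exists>t s'. exec (c n) s t s' \<and> s' (Suc n) = enc (f x) \<and> s' n = enc x \<and> (\<forall>m<n. s' m = s m) \<and> t \<le> T x"
proof -
  obtain T c where T: "pb T" and c: "\<And>n s x. s n = enc x \<Longrightarrow> runs (c n) n s (T x) (enc (f x))"
    using FP_E[OF assms(1)] by blast
  show ?thesis
  proof (rule that[of "\<lambda>x. 3 + esize x + T x" "\<lambda>n. Seq (Assign (Suc n) (Var n)) (c (Suc n))"])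
    show "pb (\<lambda>x. 3 + esize x + T x)" by (intro pb_add pb_const pb_esize T)
    fix n :: nat and s :: store and x :: 'a assume s: "s n = enc x"
    let ?s = "s(Suc n := s n)"
    have "?s (Suc n) = enc x" using s by simp
    from c[of ?s "Suc n" x, OF this] obtain t s' where 1: "exec (c (Suc n)) ?s t s'" "s' (Suc n) = enc (f x)"
        "\<forall>m<Suc n. s' m = ?s m" "t \<le> T x"
      unfolding runs_def by blast
    have 2: "exec (Assign (Suc n) (Var n)) s (2 + esize x) ?s"
      using exec.Assign[of "Suc n" "Var n" s] s by simp
    show "\<exists>t s'. exec (Seq (Assign (Suc n) (Var n)) (c (Suc n))) s t s' \<and> s' (Suc n) = enc (f x) \<and>
        s' n = enc x \<and> (\<forall>m<n. s' m = s m) \<and> t \<le> 3 + esize x + T x"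
      using exec.Seq[OF 2 1(1)] 1 s
      by (intro exI[of _ "1 + (2 + esize x) + t"] exI[of _ s']) auto
  qed
qed

lemma FP_Pair:
  assumes "FP f" "FP g"
  shows "FP (\<lambda>x. (f x, g x))"
proof -
  \<comment> \<open>With \<open>dup\<close> and rearrangements one passes from \<open>x\<close> to
    \<open>(g x, x)\<close>, then to \<open>((g x, x), f x)\<close>: the argument survives until
    both values are computed.\<close>
  have dup: "FP (\<lambda>x. (x, h x))" if h: "FP h" for h :: "'x::encodable \<Rightarrow> 'y::encodable"
  proof -
    obtain T c where T: "pb T" and c: "\<And>n s x. s n = enc x \<Longrightarrow>
        \<exists>t s'. exec (c n) s t s' \<and> s' (Suc n) = enc (h x) \<and> s' n = enc x \<and> (\<forall>m<n. s' m = s m) \<and> t \<le> T x"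
      using runs_copy[OF h] by blast
    show ?thesis
    proof (rule FP_I)
      show "pb (\<lambda>x. 5 + T x + esize x + esize (h x))"
        by (intro pb_add pb_const T pb_esize FP_size h)
      fix n
      have "runs (Seq (c n) (Assign n (Cons_exp (Var n) (Var (Suc n))))) n s
          (5 + T x + esize x + esize (h x)) (enc (x, h x))" if s: "s n = enc x" for s x
      proof -
        obtain t s' where 1: "exec (c n) s t s'" "s' (Suc n) = enc (h x)" "s' n = enc x"
            "\<forall>m<n. s' m = s m" "t \<le> T x"
          using c[of s n x, OF s] by blast
        have 2: "exec (Assign n (Cons_exp (Var n) (Var (Suc n)))) s' (4 + esize x + esize (h x))
            (s'(n := enc (x, h x)))"
          using exec.Assign[of n "Cons_exp (Var n) (Var (Suc n))" s'] 1 by (simp add: eval_nat_numeral)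
        show ?thesis unfolding runs_def
          using exec.Seq[OF 1(1) 2] 1
          by (intro exI[of _ "1 + t + (4 + esize x + esize (h x))"] exI[of _ "s'(n := enc (x, h x))"]) auto
      qed
      then show "\<exists>c. \<forall>s x. s n = enc x \<longrightarrow> runs c n s (5 + T x + esize x + esize (h x)) (enc (x, h x))"
        by blast
    qed
  qed
  have swap: "FP (\<lambda>x. (snd x, fst x))"
    by (rule FP_assign[where e = "\<lambda>n. Cons_exp (Tl_exp (Var n)) (Hd_exp (Var n))" and T = "\<lambda>x. 5 + esize x + esize x"])
      (auto, intro pb_add pb_mult pb_const pb_esize)
  have 1: "FP (\<lambda>x. (g x, x))" using FP_comp[OF dup[OF assms(2)] swap] by simp
  have 2: "FP (\<lambda>z. (z, f (snd z)))" by (intro dup FP_comp[OF FP_snd[OF FP_id] assms(1)])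
  have 3: "FP (\<lambda>x. ((g x, x), f x))" using FP_comp[OF 1 2] by simp
  have 4: "FP (\<lambda>y. (fst (fst y), snd y))"
    by (rule FP_assign[where e = "\<lambda>n. Cons_exp (Hd_exp (Hd_exp (Var n))) (Tl_exp (Var n))" and T = "\<lambda>x. 6 + esize x + esize x"])
      (auto, intro pb_add pb_mult pb_const pb_esize)
  have 5: "FP (\<lambda>x. (g x, f x))" using FP_comp[OF 3 4] by simp
  show ?thesis using FP_comp[OF 5 swap] by simp
qed

text \<open>Separates a binary function from its arguments: it suffices to treat it on the two
  projections, so its definition is unfolded only once.\<close>

lemma FP_comp2:
  assumes "FP (\<lambda>z. f (fst z) (snd z))" "FP g" "FP h"
  shows "FP (\<lambda>x. f (g x) (h x))"
  using FP_comp[OF FP_Pair[OF assms(2,3)] assms(1)] by simp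

text \<open>The machine branches only on \<open>DNil\<close>. The other branch receives argument and
  tested value as one tree, and \<open>z\<close> may have any type with that encoding: a pair with a
  truth value as well as a triple with the head and tail of a list.\<close>

lemma FP_case_data:
  assumes f: "FP (f :: 'a::encodable \<Rightarrow> 'c::encodable)" and a: "FP a" and b: "FP b"
    and nil: "\<And>x. enc (f x) = DNil \<Longrightarrow> r x = a x"
    and cons: "\<And>x. enc (f x) \<noteq> DNil \<Longrightarrow> \<exists>z. enc z = DCons (enc x) (enc (f x)) \<and> r x = b z"
  shows "FP r"
proof -
  obtain T c where T: "pb T" and c: "\<And>n s x. s n = enc x \<Longrightarrow>
      \<exists>t s'. exec (c n) s t s' \<and> s' (Suc n) = enc (f x) \<and> s' n = enc x \<and> (\<forall>m<n. s' m = s m) \<and> t \<le> T x"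
    using runs_copy[OF f] by blast
  obtain Ta ca where Ta: "pb Ta" and ca: "\<And>n s x. s n = enc x \<Longrightarrow> runs (ca n) n s (Ta x) (enc (a x))"
    using FP_E[OF a] by blast
  obtain Tb cb where Tb: "pb Tb" and cb: "\<And>n s x. s n = enc x \<Longrightarrow> runs (cb n) n s (Tb x) (enc (b x))"
    using FP_E[OF b] by blast
  obtain d where d: "\<And>x b. esize x \<le> b \<Longrightarrow> Tb x \<le> (b + 2) ^ d"
    using pb_majorant[OF Tb] by blast
  let ?U = "\<lambda>x. 10 + T x + esize x + 2 * esize (f x) + Ta x + (esize x + esize (f x) + 1 + 2) ^ d"
  show ?thesis
  proof (rule FP_I)
    show "pb ?U" by (intro pb_add pb_const T Ta pb_esize pb_mult pb_power FP_size[OF f])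
    fix n
    let ?mk = "Assign n (Cons_exp (Var n) (Var (Suc n)))"
    let ?c = "Seq (c n) (Cond (Var (Suc n)) (Seq ?mk (cb n)) (ca n))"
    have "runs ?c n s (?U x) (enc (r x))" if s: "s n = enc x" for s x
    proof -
      obtain t s1 where 1: "exec (c n) s t s1" "s1 (Suc n) = enc (f x)" "s1 n = enc x"
          "\<forall>m<n. s1 m = s m" "t \<le> T x"
        using c[of s n x, OF s] by blast
      show ?thesis
      proof (cases "enc (f x) = DNil")
        case True
        obtain t2 s2 where 2: "exec (ca n) s1 t2 s2" "s2 n = enc (a x)" "\<forall>m<n. s2 m = s1 m" "t2 \<le> Ta x"
          using ca[of s1 n x, OF 1(3)] unfolding runs_def by blast
        have 3: "exec (Cond (Var (Suc n)) (Seq ?mk (cb n)) (ca n)) s1 (2 + t2) s2"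
          using exec.IfFalse[of "Var (Suc n)" s1 "ca n" t2 s2 "Seq ?mk (cb n)"] 2 1 True by simp
        show ?thesis unfolding runs_def using exec.Seq[OF 1(1) 3] 1 2 nil[OF True]
          by (intro exI[of _ "1 + t + (2 + t2)"] exI[of _ s2]) auto
      next
        case False
        then obtain z where z: "enc z = DCons (enc x) (enc (f x))" "r x = b z" using cons by blast
        let ?s = "s1(n := enc z)"
        have mk: "exec ?mk s1 (4 + esize x + esize (f x)) ?s"
          using exec.Assign[of n "Cons_exp (Var n) (Var (Suc n))" s1] 1 z by (simp add: eval_nat_numeral)
        have "?s n = enc z" by simp
        from cb[of ?s n z, OF this] obtain t2 s2 where 2: "exec (cb n) ?s t2 s2" "s2 n = enc (b z)"
            "\<forall>m<n. s2 m = ?s m" "t2 \<le> Tb z"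
          unfolding runs_def by blast
        have 3: "exec (Cond (Var (Suc n)) (Seq ?mk (cb n)) (ca n)) s1
            (2 + esize (f x) + (1 + (4 + esize x + esize (f x)) + t2)) s2"
          using exec.IfTrue[OF _ exec.Seq[OF mk 2(1)], of "Var (Suc n)" "ca n"] 1(2) False
          by (simp add: eval_nat_numeral)
        have "Tb z \<le> (esize x + esize (f x) + 1 + 2) ^ d" by (rule d) (simp add: z)
        with 2(4) have t2: "t2 \<le> (esize x + esize (f x) + 1 + 2) ^ d" by simp
        show ?thesis unfolding runs_def
          using exec.Seq[OF 1(1) 3] 1 2 t2 z(2)
          by (intro exI[of _ "1 + t + (2 + esize (f x) + (1 + (4 + esize x + esize (f x)) + t2))"] exI[of _ s2]) auto
      qed
    qed
    then show "\<exists>c. \<forall>s x. s n = enc x \<longrightarrow> runs c n s (?U x) (enc (r x))" by blast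
  qed
qed

lemma FP_if:
  assumes "FP p" "FP f" "FP g"
  shows "FP (\<lambda>x. if p x then f x else g x)"
  by (rule FP_case_data[OF assms(1) assms(3) FP_comp[OF FP_fst[OF FP_id] assms(2)]])
    (auto split: if_splits intro!: exI[of _ True])

lemma FP_is_DNil: "FP f \<Longrightarrow> FP (\<lambda>x. enc (f x) = DNil)"
  by (rule FP_case_data[where a = "\<lambda>_. True" and b = "\<lambda>_::_ \<times> _. False"])
    (auto intro: FP_const exI[of _ "(_, _)"])

lemma FP_case_list:
  assumes "FP f" "FP a" "FP (\<lambda>z. b (fst z) (fst (snd z)) (snd (snd z)))"
  shows "FP (\<lambda>x. case f x of [] \<Rightarrow> a x | y # ys \<Rightarrow> b x y ys)"
proof (rule FP_case_data[OF assms])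
  fix x assume "enc (f x) \<noteq> DNil"
  then obtain y ys where "f x = y # ys" by (cases "f x") auto
  then show "\<exists>z. enc z = DCons (enc x) (enc (f x)) \<and>
      (case f x of [] \<Rightarrow> a x | y # ys \<Rightarrow> b x y ys) = b (fst z) (fst (snd z)) (snd (snd z))"
    by (intro exI[of _ "(x, y, ys)"]) simp
qed auto

lemma FP_Cons:
  assumes "FP f" "FP g"
  shows "FP (\<lambda>x. f x # g x)"
  by (rule FP_coerce[OF FP_Pair[OF assms]]) simp

lemma FP_Some:
  assumes "FP f"
  shows "FP (\<lambda>x. Some (f x))"
  by (rule FP_coerce[OF FP_Pair[OF FP_const[of False] assms]]) simp

lemma FP_not: "FP p \<Longrightarrow> FP (\<lambda>x. \<not> p x)"
  by (rule FP_coerce[OF FP_if[OF _ FP_const[of False] FP_const[of True]]]) auto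

lemma FP_conj: "FP p \<Longrightarrow> FP q \<Longrightarrow> FP (\<lambda>x. p x \<and> q x)"
  by (rule FP_coerce[OF FP_if[of p q, OF _ _ FP_const[of False]]]) auto

lemma FP_null: "FP f \<Longrightarrow> FP (\<lambda>x. f x = [])"
  using FP_is_DNil[of f] by simp

text \<open>The number of rounds \<open>N x\<close> occurs only in the analysis, since the program
  stops when the test fails. The bound \<open>B\<close> on all intermediate states keeps the cost of
  each round polynomial.\<close>

lemma FP_while:
  fixes step :: "'b::encodable \<Rightarrow> 'b"
  assumes init: "FP init" and step: "FP step" and test: "FP test" and N: "pb N" and B: "pb B"
    and size: "\<And>x i. i \<le> N x \<Longrightarrow> esize ((step ^^ i) (init x)) \<le> B x"
    and go: "\<And>x i. i < N x \<Longrightarrow> test ((step ^^ i) (init x))"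
    and stop: "\<And>x. \<not> test ((step ^^ N x) (init x))"
  shows "FP (\<lambda>x. (step ^^ N x) (init x))"
proof -
  obtain Ti ci where Ti: "pb Ti" and ci: "\<And>n s x. s n = enc x \<Longrightarrow> runs (ci n) n s (Ti x) (enc (init x))"
    using FP_E[OF init] by blast
  obtain Ts cs where Ts: "pb Ts" and cs: "\<And>n s x. s n = enc x \<Longrightarrow> runs (cs n) n s (Ts x) (enc (step x))"
    using FP_E[OF step] by blast
  obtain Tt ct where Tt: "pb Tt" and ct: "\<And>n s x. s n = enc x \<Longrightarrow>
      \<exists>t s'. exec (ct n) s t s' \<and> s' (Suc n) = enc (test x) \<and> s' n = enc x \<and> (\<forall>m<n. s' m = s m) \<and> t \<le> Tt x"
    using runs_copy[OF test] by blast
  obtain ds where ds: "\<And>x b. esize x \<le> b \<Longrightarrow> Ts x \<le> (b + 2) ^ ds" using pb_majorant[OF Ts] by blast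
  obtain dt where dt: "\<And>x b. esize x \<le> b \<Longrightarrow> Tt x \<le> (b + 2) ^ dt" using pb_majorant[OF Tt] by blast
  let ?C = "\<lambda>x. 4 + (B x + 2) ^ ds + (B x + 2) ^ dt"
  let ?U = "\<lambda>x. 2 + Ti x + (B x + 2) ^ dt + (2 + N x * ?C x)"
  show ?thesis
  proof (rule FP_I)
    show "pb ?U" by (intro pb_add pb_const Ti pb_mult pb_power B N)
    fix n
    let ?w = "While (Var (Suc n)) (Seq (cs n) (ct n))"
    \<comment> \<open>Induction on the number \<open>j\<close> of rounds left. Variable
      \<open>Suc n\<close> holds the test of the current state, recomputed at the end of every
      round.\<close>
    have loop: "\<exists>t s'. exec ?w s t s' \<and> s' n = enc ((step ^^ N x) (init x)) \<and> (\<forall>m<n. s' m = s m) \<and> t \<le> 2 + j * ?C x"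
      if "j \<le> N x" "s n = enc ((step ^^ (N x - j)) (init x))"
        "s (Suc n) = enc (test ((step ^^ (N x - j)) (init x)))" for j s x
      using that
    proof (induction j arbitrary: s)
      case 0
      then show ?case using stop[of x] exec.WhileFalse[of "Var (Suc n)" s "Seq (cs n) (ct n)"]
        by (intro exI[of _ "Suc (Suc 0)"] exI[of _ s]) auto
    next
      case (Suc j)
      let ?y = "(step ^^ (N x - Suc j)) (init x)"
      let ?y' = "(step ^^ (N x - j)) (init x)"
      have y': "step ?y = ?y'" using Suc.prems(1) by (metis Suc_diff_Suc Suc_le_lessD comp_apply funpow.simps(2))
      have tst: "test ?y" using Suc.prems(1) by (intro go) auto
      obtain t1 s1 where 1: "exec (cs n) s t1 s1" "s1 n = enc ?y'" "\<forall>m<n. s1 m = s m" "t1 \<le> Ts ?y"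
        using cs[of s n ?y, OF Suc.prems(2)] y' unfolding runs_def by auto
      obtain t2 s2 where 2: "exec (ct n) s1 t2 s2" "s2 (Suc n) = enc (test ?y')" "s2 n = enc ?y'"
          "\<forall>m<n. s2 m = s1 m" "t2 \<le> Tt ?y'"
        using ct[of s1 n ?y', OF 1(2)] by blast
      have "j \<le> N x" using Suc.prems(1) by simp
      from Suc.IH[OF this 2(3) 2(2)] obtain t3 s3 where 3: "exec ?w s2 t3 s3"
          "s3 n = enc ((step ^^ N x) (init x))" "\<forall>m<n. s3 m = s2 m" "t3 \<le> 2 + j * ?C x"
        by blast
      have sv: "s (Suc n) = DCons DNil DNil" using Suc.prems(3) tst by simp
      have 4: "exec ?w s (1 + exp_cost (Var (Suc n)) s + (1 + t1 + t2) + t3) s3"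
        by (rule exec.WhileTrue[OF _ exec.Seq[OF 1(1) 2(1)] 3(1)]) (simp add: sv)
      have "Ts ?y \<le> (B x + 2) ^ ds" by (intro ds size) simp
      moreover have "Tt ?y' \<le> (B x + 2) ^ dt" by (intro dt size) simp
      ultimately have "1 + exp_cost (Var (Suc n)) s + (1 + t1 + t2) + t3 \<le> 2 + Suc j * ?C x"
        using 1(4) 2(5) 3(4) sv by simp
      then show ?case using 4 3 2 1 by (intro exI conjI) auto
    qed
    have "runs (Seq (ci n) (Seq (ct n) ?w)) n s (?U x) (enc ((step ^^ N x) (init x)))" if s: "s n = enc x" for s x
    proof -
      obtain t1 s1 where 1: "exec (ci n) s t1 s1" "s1 n = enc (init x)" "\<forall>m<n. s1 m = s m" "t1 \<le> Ti x"
        using ci[of s n x, OF s] unfolding runs_def by auto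
      obtain t2 s2 where 2: "exec (ct n) s1 t2 s2" "s2 (Suc n) = enc (test (init x))" "s2 n = enc (init x)"
          "\<forall>m<n. s2 m = s1 m" "t2 \<le> Tt (init x)"
        using ct[of s1 n "init x", OF 1(2)] by blast
      obtain t3 s3 where 3: "exec ?w s2 t3 s3"
          "s3 n = enc ((step ^^ N x) (init x))" "\<forall>m<n. s3 m = s2 m" "t3 \<le> 2 + N x * ?C x"
        using loop[of "N x" x s2] 2 by auto
      have "Tt (init x) \<le> (B x + 2) ^ dt" using size[of 0 x] by (intro dt) simp
      then have "1 + t1 + (1 + t2 + t3) \<le> ?U x" using 1(4) 2(5) 3(4) by linarith
      then show ?thesis unfolding runs_def
        using exec.Seq[OF 1(1) exec.Seq[OF 2(1) 3(1)]] 1 2 3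
        by (intro exI[of _ "1 + t1 + (1 + t2 + t3)"] exI[of _ s3]) auto
    qed
    then show "\<exists>c. \<forall>s x. s n = enc x \<longrightarrow> runs c n s (?U x) (enc ((step ^^ N x) (init x)))" by blast
  qed
qed

text \<open>The measure bounds the first \<open>i\<close> at which the test fails, and this
  \<open>i\<close> is the number of rounds.\<close>

lemma FP_while_measure:
  fixes step :: "'b::encodable \<Rightarrow> 'b"
  assumes init: "FP init" and step: "FP step" and test: "FP test" and m: "pb (\<lambda>x. m (init x))"
    and B: "pb B"
    and decr: "\<And>y. test y \<Longrightarrow> m (step y) < (m y :: nat)"
    and size: "\<And>x i. esize ((step ^^ i) (init x)) \<le> B x"
    and out: "\<And>x i. \<not> test ((step ^^ i) (init x)) \<Longrightarrow> out x = (step ^^ i) (init x)"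
  shows "FP out"
proof -
  have ex: "\<exists>i\<le>m y. \<not> test ((step ^^ i) y)" for y
  proof (induction "m y" arbitrary: y rule: less_induct)
    case less
    show ?case
    proof (cases "test y")
      case True
      from less[OF decr[OF True]] obtain i where "i \<le> m (step y)" "\<not> test ((step ^^ i) (step y))"
        by blast
      then show ?thesis using decr[OF True]
        by (intro exI[of _ "Suc i"]) (simp add: funpow_swap1)
    qed (auto intro: exI[of _ 0])
  qed
  define N where "N x = (LEAST i. \<not> test ((step ^^ i) (init x)))" for x
  have N: "\<not> test ((step ^^ N x) (init x))" "N x \<le> m (init x)" for x
  proof -
    obtain i where i: "i \<le> m (init x)" "\<not> test ((step ^^ i) (init x))" using ex by blast
    show "\<not> test ((step ^^ N x) (init x))" unfolding N_def using i(2) by (rule LeastI)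
    have "N x \<le> i" unfolding N_def using i(2) by (rule Least_le)
    then show "N x \<le> m (init x)" using i(1) by simp
  qed
  have "FP (\<lambda>x. (step ^^ N x) (init x))"
  proof (rule FP_while[OF init step test pb_mono[OF m] B])
    show "test ((step ^^ i) (init x))" if "i < N x" for x i
      using not_less_Least[OF that[unfolded N_def]] by simp
  qed (simp_all add: N size)
  then show ?thesis by (rule FP_coerce) (simp add: out[OF N(1)])
qed

text \<open>Injectivity of \<open>enc\<close> reduces equality to equality of trees. For lack of
  recursion the pairs still to be compared are kept on a stack. A mismatch empties the stack, so
  that the final state depends on the answer alone.\<close>

lemma FP_eq:
  assumes "FP (f :: 'a::encodable \<Rightarrow> 'b::encodable)" "FP g"
  shows "FP (\<lambda>x. f x = g x)"
proof -
  let ?test = "\<lambda>st :: (data \<times> data) list \<times> bool. fst st \<noteq> []"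
  let ?step = "\<lambda>st :: (data \<times> data) list \<times> bool. case fst st of [] \<Rightarrow> st
    | p # ps \<Rightarrow> if enc (fst p) = DNil then (if enc (snd p) = DNil then (ps, snd st) else ([], False))
        else if enc (snd p) = DNil then ([], False)
        else ((dhd (fst p), dhd (snd p)) # (dtl (fst p), dtl (snd p)) # ps, snd st)"
  \<comment> \<open>Splitting a pair whose first tree has subtrees of sizes a and b replaces 3 + 2a
    + 2b by 2 + 2a + 2b; without the factor 2 the measure would not drop.\<close>
  let ?m = "\<lambda>st :: (data \<times> data) list \<times> bool. \<Sum>p\<leftarrow>fst st. 1 + 2 * size (fst p)"
  let ?init = "\<lambda>z :: data \<times> data. ([z], True)"
  let ?P = "\<lambda>(st :: (data \<times> data) list \<times> bool). snd st \<and> (\<forall>p\<in>set (fst st). fst p = snd p)"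
  have dhd: "FP dhd" and dtl: "FP dtl" by (rule FP_dhd, simp, rule FP_dtl, simp)
  note rls = FP_case_list FP_if FP_Pair FP_fst FP_snd FP_is_DNil FP_Cons FP_const
    FP_comp[OF _ dhd] FP_comp[OF _ dtl] FP_not FP_null FP_id
  have inv: "?P (?step st) = ?P st" for st :: "(data \<times> data) list \<times> bool"
  proof (cases "fst st")
    case (Cons p ps)
    then show ?thesis by (cases "fst p"; cases "snd p") auto
  qed simp
  have inv': "?P ((?step ^^ i) st) = ?P st" for i st by (induction i) (simp_all only: funpow.simps id_apply comp_apply inv)
  have "FP (\<lambda>z. (([] :: (data \<times> data) list), fst z = (snd z :: data)))"
  proof (rule FP_while_measure[of ?init ?step ?test ?m "\<lambda>z. 10 + 10 * esize z"])
    show "FP ?init" by (intro rls)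
    show "FP ?step" by (intro rls)
    show "FP ?test" by (intro rls)
    show "pb (\<lambda>x. ?m (?init x))"
      by (rule pb_mono[OF pb_add[OF pb_const[of 1] pb_mult[OF pb_const[of 2] pb_esize]]]) (auto split: prod.split)
    show "pb (\<lambda>z::data \<times> data. 10 + 10 * esize z)" by (intro pb_add pb_const pb_mult pb_esize)
    show "?m (?step y) < ?m y" if "?test y" for y
    proof (cases "fst y")
      case (Cons p ps)
      then show ?thesis by (cases "fst p"; cases "snd p") auto
    qed (use that in simp)
    show "esize ((?step ^^ i) (?init x)) \<le> 10 + 10 * esize x" for x i
    proof -
      let ?S = "\<lambda>st :: (data \<times> data) list \<times> bool. \<Sum>p\<leftarrow>fst st. 2 + 2 * size (fst p) + 2 * size (snd p)"
      have S: "?S (?step st) \<le> ?S st" for st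
      proof (cases "fst st")
        case (Cons p ps)
        then show ?thesis by (cases "fst p"; cases "snd p") auto
      qed simp
      have "?S ((?step ^^ i) (?init x)) \<le> ?S (?init x)"
      proof (induction i)
        case (Suc i)
        show ?case using order_trans[OF S Suc] by (simp only: funpow.simps comp_apply)
      qed simp
      moreover have "esize st \<le> 2 + ?S st" for st
      proof -
        have "esize xs \<le> (\<Sum>p\<leftarrow>xs. 2 + 2 * size (fst p) + 2 * size (snd p))" for xs :: "(data \<times> data) list"
          by (induction xs) auto
        from this[of "fst st"] show ?thesis by (cases st) auto
      qed
      ultimately have "esize ((?step ^^ i) (?init x)) \<le> 2 + ?S (?init x)"
        using add_left_mono order_trans by blast
      also have "\<dots> \<le> 10 + 10 * esize x" by (cases x) simp
      finally show ?thesis .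
    qed
    show "([], fst x = snd x) = (?step ^^ i) (?init x)" if "\<not> ?test ((?step ^^ i) (?init x))" for x i
      using that inv'[of i "?init x"] by (cases "(?step ^^ i) (?init x)") auto
  qed
  from FP_snd[OF this] have eq: "FP (\<lambda>z. fst z = (snd z :: data))" by simp
  have enc: "FP (\<lambda>x. enc (h x))" if "FP h" for h :: "'a \<Rightarrow> 'b" by (rule FP_coerce[OF that]) simp
  from FP_comp2[of "\<lambda>x y. x = y", OF eq enc[OF assms(1)] enc[OF assms(2)]] show ?thesis by simp
qed

section \<open>List functions\<close>

lemma esize_list: "esize xs = length xs + (\<Sum>x\<leftarrow>xs. esize x)"
  by (induction xs) auto

lemma length_le_esize: "length xs \<le> esize xs"
  by (simp add: esize_list)

lemma esize_le_esize_list: "x \<in> set xs \<Longrightarrow> esize x \<le> esize xs"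
  by (induction xs) auto

lemma esize_list_le:
  assumes "length xs \<le> l" "\<And>x. x \<in> set xs \<Longrightarrow> esize x \<le> b"
  shows "esize xs \<le> l * (b + 1)"
proof -
  have "esize xs \<le> length xs * (b + 1)" using assms(2) by (induction xs) fastforce+
  then show ?thesis using assms(1) mult_le_mono1 order_trans by blast
qed

lemma esize_take: "esize (take i xs) \<le> esize xs" and esize_drop: "esize (drop i xs) \<le> esize xs"
proof -
  have "esize (us @ vs) = esize us + esize vs" for us vs :: "'a list" by (simp add: esize_list)
  from this[of "take i xs" "drop i xs"]
  show "esize (take i xs) \<le> esize xs" "esize (drop i xs) \<le> esize xs" by simp_all
qed

text \<open>A polynomial step alone is not enough, since doubling the accumulator in every round
  leads to exponential size. Hence the bound on the accumulators of all prefixes.\<close>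

lemma FP_fold:
  assumes f: "FP (\<lambda>z. f (fst z) (fst (snd z)) (snd (snd z)))" and g: "FP g" and h: "FP h" and B: "pb B"
    and size: "\<And>x i. i \<le> length (g x) \<Longrightarrow> esize (fold (f x) (take i (g x)) (h x)) \<le> B x"
  shows "FP (\<lambda>x. fold (f x) (g x) (h x))"
proof -
  let ?step = "\<lambda>st. case fst (snd st) of [] \<Rightarrow> st | y # ys \<Rightarrow> (fst st, ys, f (fst st) y (snd (snd st)))"
  have *: "(?step ^^ i) (x, ys, a) = (x, drop i ys, fold (f x) (take i ys) a)" if "i \<le> length ys" for i x ys a
    using that
  proof (induction i)
    case (Suc i)
    then have "drop i ys = ys ! i # drop (Suc i) ys" "take (Suc i) ys = take i ys @ [ys ! i]"
      by (simp_all add: Cons_nth_drop_Suc take_Suc_conv_app_nth)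
    with Suc show ?case by simp
  qed simp
  have "FP (\<lambda>x. (?step ^^ length (g x)) (x, g x, h x))"
  proof (rule FP_while)
    show "FP (\<lambda>x. (x, g x, h x))" by (intro FP_Pair FP_id g h)
    have "FP (\<lambda>x. (\<lambda>z. f (fst z) (fst (snd z)) (snd (snd z))) (fst (fst x), fst (snd x), snd (snd (fst x))))"
      by (rule FP_comp[OF _ f]) (intro FP_Pair FP_fst FP_snd FP_id)
    then have F: "FP (\<lambda>x. f (fst (fst x)) (fst (snd x)) (snd (snd (fst x))))" by simp
    show "FP ?step" by (intro FP_case_list FP_Pair FP_fst FP_snd FP_id F)
    show "FP (\<lambda>st. fst (snd st) \<noteq> [])" by (intro FP_not FP_null FP_fst FP_snd FP_id)
    show "pb (\<lambda>x. length (g x))" by (rule pb_mono[OF FP_size[OF g] length_le_esize])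
    show "pb (\<lambda>x. 2 + esize x + esize (g x) + B x)" by (intro pb_add pb_const pb_esize FP_size g B)
    show "esize ((?step ^^ i) (x, g x, h x)) \<le> 2 + esize x + esize (g x) + B x" if "i \<le> length (g x)" for x i
      using *[OF that, of x "h x"] size[OF that] esize_drop[of i "g x"] by simp
    show "fst (snd ((?step ^^ i) (x, g x, h x))) \<noteq> []" if "i < length (g x)" for x i
      using *[of i "g x" x "h x"] that by simp
    show "\<not> fst (snd ((?step ^^ length (g x)) (x, g x, h x))) \<noteq> []" for x
      using *[of "length (g x)" "g x" x "h x"] by simp
  qed
  from FP_snd[OF FP_snd[OF this]] show ?thesis by (simp add: *)
qed

lemma FP_rev:
  assumes g: "FP (g :: 'a::encodable \<Rightarrow> 'c::encodable list)"
  shows "FP (\<lambda>x. rev (g x))"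
proof -
  have *: "fold (\<lambda>y ys. y # ys) xs ys = rev xs @ ys" for xs ys :: "'c list"
    by (induction xs arbitrary: ys) auto
  have size: "esize (rev (take i xs)) \<le> esize xs" for i and xs :: "'c list"
    using esize_take[of i xs] by (simp add: esize_list flip: rev_map)
  have "FP (\<lambda>x. fold (\<lambda>y ys. y # ys) (g x) [])"
  proof (rule FP_fold[where f = "\<lambda>_ y ys. y # ys" and B = "\<lambda>x. esize (g x)"])
    show "esize (fold (\<lambda>y ys. y # ys) (take i (g x)) []) \<le> esize (g x)" for i x
      by (simp add: * size)
  qed (intro FP_Cons FP_fst FP_snd FP_id FP_const FP_size g)+
  then show ?thesis by (simp add: *)
qed

lemma FP_append:
  assumes "FP f" "FP g"
  shows "FP (\<lambda>x. f x @ g x)"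
proof -
  have *: "fold (\<lambda>y ys. y # ys) xs ys = rev xs @ ys" for xs ys :: "'b list"
    by (induction xs arbitrary: ys) auto
  have size: "esize (rev (take i xs) @ ys) \<le> esize (rev xs) + esize ys" for i and xs ys :: "'b list"
    using esize_take[of i xs] by (simp add: esize_list flip: rev_map)
  have "FP (\<lambda>x. fold (\<lambda>y ys. y # ys) (rev (f x)) (g x))"
  proof (rule FP_fold[where f = "\<lambda>_ y ys. y # ys" and B = "\<lambda>x. esize (f x) + esize (g x)"])
    show "esize (fold (\<lambda>y ys. y # ys) (take i (rev (f x))) (g x)) \<le> esize (f x) + esize (g x)" for i x
      using size[of i "rev (f x)" "g x"] by (simp add: *)
  qed (intro FP_Cons FP_fst FP_snd FP_id pb_add FP_size FP_rev assms)+
  then show ?thesis by (simp add: *)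
qed

lemma FP_map:
  assumes F: "FP (\<lambda>z. F (fst z) (snd z))" and g: "FP g"
  shows "FP (\<lambda>x. map (F x) (g x))"
proof -
  have *: "fold (\<lambda>y ys. h y # ys) xs ys = rev (map h xs) @ ys" for h :: "'b \<Rightarrow> 'c" and xs ys
    by (induction xs arbitrary: ys) auto
  obtain d where d: "\<And>z b. esize z \<le> b \<Longrightarrow> esize (F (fst z) (snd z)) \<le> (b + 2) ^ d"
    using pb_majorant[OF FP_size[OF F]] by blast
  let ?B = "\<lambda>x. esize (g x) * ((esize x + esize (g x) + 1 + 2) ^ d + 1)"
  have "FP (\<lambda>x. fold (\<lambda>y ys. F x y # ys) (g x) [])"
  proof (rule FP_fold[where f = "\<lambda>x y ys. F x y # ys" and B = ?B])
    show "FP (\<lambda>z. F (fst z) (fst (snd z)) # snd (snd z))"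
      by (intro FP_Cons FP_comp2[of F, OF F] FP_fst FP_snd FP_id)
    show "pb ?B" by (intro pb_mult pb_add pb_power pb_const pb_esize FP_size g)
    show "esize (fold (\<lambda>y ys. F x y # ys) (take i (g x)) []) \<le> ?B x" for x i
    proof (rule esize_list_le)
      show "length (fold (\<lambda>y ys. F x y # ys) (take i (g x)) []) \<le> esize (g x)"
        using length_le_esize[of "g x"] by (simp add: *)
      fix w assume "w \<in> set (fold (\<lambda>y ys. F x y # ys) (take i (g x)) [])"
      then obtain y where "y \<in> set (g x)" "w = F x y" using set_take_subset[of i "g x"] by (auto simp: *)
      then show "esize w \<le> (esize x + esize (g x) + 1 + 2) ^ d"
        using d[of "(x, y)" "esize x + esize (g x) + 1"] esize_le_esize_list[of y "g x"] by simp
    qed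
  qed (intro FP_const g)+
  from FP_rev[OF this] show ?thesis by (simp add: *)
qed

lemma FP_concat:
  assumes "FP g"
  shows "FP (\<lambda>x. concat (g x))"
proof -
  have *: "fold (\<lambda>y ys. ys @ y) xs ys = ys @ concat xs" for xs and ys :: "'b list"
    by (induction xs arbitrary: ys) auto
  have size: "esize (concat xs) \<le> esize xs" for xs :: "'b list list"
    by (induction xs) (auto simp: esize_list)
  have "FP (\<lambda>x. fold (\<lambda>y ys. ys @ y) (g x) [])"
  proof (rule FP_fold[where f = "\<lambda>_ y ys. ys @ y" and B = "\<lambda>x. esize (g x)"])
    show "esize (fold (\<lambda>y ys. ys @ y) (take i (g x)) []) \<le> esize (g x)" for i x
      using order_trans[OF size esize_take, of i "g x"] by (simp add: *)
  qed (intro FP_append FP_fst FP_snd FP_id FP_size FP_const assms)+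
  then show ?thesis by (simp add: *)
qed

lemma FP_filter:
  assumes "FP (\<lambda>z. P (fst z) (snd z))" "FP g"
  shows "FP (\<lambda>x. filter (P x) (g x))"
proof -
  have "concat (map (\<lambda>y. if Q y then [y] else []) xs) = filter Q xs" for Q :: "'b \<Rightarrow> bool" and xs
    by (induction xs) auto
  moreover have "FP (\<lambda>x. concat (map (\<lambda>y. if P x y then [y] else []) (g x)))"
    by (intro FP_concat FP_map FP_if FP_Cons FP_fst FP_snd FP_id FP_const assms)
  ultimately show ?thesis by simp
qed

lemma FP_Bex:
  assumes "FP (\<lambda>z. P (fst z) (snd z))" "FP g"
  shows "FP (\<lambda>x. \<exists>y\<in>set (g x). P x y)"
  by (rule FP_coerce[OF FP_not[OF FP_null[OF FP_filter[OF assms]]]]) (auto simp: filter_empty_conv)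

lemma FP_Ball:
  assumes "FP (\<lambda>z. P (fst z) (snd z))" "FP g"
  shows "FP (\<lambda>x. \<forall>y\<in>set (g x). P x y)"
  by (rule FP_coerce[OF FP_null[OF FP_filter[OF FP_not[OF assms(1)] assms(2)]]]) (auto simp: filter_empty_conv)

lemma FP_member:
  assumes "FP f" "FP g"
  shows "FP (\<lambda>x. f x \<in> set (g x))"
  by (rule FP_coerce[OF FP_Bex[where P = "\<lambda>x y. y = f x"]])
    (auto intro!: FP_eq FP_comp[OF FP_fst] FP_fst FP_snd FP_id assms)

text \<open>The algorithm compares numbers only in this form: the first list is shortened once for
  every element of the second.\<close>

lemma FP_length_le:
  assumes "FP (f :: 'a::encodable \<Rightarrow> 'b::encodable list)" "FP (g :: 'a \<Rightarrow> 'c::encodable list)"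
  shows "FP (\<lambda>x. length (f x) \<le> length (g x))"
proof -
  have *: "fold (\<lambda>_ ys. tl ys) (zs :: 'c list) ys = drop (length zs) ys" for zs and ys :: "'b list"
    by (induction zs arbitrary: ys) (auto simp: drop_Suc)
  have "FP (\<lambda>x. fold (\<lambda>_ ys. tl ys) (g x) (f x))"
  proof (rule FP_fold[where f = "\<lambda>_ _ ys. tl ys" and B = "\<lambda>x. esize (f x)"])
    show "esize (fold (\<lambda>_ ys. tl ys) (take i (g x)) (f x)) \<le> esize (f x)" for i x
      by (simp only: * esize_drop)
  qed (intro FP_tl FP_fst FP_snd FP_id FP_size assms)+
  from FP_null[OF this] show ?thesis by (simp add: *)
qed

text \<open>Besides listing pairs of candidates this serves as multiplication, by way of the length
  of the product.\<close>

lemma FP_product: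
  assumes "FP f" "FP g"
  shows "FP (\<lambda>x. List.product (f x) (g x))"
proof -
  have "List.product xs ys = concat (map (\<lambda>a. map (Pair a) ys) xs)" for xs :: "'b list" and ys :: "'c list"
    by (induction xs) auto
  moreover have "FP (\<lambda>x. concat (map (\<lambda>a. map (Pair a) (g x)) (f x)))"
    by (intro FP_concat FP_map FP_Pair FP_fst FP_snd FP_id FP_comp[OF FP_fst assms(2)] assms(1))
  ultimately show ?thesis by simp
qed

lemma FP_funpow:
  fixes F :: "'a::encodable \<Rightarrow> 'b::encodable \<Rightarrow> 'b"
  assumes "FP (\<lambda>z. F (fst z) (snd z))" "FP (g :: 'a \<Rightarrow> 'c::encodable list)" "FP h" "pb B"
    and "\<And>x i. i \<le> length (g x) \<Longrightarrow> esize ((F x ^^ i) (h x)) \<le> B x"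
  shows "FP (\<lambda>x. (F x ^^ length (g x)) (h x))"
proof -
  have *: "fold (\<lambda>_. F x) ys y = (F x ^^ length ys) y" for x y and ys :: "'c list"
    by (induction ys arbitrary: y) (auto simp: funpow_swap1)
  have "FP (\<lambda>x. fold (\<lambda>_. F x) (g x) (h x))"
  proof (rule FP_fold[where f = "\<lambda>x _ ys. F x ys" and B = B])
    show "FP (\<lambda>z :: 'a \<times> 'c \<times> 'b. F (fst z) (snd (snd z)))"
      by (intro FP_comp2[of F, OF assms(1)] FP_fst FP_snd FP_id)
  qed (simp_all add: assms *)
  then show ?thesis by (simp add: *)
qed

section \<open>The algorithm\<close>

lemmas FP_fst0 = FP_fst[OF FP_id] and FP_snd0 = FP_snd[OF FP_id]

lemmas FP_rules = FP_fst0 FP_snd0 FP_const FP_id FP_fst FP_snd FP_Pair FP_null FP_eq FP_member FP_length_le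
  FP_Ball FP_Bex FP_not FP_conj FP_Cons FP_append FP_tl FP_map FP_filter FP_concat
  FP_product FP_Some FP_if FP_case_list

definition first_or :: "'a \<Rightarrow> 'a list \<Rightarrow> 'a" where
  "first_or x ys = (case ys of [] \<Rightarrow> x | y # _ \<Rightarrow> y)"

lemma FP_first_or: "FP f \<Longrightarrow> FP g \<Longrightarrow> FP (\<lambda>x. first_or (f x) (g x))"
  unfolding first_or_def by (intro FP_rules)

lemma first_or_in: "first_or x ys \<in> insert x (set ys)"
  by (cases ys) (auto simp: first_or_def)

section \<open>Arcs, search trees and path reversal\<close>

type_synonym ('i, 'a) arc = "'i \<times> 'a \<times> 'a"

definition tail :: "('i, 'a) arc \<Rightarrow> 'a" where "tail a = fst (snd a)"
definition head :: "('i, 'a) arc \<Rightarrow> 'a" where "head a = snd (snd a)"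
text \<open>The tag stays, so an arc keeps its identity under reversal and parallel edges remain
  distinguishable.\<close>

definition turn :: "('i, 'a) arc \<Rightarrow> ('i, 'a) arc" where "turn a = (fst a, head a, tail a)"

lemma arc_simps [simp]:
  "tail (i, u, v) = u" "head (i, u, v) = v" "turn (i, u, v) = (i, v, u)"
  "fst (turn a) = fst a" "tail (turn a) = head a" "head (turn a) = tail a" "turn (turn a) = a"
  by (simp_all add: tail_def head_def turn_def)

lemma FP_tail: "FP f \<Longrightarrow> FP (\<lambda>x. tail (f x))" and FP_head: "FP f \<Longrightarrow> FP (\<lambda>x. head (f x))"
  unfolding tail_def head_def by (intro FP_rules; assumption)+

lemma FP_turn: "FP f \<Longrightarrow> FP (\<lambda>x. turn (f x))"
  unfolding turn_def by (intro FP_rules FP_tail FP_head)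

lemma esize_turn [simp]: "esize (turn a) = esize a"
  by (cases a) simp

text \<open>Greedy growth, newest element first; it yields both search trees and the paths traced
  back in them. As many rounds as \<open>D\<close> has elements suffice if \<open>P\<close> never
  admits an element twice.\<close>

definition push :: "('a \<Rightarrow> 'a list \<Rightarrow> bool) \<Rightarrow> 'a list \<Rightarrow> 'a list \<Rightarrow> 'a list" where
  "push P D xs = (case filter (\<lambda>a. P a xs) D of [] \<Rightarrow> xs | a # _ \<Rightarrow> a # xs)"

definition pushes :: "('a \<Rightarrow> 'a list \<Rightarrow> bool) \<Rightarrow> 'a list \<Rightarrow> 'a list" where
  "pushes P D = (push P D ^^ length D) []"

lemma push_cases:
  obtains "push P D xs = xs" "\<forall>a\<in>set D. \<not> P a xs"
  | a where "push P D xs = a # xs" "a \<in> set D" "P a xs"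
proof (cases "filter (\<lambda>a. P a xs) D")
  case Nil
  then show ?thesis using that(1) by (simp add: push_def filter_empty_conv)
next
  case (Cons a as)
  have "a \<in> set (filter (\<lambda>a. P a xs) D)" unfolding Cons by simp
  then have "a \<in> set D" "P a xs" by auto
  moreover have "push P D xs = a # xs" using Cons by (simp add: push_def)
  ultimately show ?thesis using that(2) by blast
qed

lemma push_iterates: "set ((push P D ^^ i) []) \<subseteq> set D \<and> length ((push P D ^^ i) []) \<le> i"
proof (induction i)
  case (Suc i)
  then show ?case by (cases rule: push_cases[of P D "(push P D ^^ i) []"]) auto
qed simp

lemma FP_pushes:
  assumes P: "FP (\<lambda>z. P (fst z) (fst (snd z)) (snd (snd z)))" and g: "FP g"
  shows "FP (\<lambda>x. pushes (P x) (g x))"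
  unfolding pushes_def
proof (rule FP_funpow[where F = "\<lambda>x. push (P x) (g x)" and h = "\<lambda>_. []"])
  have "FP (\<lambda>z. P (fst (fst z)) (snd z) (snd (fst z)))"
    using FP_comp[OF _ P, of "\<lambda>z. (fst (fst z), snd z, snd (fst z))"] by (simp add: FP_rules)
  then show "FP (\<lambda>z. push (P (fst z)) (g (fst z)) (snd z))"
    unfolding push_def by (intro FP_rules FP_comp[OF _ g])
  show "pb (\<lambda>x. esize (g x) * (esize (g x) + 1))"
    by (intro pb_mult pb_add pb_const FP_size g)
  show "esize ((push (P x) (g x) ^^ i) []) \<le> esize (g x) * (esize (g x) + 1)" if "i \<le> length (g x)" for x i
    using push_iterates[of i "P x" "g x"] that length_le_esize[of "g x"]
    by (intro esize_list_le) (auto intro: esize_le_esize_list)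
qed (intro FP_rules g)+

definition grow :: "'a \<Rightarrow> ('i, 'a) arc list \<Rightarrow> ('i, 'a) arc list" where
  "grow r D = pushes (\<lambda>a T. tail a \<in> set (r # map head T) \<and> head a \<notin> set (r # map head T)) D"

definition reached :: "'a \<Rightarrow> ('i, 'a) arc list \<Rightarrow> 'a list" where
  "reached r D = r # map head (grow r D)"

text \<open>The path is grown backwards from \<open>t\<close>, so consing leaves it in walking
  order. In a search tree at most one arc can be chosen each time, and the process ends at the
  root.\<close>

definition trace :: "'a \<Rightarrow> ('i, 'a) arc list \<Rightarrow> ('i, 'a) arc list" where
  "trace t T = pushes (\<lambda>a p. head a = (case p of [] \<Rightarrow> t | b # _ \<Rightarrow> tail b)) T"

text \<open>The path is taken from the search tree of \<open>s\<close>. After its reversal one more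
  arc enters \<open>s\<close> and one fewer enters \<open>t\<close>.\<close>

definition reroute :: "'a \<Rightarrow> 'a \<Rightarrow> ('i, 'a) arc list \<Rightarrow> ('i, 'a) arc list" where
  "reroute s t D = map (\<lambda>a. if a \<in> set (trace t (grow s D)) then turn a else a) D"

lemma FP_grow: "FP f \<Longrightarrow> FP g \<Longrightarrow> FP (\<lambda>x. grow (f x) (g x))"
  by (erule (1) FP_comp2[of grow, rotated])
    (unfold grow_def, rule FP_pushes; intro FP_rules FP_tail FP_head)

lemma FP_reached: "FP f \<Longrightarrow> FP g \<Longrightarrow> FP (\<lambda>x. reached (f x) (g x))"
  unfolding reached_def by (intro FP_rules FP_grow FP_head)

lemma FP_trace: "FP f \<Longrightarrow> FP g \<Longrightarrow> FP (\<lambda>x. trace (f x) (g x))"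
  by (erule (1) FP_comp2[of trace, rotated])
    (unfold trace_def, rule FP_pushes; intro FP_rules FP_tail FP_head)

lemma FP_reroute:
  assumes "FP f" "FP g" "FP h"
  shows "FP (\<lambda>x. reroute (f x) (g x) (h x))"
proof -
  have "FP (\<lambda>z. reroute (fst z) (fst (snd z)) (snd (snd z)))"
    unfolding reroute_def by (intro FP_rules FP_trace FP_grow FP_turn)
  from FP_comp[OF _ this, of "\<lambda>x. (f x, g x, h x)"] show ?thesis by (simp add: FP_rules assms)
qed

section \<open>Degrees, copies and the two local searches\<close>

definition into :: "('i, 'a) arc list \<Rightarrow> 'a \<Rightarrow> ('i, 'a) arc list" where
  "into D v = filter (\<lambda>a. head a = v) D"

text \<open>A loop at \<open>v\<close> is listed twice, so the length of the list is the
  degree.\<close>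

definition incid :: "('i, 'a) arc list \<Rightarrow> 'a \<Rightarrow> ('i, 'a) arc list" where
  "incid D v = filter (\<lambda>a. tail a = v) D @ into D v"

lemma FP_into: "FP f \<Longrightarrow> FP g \<Longrightarrow> FP (\<lambda>x. into (f x) (g x))"
  by (erule (1) FP_comp2[of into, rotated]) (unfold into_def, intro FP_rules FP_head)

lemma FP_incid: "FP f \<Longrightarrow> FP g \<Longrightarrow> FP (\<lambda>x. incid (f x) (g x))"
  by (erule (1) FP_comp2[of incid, rotated]) (unfold incid_def, intro FP_rules FP_tail FP_into)

text \<open>
  In the following, the degree bound is the length of K. The copies of a vertex in the preimage are
  named by the tags of the arcs that enter it; r has in addition the root copy \<open>\<rho>\<close>.
\<close>

definition copies :: "'i \<Rightarrow> 'a \<Rightarrow> ('i, 'a) arc list \<Rightarrow> 'a \<Rightarrow> 'i list" where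
  "copies \<rho> r D v = (if v = r then [\<rho>] else []) @ map fst (into D v)"

definition enough :: "unit list \<Rightarrow> 'i \<Rightarrow> 'a \<Rightarrow> ('i, 'a) arc list \<Rightarrow> 'a \<Rightarrow> bool" where
  "enough K \<rho> r D v \<longleftrightarrow> length (incid D v) \<le> length (List.product K (copies \<rho> r D v))"

text \<open>The possible ends of a reversal: vertices that can give up an entering arc, and with it
  a copy, without getting into deficit.\<close>

definition spare :: "unit list \<Rightarrow> 'i \<Rightarrow> 'a \<Rightarrow> ('i, 'a) arc list \<Rightarrow> 'a \<Rightarrow> bool" where
  "spare K \<rho> r D v \<longleftrightarrow> into D v \<noteq> [] \<and>
    length (incid D v) \<le> length (List.product K (tl (copies \<rho> r D v)))"

definition rooted :: "'a \<Rightarrow> 'a list \<Rightarrow> ('i, 'a) arc list \<Rightarrow> bool" where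
  "rooted r V D \<longleftrightarrow> (\<forall>v\<in>set V. v \<in> set (reached r D))"

definition improve :: "unit list \<Rightarrow> 'i \<Rightarrow> 'a \<Rightarrow> 'a list \<Rightarrow> ('i, 'a) arc list \<Rightarrow> ('i, 'a) arc list" where
  "improve K \<rho> r V D = first_or D (filter (rooted r V)
    (map (\<lambda>p. reroute (fst p) (snd p) D)
      (filter (\<lambda>p. \<not> enough K \<rho> r D (fst p) \<and> spare K \<rho> r D (snd p) \<and> snd p \<in> set (reached (fst p) D))
        (List.product V V))))"

text \<open>A search in the underlying graph, where each edge is offered in both directions; the
  edges that the tree crosses backwards are turned.\<close>

definition orient0 :: "'a \<Rightarrow> ('i, 'a) arc list \<Rightarrow> ('i, 'a) arc list" where
  "orient0 r E = map (\<lambda>a. if turn a \<in> set (grow r (E @ map turn E)) then turn a else a) E"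

text \<open>Every effective round lowers the total deficit, which is at most the sum of the degrees;
  this gives the number of rounds.\<close>

definition optimum :: "unit list \<Rightarrow> 'i \<Rightarrow> 'a \<Rightarrow> 'a list \<Rightarrow> ('i, 'a) arc list \<Rightarrow> ('i, 'a) arc list" where
  "optimum K \<rho> r V E = (improve K \<rho> r V ^^ length (E @ E)) (orient0 r E)"

text \<open>The copy of \<open>u\<close> to which all children are attached at first: the one
  created by the tree arc entering \<open>u\<close>. For \<open>u\<close> reachable from
  \<open>r\<close> the default of \<open>first_or\<close> is never met.\<close>

definition origin :: "'i \<Rightarrow> 'a \<Rightarrow> ('i, 'a) arc list \<Rightarrow> 'a \<Rightarrow> 'i" where
  "origin \<rho> r D u = (if u = r then \<rho> else first_or \<rho> (map fst (into (grow r D) u)))"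

text \<open>
  The preimage is a list of arcs whose heads and tails are copies and whose tags are the vertices
  that the tails are copies of.
\<close>

definition split0 :: "'i \<Rightarrow> 'a \<Rightarrow> ('i, 'a) arc list \<Rightarrow> ('a, 'i) arc list" where
  "split0 \<rho> r D = map (\<lambda>a. (tail a, origin \<rho> r D (tail a), fst a)) D"

definition rehang :: "('a, 'i) arc \<Rightarrow> 'i \<Rightarrow> ('a, 'i) arc list \<Rightarrow> ('a, 'i) arc list" where
  "rehang h b H = map (\<lambda>h'. if h' = h then (fst h, b, head h) else h') H"

text \<open>Strict inequalities appear as negations because lengths are compared by
  \<open>FP_length_le\<close>. Testing reachability after the move rules out that a subtree is hung
  below itself.\<close>

definition balance ::
  "unit list \<Rightarrow> 'i \<Rightarrow> 'a \<Rightarrow> ('i, 'a) arc list \<Rightarrow> ('a, 'i) arc list \<Rightarrow> ('a, 'i) arc list" where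
  "balance K \<rho> r D H = first_or H (filter (rooted \<rho> (\<rho> # map fst D))
    (map (\<lambda>p. rehang (fst p) (snd p) H)
      (filter (\<lambda>p. snd p \<in> set (copies \<rho> r D (fst (fst p))) \<and>
          \<not> length (incid H (tail (fst p))) \<le> length K \<and> \<not> length K \<le> length (incid H (snd p)))
        (List.product H (\<rho> # map fst D)))))"

definition splitting :: "unit list \<Rightarrow> 'i \<Rightarrow> 'a \<Rightarrow> ('i, 'a) arc list \<Rightarrow> ('a, 'i) arc list" where
  "splitting K \<rho> r D = (balance K \<rho> r D ^^ length (D @ D)) (split0 \<rho> r D)"

text \<open>The tags will also name vertices of the tree, hence numbers. The length of the
  accumulator supplies a fresh one each time.\<close>

definition number :: "'a list \<Rightarrow> (nat \<times> 'a) list" where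
  "number xs = fold (\<lambda>x acc. (2 ^ length acc - 1, x) # acc) xs []"

fun bits :: "nat \<Rightarrow> bool list" where
  "bits n = (if n = 0 then [] else odd n # bits (n div 2))"

declare bits.simps [simp del]

definition clip :: "unit list \<Rightarrow> unit list \<Rightarrow> unit list" where
  "clip L xs = (if length xs \<le> length L then xs else L)"

text \<open>Conversion from binary to unary by repeated doubling. Saturation at the length of
  \<open>L\<close> keeps all intermediate lists short even for exponentially large
  \<open>k\<close>.\<close>

definition capped :: "unit list \<Rightarrow> nat \<Rightarrow> unit list" where
  "capped L k = snd (fold (\<lambda>b s. (clip L (fst s @ fst s), clip L (snd s @ (if b then fst s else [])))) (bits k) (clip L [()], []))"

text \<open>The cap 1 + 2|E| exceeds every degree, so on valid inputs it does not affect the answer.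
  The root copy gets the first name that no edge has. A valid input never has an empty vertex
  list.\<close>

definition solve :: "pres \<times> nat \<Rightarrow> (pres \<times> fun_table) option" where
  "solve x = (case fst (fst x) of [] \<Rightarrow> None | r # _ \<Rightarrow>
    (let V = fst (fst x); E = number (snd (fst x)); \<rho> = 2 ^ length E - 1;
      K = capped (() # map (\<lambda>_. ()) (E @ E)) (snd x); D = optimum K \<rho> r V E
    in if \<forall>v\<in>set V. enough K \<rho> r D v
      then Some ((\<rho> # map fst D, map snd (splitting K \<rho> r D)), (\<rho>, r) # map (\<lambda>a. (fst a, head a)) D)
      else None))"

section \<open>Running time of the components\<close>

lemma FP_comp3:
  assumes "FP (\<lambda>z. f (fst z) (fst (snd z)) (snd (snd z)))" "FP a" "FP b" "FP c"
  shows "FP (\<lambda>x. f (a x) (b x) (c x))"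
  using FP_comp[OF FP_Pair[OF assms(2) FP_Pair[OF assms(3,4)]] assms(1)] by simp

lemma FP_comp4:
  assumes "FP (\<lambda>z. f (fst z) (fst (snd z)) (fst (snd (snd z))) (snd (snd (snd z))))" "FP a" "FP b" "FP c" "FP d"
  shows "FP (\<lambda>x. f (a x) (b x) (c x) (d x))"
  using FP_comp[OF FP_Pair[OF assms(2) FP_Pair[OF assms(3) FP_Pair[OF assms(4,5)]]] assms(1)] by simp

lemma FP_comp5:
  assumes "FP (\<lambda>z. f (fst z) (fst (snd z)) (fst (snd (snd z))) (fst (snd (snd (snd z)))) (snd (snd (snd (snd z)))))"
    and "FP a" "FP b" "FP c" "FP d" "FP e"
  shows "FP (\<lambda>x. f (a x) (b x) (c x) (d x) (e x))"
  using FP_comp[OF FP_Pair[OF assms(2) FP_Pair[OF assms(3) FP_Pair[OF assms(4) FP_Pair[OF assms(5,6)]]]] assms(1)]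
  by simp

lemma FP_copies: "FP a \<Longrightarrow> FP b \<Longrightarrow> FP c \<Longrightarrow> FP d \<Longrightarrow> FP (\<lambda>x. copies (a x) (b x) (c x) (d x))"
  unfolding copies_def by (intro FP_rules FP_into)

lemma FP_enough: "FP a \<Longrightarrow> FP b \<Longrightarrow> FP c \<Longrightarrow> FP d \<Longrightarrow> FP e \<Longrightarrow> FP (\<lambda>x. enough (a x) (b x) (c x) (d x) (e x))"
  unfolding enough_def by (intro FP_rules FP_copies FP_incid)

lemma FP_spare: "FP a \<Longrightarrow> FP b \<Longrightarrow> FP c \<Longrightarrow> FP d \<Longrightarrow> FP e \<Longrightarrow> FP (\<lambda>x. spare (a x) (b x) (c x) (d x) (e x))"
  unfolding spare_def by (intro FP_rules FP_copies FP_incid FP_into)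

lemma FP_rooted: "FP a \<Longrightarrow> FP b \<Longrightarrow> FP c \<Longrightarrow> FP (\<lambda>x. rooted (a x) (b x) (c x))"
  by (erule (2) FP_comp3[of rooted, rotated]) (unfold rooted_def, intro FP_rules FP_reached)

lemma FP_improve:
  "FP a \<Longrightarrow> FP b \<Longrightarrow> FP c \<Longrightarrow> FP d \<Longrightarrow> FP e \<Longrightarrow> FP (\<lambda>x. improve (a x) (b x) (c x) (d x) (e x))"
  by (erule (4) FP_comp5[of improve, rotated])
    (unfold improve_def, intro FP_rules FP_first_or FP_rooted FP_reroute FP_enough FP_spare FP_reached)

lemma FP_orient0: "FP a \<Longrightarrow> FP b \<Longrightarrow> FP (\<lambda>x. orient0 (a x) (b x))"
  by (erule (1) FP_comp2[of orient0, rotated]) (unfold orient0_def, intro FP_rules FP_grow FP_turn)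

lemma esize_map_if_turn: "esize (map (\<lambda>a. if Q a then turn a else a) D) = esize D"
  by (induction D) auto

lemma improve_cases:
  obtains "improve K \<rho> r V D = D"
  | s t where "improve K \<rho> r V D = reroute s t D" "s \<in> set V" "t \<in> set V"
    "\<not> enough K \<rho> r D s" "spare K \<rho> r D t" "t \<in> set (reached s D)" "rooted r V (reroute s t D)"
proof -
  let ?C = "filter (rooted r V) (map (\<lambda>p. reroute (fst p) (snd p) D)
    (filter (\<lambda>p. \<not> enough K \<rho> r D (fst p) \<and> spare K \<rho> r D (snd p) \<and> snd p \<in> set (reached (fst p) D))
      (List.product V V)))"
  have "improve K \<rho> r V D = D \<or> improve K \<rho> r V D \<in> set ?C"
    using first_or_in[of D ?C] unfolding improve_def by blast
  then show ?thesis using that by fastforce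
qed

lemma esize_improve: "esize (improve K \<rho> r V D) = esize D"
  by (cases rule: improve_cases[of K \<rho> r V D]) (simp_all add: reroute_def esize_map_if_turn)

lemma FP_optimum:
  "FP a \<Longrightarrow> FP b \<Longrightarrow> FP c \<Longrightarrow> FP d \<Longrightarrow> FP e \<Longrightarrow> FP (\<lambda>x. optimum (a x) (b x) (c x) (d x) (e x))"
proof (erule (4) FP_comp5[of optimum, rotated])
  let ?F = "\<lambda>z :: unit list \<times> 'b \<times> 'c \<times> 'c list \<times> ('b, 'c) arc list.
    improve (fst z) (fst (snd z)) (fst (snd (snd z))) (fst (snd (snd (snd z))))"
  let ?E = "\<lambda>z :: unit list \<times> 'b \<times> 'c \<times> 'c list \<times> ('b, 'c) arc list. snd (snd (snd (snd z)))"
  let ?h = "\<lambda>z. orient0 (fst (snd (snd z))) (?E z)"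
  have "FP (\<lambda>z. (?F z ^^ length (?E z @ ?E z)) (?h z))"
  proof (rule FP_funpow)
    show "FP (\<lambda>z. ?F (fst z) (snd z))" by (intro FP_rules FP_improve)
    show "FP ?h" "FP (\<lambda>z. ?E z @ ?E z)" by (intro FP_rules FP_orient0)+
    show "pb (\<lambda>z. esize (?h z))" by (intro FP_size FP_orient0 FP_rules)
    \<comment> \<open>Reversing arcs preserves sizes, so all iterates are as large as the initial
      orientation.\<close>
    show "esize ((?F z ^^ i) (?h z)) \<le> esize (?h z)" for z i
      by (induction i) (simp_all add: esize_improve)
  qed
  then show "FP (\<lambda>z. optimum (fst z) (fst (snd z)) (fst (snd (snd z))) (fst (snd (snd (snd z)))) (?E z))"
    by (simp add: optimum_def)
qed

lemma FP_split0: "FP a \<Longrightarrow> FP b \<Longrightarrow> FP c \<Longrightarrow> FP (\<lambda>x. split0 (a x) (b x) (c x))"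
  by (erule (2) FP_comp3[of split0, rotated])
    (unfold split0_def origin_def, intro FP_rules FP_first_or FP_grow FP_into FP_tail)

lemma FP_rehang: "FP a \<Longrightarrow> FP b \<Longrightarrow> FP c \<Longrightarrow> FP (\<lambda>x. rehang (a x) (b x) (c x))"
  by (erule (2) FP_comp3[of rehang, rotated]) (unfold rehang_def, intro FP_rules FP_head)

lemma FP_balance:
  "FP a \<Longrightarrow> FP b \<Longrightarrow> FP c \<Longrightarrow> FP d \<Longrightarrow> FP e \<Longrightarrow> FP (\<lambda>x. balance (a x) (b x) (c x) (d x) (e x))"
  by (erule (4) FP_comp5[of balance, rotated])
    (unfold balance_def, intro FP_rules FP_first_or FP_rooted FP_rehang FP_copies FP_incid FP_tail)

lemma filter_map_mem: "y \<in> set (filter P (map f xs)) \<Longrightarrow> \<exists>x\<in>set xs. y = f x \<and> P (f x)"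
  by auto

lemma balance_cases:
  obtains "balance K \<rho> r D H = H"
  | h b where "balance K \<rho> r D H = rehang h b H" "h \<in> set H" "b \<in> set (copies \<rho> r D (fst h))"
    "b \<in> insert \<rho> (fst ` set D)" "length K < length (incid H (tail h))" "length (incid H b) < length K"
    "rooted \<rho> (\<rho> # map fst D) (rehang h b H)"
proof -
  let ?C = "filter (rooted \<rho> (\<rho> # map fst D)) (map (\<lambda>p. rehang (fst p) (snd p) H)
      (filter (\<lambda>p. snd p \<in> set (copies \<rho> r D (fst (fst p))) \<and>
          \<not> length (incid H (tail (fst p))) \<le> length K \<and> \<not> length K \<le> length (incid H (snd p)))
        (List.product H (\<rho> # map fst D))))"
  have "balance K \<rho> r D H = H \<or> balance K \<rho> r D H \<in> set ?C"
    using first_or_in[of H ?C] unfolding balance_def by blast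
  then show ?thesis
  proof
    assume "balance K \<rho> r D H \<in> set ?C"
    from filter_map_mem[OF this] obtain p where p: "p \<in> set H \<times> set (\<rho> # map fst D)"
        "snd p \<in> set (copies \<rho> r D (fst (fst p)))" "length K < length (incid H (tail (fst p)))"
        "length (incid H (snd p)) < length K" "balance K \<rho> r D H = rehang (fst p) (snd p) H"
        "rooted \<rho> (\<rho> # map fst D) (rehang (fst p) (snd p) H)"
      by (auto simp del: fst_conv snd_conv split_paired_All split_paired_Ex set_simps simp: not_le)
    show ?thesis
    proof (rule that(2)[of "fst p" "snd p"])
      show "fst p \<in> set H" "snd p \<in> insert \<rho> (fst ` set D)" using p(1) by (auto simp: mem_Times_iff)
    qed (use p in auto)
  qed (use that(1) in auto)
qed

text \<open>Names differ in length, so a move may change the total size. The number of arcs and a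
  common bound on their components persist, because the new tail is \<open>\<rho>\<close> or a tag
  of \<open>D\<close>.\<close>

lemma balance_size:
  fixes \<rho> :: "'i::encodable" and H :: "('a::encodable, 'i) arc list"
  assumes "length H = l" "\<forall>h\<in>set H. esize (fst h) \<le> S \<and> esize (tail h) \<le> S \<and> esize (head h) \<le> S"
    and "esize \<rho> \<le> S" "esize D \<le> S"
  shows "length (balance K \<rho> r D H) = l \<and> (\<forall>h\<in>set (balance K \<rho> r D H).
    esize (fst h) \<le> S \<and> esize (tail h) \<le> S \<and> esize (head h) \<le> S)"
proof (cases rule: balance_cases[of K \<rho> r D H])
  case 1
  then show ?thesis using assms by simp
next
  case (2 h b)
  have "esize (fst d) \<le> S" if "d \<in> set D" for d
  proof -
    have "esize (fst d) \<le> esize d" by (cases d) simp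
    then show ?thesis using esize_le_esize_list[OF that] assms(4) by linarith
  qed
  then have "esize b \<le> S" using 2(4) assms(3) by auto
  then show ?thesis using 2(1,2) assms by (auto simp: rehang_def)
qed

lemma FP_splitting:
  "FP a \<Longrightarrow> FP b \<Longrightarrow> FP c \<Longrightarrow> FP d \<Longrightarrow> FP (\<lambda>x. splitting (a x) (b x) (c x) (d x))"
proof (erule (3) FP_comp4[of splitting, rotated])
  let ?D = "\<lambda>z :: unit list \<times> 'b \<times> 'c \<times> ('b, 'c) arc list. snd (snd (snd z))"
  let ?F = "\<lambda>z. balance (fst z) (fst (snd z)) (fst (snd (snd z))) (?D z)"
  let ?h = "\<lambda>z. split0 (fst (snd z)) (fst (snd (snd z))) (?D z)"
  let ?S = "\<lambda>z. esize (?h z) + esize (fst (snd z)) + esize (?D z)"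
  have "FP (\<lambda>z. (?F z ^^ length (?D z @ ?D z)) (?h z))"
  proof (rule FP_funpow)
    show "FP (\<lambda>z. ?F (fst z) (snd z))" by (intro FP_rules FP_balance)
    show "FP ?h" "FP (\<lambda>z. ?D z @ ?D z)" by (intro FP_rules FP_split0)+
    \<comment> \<open>At most \<open>?S z\<close> arcs, each with three components and two pairing
      nodes; the last 1 is the list cell.\<close>
    show "pb (\<lambda>z. ?S z * ((3 * ?S z + 2) + 1))"
      by (intro pb_mult pb_add pb_const FP_size FP_split0 FP_rules)
    show "esize ((?F z ^^ i) (?h z)) \<le> ?S z * ((3 * ?S z + 2) + 1)" for z i
    proof -
      have "length ((?F z ^^ i) (?h z)) = length (?h z) \<and> (\<forall>h\<in>set ((?F z ^^ i) (?h z)).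
        esize (fst h) \<le> ?S z \<and> esize (tail h) \<le> ?S z \<and> esize (head h) \<le> ?S z)"
      proof (induction i)
        case 0
        have "esize (fst h) \<le> ?S z \<and> esize (tail h) \<le> ?S z \<and> esize (head h) \<le> ?S z" if "h \<in> set (?h z)" for h
          using esize_le_esize_list[OF that] by (cases h) simp
        then show ?case by simp
      next
        case (Suc i)
        show ?case
          using balance_size[OF conjunct1[OF Suc] conjunct2[OF Suc], of "fst (snd z)" "?D z"] by simp
      qed
      then show ?thesis
        using length_le_esize[of "?h z"] by (intro esize_list_le) (fastforce simp: tail_def head_def)+
    qed
  qed
  then show "FP (\<lambda>z. splitting (fst z) (fst (snd z)) (fst (snd (snd z))) (?D z))"
    by (simp add: splitting_def)
qed

section \<open>Binary numbers, names and the capped degree bound\<close>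

lemma bits_0 [simp]: "bits 0 = []" and bits_pos: "n > 0 \<Longrightarrow> bits n = odd n # bits (n div 2)"
  by (simp_all add: bits.simps)

lemma enc_bits: "enc (bits n) = enc n"
proof (induction n rule: less_induct)
  case (less n)
  then show ?case by (cases "n = 0") (simp_all add: enc_nat_def' bits_pos enc_nat_0 enc_nat_pos)
qed

lemma FP_bits: "FP f \<Longrightarrow> FP (\<lambda>x. bits (f x))"
  by (rule FP_coerce) (simp_all add: enc_bits)

text \<open>Such numbers serve as names because their binary representation is unary.\<close>

lemma enc_mersenne: "enc (2 ^ n - 1 :: nat) = enc (replicate n True)"
proof (induction n)
  case (Suc n)
  obtain m :: nat where "2 ^ n = Suc m" using not0_implies_Suc[of "2 ^ n"] by auto
  then have "2 ^ Suc n - 1 = 2 * (2 ^ n - 1) + (1 :: nat)" by simp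
  then have "odd (2 ^ Suc n - 1 :: nat)" "(2 ^ Suc n - 1) div 2 = (2 ^ n - 1 :: nat)" "(2 ^ Suc n - 1 :: nat) > 0"
    by simp_all
  with Suc show ?case by (simp add: enc_nat_def' enc_nat_pos)
qed (simp add: enc_nat_def' enc_nat_0)

lemma FP_mersenne:
  assumes "FP f" shows "FP (\<lambda>x. 2 ^ length (f x) - 1 :: nat)"
proof (rule FP_coerce)
  show "FP (\<lambda>x. map (\<lambda>_. True) (f x))" by (intro FP_rules assms)
qed (simp add: enc_mersenne[simplified] map_replicate_const)

lemma number_fold: "fold (\<lambda>x acc. (2 ^ length acc - 1 :: nat, x) # acc) xs [] =
  map (\<lambda>(i, x). (2 ^ i - 1, x)) (rev (zip [0..<length xs] xs))"
  by (induction xs rule: rev_induct) auto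

lemma FP_number: "FP f \<Longrightarrow> FP (\<lambda>x. number (f x))"
  unfolding number_def
proof (rule FP_fold[where f = "\<lambda>_ x acc. (2 ^ length acc - 1 :: nat, x) # acc" and h = "\<lambda>_. []"])
  assume f: "FP f"
  let ?B = "\<lambda>x. esize (f x) * ((2 * esize (f x) + esize (f x) + 1) + 1)"
  show "pb ?B" by (intro pb_mult pb_add pb_const FP_size f)
  show "esize (fold (\<lambda>x acc. (2 ^ length acc - 1 :: nat, x) # acc) (take i (f x)) []) \<le> ?B x" for x i
  proof (rule esize_list_le)
    show "length (fold (\<lambda>x acc. (2 ^ length acc - 1 :: nat, x) # acc) (take i (f x)) []) \<le> esize (f x)"
      using length_le_esize[of "f x"] by (simp add: number_fold[simplified])
    fix w assume "w \<in> set (fold (\<lambda>x acc. (2 ^ length acc - 1 :: nat, x) # acc) (take i (f x)) [])"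
    then obtain j y where j: "j < length (f x)" "y \<in> set (f x)" "w = (2 ^ j - 1, y)"
      by (auto simp: number_fold[simplified] set_zip)
    \<comment> \<open>Each of the \<open>j\<close> binary digits is a one and takes two nodes: the
      list cell and the encoding of \<open>True\<close>.\<close>
    have "esize (2 ^ j - 1 :: nat) \<le> 2 * j"
      by (simp add: enc_mersenne[simplified]) (induction j; simp)
    then show "esize w \<le> 2 * esize (f x) + esize (f x) + 1"
      using j esize_le_esize_list[of y "f x"] length_le_esize[of "f x"] by simp
  qed
qed (intro FP_rules FP_mersenne | assumption)+

lemma FP_clip: "FP f \<Longrightarrow> FP g \<Longrightarrow> FP (\<lambda>x. clip (f x) (g x))"
  unfolding clip_def by (intro FP_rules)

lemma esize_unit_list: "esize (xs :: unit list) = length xs"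
  by (induction xs) auto

lemma length_clip: "length (clip L xs) = min (length L) (length xs)"
  by (simp add: clip_def)

lemma FP_capped: "FP f \<Longrightarrow> FP g \<Longrightarrow> FP (\<lambda>x. capped (f x) (g x))"
  unfolding capped_def
proof (intro FP_snd FP_fold[where f = "\<lambda>x b s. (clip (f x) (fst s @ fst s), clip (f x) (snd s @ (if b then fst s else [])))"])
  assume f: "FP f" and g: "FP g"
  have "FP (\<lambda>z. f (fst z))" by (rule FP_comp[OF FP_fst0 f])
  then show "FP (\<lambda>z. (clip (f (fst z)) (fst (snd (snd z)) @ fst (snd (snd z))),
      clip (f (fst z)) (snd (snd (snd z)) @ (if fst (snd z) then fst (snd (snd z)) else []))))"
    by (intro FP_rules FP_clip)
  show "FP (\<lambda>x. bits (g x))" "FP (\<lambda>x. (clip (f x) [()], []))" by (intro FP_rules FP_clip FP_bits f g)+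
  show "pb (\<lambda>x. 2 * esize (f x) + 1)" by (intro pb_mult pb_add pb_const FP_size f)
  show "esize (fold (\<lambda>b s. (clip (f x) (fst s @ fst s), clip (f x) (snd s @ (if b then fst s else []))))
      (take i (bits (g x))) (clip (f x) [()], [])) \<le> 2 * esize (f x) + 1" for x i
  proof -
    have "length (fst (fold (\<lambda>b s. (clip L (fst s @ fst s), clip L (snd s @ (if b then fst s else [])))) bs s)) \<le> length L \<and>
      length (snd (fold (\<lambda>b s. (clip L (fst s @ fst s), clip L (snd s @ (if b then fst s else [])))) bs s)) \<le> length L"
      if "length (fst s) \<le> length L" "length (snd s) \<le> length L" for L :: "unit list" and s and bs :: "bool list"
      using that by (induction bs arbitrary: s) (simp_all add: length_clip)
    from this[of "(clip (f x) [()], [])" "f x" "take i (bits (g x))"]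
    show ?thesis
      by (cases "fold (\<lambda>b s. (clip (f x) (fst s @ fst s), clip (f x) (snd s @ (if b then fst s else []))))
        (take i (bits (g x))) (clip (f x) [()], [])") (simp add: esize_unit_list length_clip)
  qed
qed

lemma FP_solve: "FP solve"
proof -
  have "FP (\<lambda>z. let V = fst (fst (fst z)); E = number (snd (fst (fst z))); \<rho> = 2 ^ length E - 1;
      K = capped (() # map (\<lambda>_. ()) (E @ E)) (snd (fst z)); D = optimum K \<rho> (snd z) V E
    in if \<forall>v\<in>set V. enough K \<rho> (snd z) D v
      then Some ((\<rho> # map fst D, map snd (splitting K \<rho> (snd z) D)), (\<rho>, snd z) # map (\<lambda>a. (fst a, head a)) D)
      else None)"
    unfolding Let_def
    by (intro FP_rules FP_number FP_mersenne FP_capped FP_optimum FP_enough FP_splitting FP_head)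
  note * = FP_comp2[where f = "\<lambda>x r. let V = fst (fst x); E = number (snd (fst x)); \<rho> = 2 ^ length E - 1;
      K = capped (() # map (\<lambda>_. ()) (E @ E)) (snd x); D = optimum K \<rho> r V E
    in if \<forall>v\<in>set V. enough K \<rho> r D v
      then Some ((\<rho> # map fst D, map snd (splitting K \<rho> r D)), (\<rho>, r) # map (\<lambda>a. (fst a, head a)) D)
      else None", OF this]
  show ?thesis
    unfolding solve_def by (intro FP_case_list * FP_rules)
qed

section \<open>Growing arborescences\<close>

definition rel :: "('i, 'a) arc list \<Rightarrow> ('a \<times> 'a) set" where
  "rel D = (\<lambda>a. (tail a, head a)) ` set D"

fun arborescence :: "'a \<Rightarrow> ('i, 'a) arc list \<Rightarrow> bool" where
  "arborescence r [] \<longleftrightarrow> True"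
| "arborescence r (a # T) \<longleftrightarrow> tail a \<in> set (r # map head T) \<and> head a \<notin> set (r # map head T) \<and> arborescence r T"

text \<open>After i rounds either i elements have been collected or nothing more can be added. A
  further element after \<open>length D\<close> rounds would give more distinct elements of
  \<open>D\<close> than it has entries.\<close>

lemma pushes_final:
  assumes "I []" "\<And>xs a. I xs \<Longrightarrow> set xs \<subseteq> set D \<Longrightarrow> a \<in> set D \<Longrightarrow> P a xs \<Longrightarrow> I (a # xs)"
    and dist: "\<And>xs. I xs \<Longrightarrow> distinct xs"
  shows "I (pushes P D)" "set (pushes P D) \<subseteq> set D" "\<And>a. a \<in> set D \<Longrightarrow> \<not> P a (pushes P D)"
proof -
  let ?it = "\<lambda>i. (push P D ^^ i) []"
  have it: "I (?it i) \<and> (length (?it i) = i \<or> (\<forall>a\<in>set D. \<not> P a (?it i)))" for i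
  proof (induction i)
    case (Suc i)
    then show ?case
      using assms(2) push_iterates[where i = i and P = P and D = D] by (cases rule: push_cases[of P D "?it i"]) auto
  qed (simp add: assms(1))
  show I: "I (pushes P D)" and sub: "set (pushes P D) \<subseteq> set D"
    using it push_iterates[of "length D" P D] by (auto simp: pushes_def)
  fix a assume a: "a \<in> set D"
  show "\<not> P a (pushes P D)"
  proof
    assume P: "P a (pushes P D)"
    with it[of "length D"] a have len: "length (pushes P D) = length D" by (auto simp: pushes_def)
    from dist[OF assms(2)[OF I sub a P]] have "card (set (a # pushes P D)) = Suc (length D)"
      using len by (simp only: distinct_card) simp
    moreover have "card (set (a # pushes P D)) \<le> card (set D)" using sub a by (intro card_mono) auto
    ultimately show False using card_length[of D] by linarith
  qed
qed

lemma arborescence_distinct: "arborescence r T \<Longrightarrow> distinct (r # map head T)"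
  by (induction T) auto

lemma grow_props:
  shows arborescence_grow: "arborescence r (grow r D)"
    and grow_subset: "set (grow r D) \<subseteq> set D"
    and grow_closed: "a \<in> set D \<Longrightarrow> tail a \<in> set (reached r D) \<Longrightarrow> head a \<in> set (reached r D)"
proof -
  have d: "arborescence r T \<Longrightarrow> distinct T" for T :: "('b, 'a) arc list"
    using arborescence_distinct[of r T] by (simp add: distinct_map)
  let ?P = "\<lambda>a T. tail a \<in> set (r # map head T) \<and> head a \<notin> set (r # map head T)"
  note * = pushes_final[of "arborescence r" D ?P, OF _ _ d, folded grow_def]
  show "arborescence r (grow r D)" "set (grow r D) \<subseteq> set D" by (rule *(1,2); simp)+
  show "a \<in> set D \<Longrightarrow> tail a \<in> set (reached r D) \<Longrightarrow> head a \<in> set (reached r D)"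
    using *(3)[of a] unfolding reached_def by auto
qed

lemma arborescence_reach: "arborescence r T \<Longrightarrow> v \<in> set (r # map head T) \<Longrightarrow> (r, v) \<in> (rel T)\<^sup>*"
proof (induction T arbitrary: v)
  case (Cons a T)
  have mono: "(rel T)\<^sup>* \<subseteq> (rel (a # T))\<^sup>*" by (intro rtrancl_mono) (auto simp: rel_def)
  have a: "(tail a, head a) \<in> rel (a # T)" by (auto simp: rel_def)
  show ?case
  proof (cases "v \<in> set (r # map head T)")
    case False
    then have "v = head a" using Cons.prems(2) by auto
    moreover have "(r, tail a) \<in> (rel (a # T))\<^sup>*" using Cons mono by auto
    ultimately show ?thesis using a by auto
  qed (use Cons mono in auto)
qed simp

lemma arborescence_tail: "arborescence r T \<Longrightarrow> b \<in> set T \<Longrightarrow> tail b \<in> set (r # map head T)"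
  by (induction T) auto

text \<open>The head of the newest arc is a new vertex, so its rank can be set freely above that of
  the tail. Ranks exclude antiparallel pairs and cycles, and later serve for inductions along the
  tree.\<close>

lemma arborescence_rank:
  assumes "arborescence r T"
  obtains rk :: "'a \<Rightarrow> nat" where "\<And>a. a \<in> set T \<Longrightarrow> rk (tail a) < rk (head a)"
proof -
  have "\<exists>rk :: 'a \<Rightarrow> nat. \<forall>a\<in>set T. rk (tail a) < rk (head a)"
    using assms
  proof (induction T)
    case (Cons a T)
    then obtain rk :: "'a \<Rightarrow> nat" where rk: "\<forall>b\<in>set T. rk (tail b) < rk (head b)" by auto
    let ?rk = "rk(head a := Suc (rk (tail a)))"
    have "?rk (tail b) < ?rk (head b)" if "b \<in> set T" for b
    proof -
      have "tail b \<in> set (r # map head T)" "head b \<in> set (r # map head T)"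
        using arborescence_tail[of r T b] Cons.prems that by simp_all
      moreover have "head a \<notin> set (r # map head T)" using Cons.prems by simp
      ultimately have "head a \<noteq> tail b" "head a \<noteq> head b" by metis+
      then show ?thesis using rk that by simp
    qed
    moreover have "tail a \<in> set (r # map head T)" "head a \<notin> set (r # map head T)" using Cons.prems by simp_all
    then have "tail a \<noteq> head a" by metis
    then have "?rk (tail a) < ?rk (head a)" by simp
    ultimately have "\<forall>b\<in>set (a # T). ?rk (tail b) < ?rk (head b)" by simp
    then show ?case by blast
  qed simp
  then show ?thesis using that by blast
qed

lemma reached_iff: "v \<in> set (reached r D) \<longleftrightarrow> (r, v) \<in> (rel D)\<^sup>*"
proof
  assume "v \<in> set (reached r D)"
  then have "(r, v) \<in> (rel (grow r D))\<^sup>*"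
    using arborescence_reach[OF arborescence_grow[of r D]] unfolding reached_def by blast
  moreover have "rel (grow r D) \<subseteq> rel D" using grow_subset[of r D] by (auto simp: rel_def)
  ultimately show "(r, v) \<in> (rel D)\<^sup>*" using rtrancl_mono by blast
next
  assume "(r, v) \<in> (rel D)\<^sup>*"
  then show "v \<in> set (reached r D)"
  proof (induction rule: rtrancl_induct)
    case (step y z)
    then show ?case using grow_closed by (auto simp: rel_def)
  qed (simp add: reached_def)
qed

lemma rooted_iff: "rooted r V D \<longleftrightarrow> (\<forall>v\<in>set V. (r, v) \<in> (rel D)\<^sup>*)"
  by (simp add: rooted_def reached_iff)

fun walk :: "'a \<Rightarrow> ('i, 'a) arc list \<Rightarrow> 'a \<Rightarrow> bool" where
  "walk x [] t \<longleftrightarrow> x = t"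
| "walk x (a # p) t \<longleftrightarrow> tail a = x \<and> walk (head a) p t"

lemma trace_walk:
  assumes T: "arborescence s T" and t: "t \<in> set (s # map head T)"
  shows "walk s (trace t T) t" "distinct (trace t T)" "set (trace t T) \<subseteq> set T"
proof -
  obtain rk :: "'a \<Rightarrow> nat" where rk: "\<And>a. a \<in> set T \<Longrightarrow> rk (tail a) < rk (head a)"
    using arborescence_rank[OF T] by blast
  define cur where "cur p = (case p of [] \<Rightarrow> t | b # _ \<Rightarrow> tail b)" for p :: "('b, 'a) arc list"
  \<comment> \<open>The last conjunct keeps the arcs distinct: a new arc enters
    \<open>cur p\<close>, all earlier ones enter vertices of larger rank.\<close>
  define I where "I p \<longleftrightarrow> walk (cur p) p t \<and> distinct p \<and> set p \<subseteq> set T \<and> (\<forall>a\<in>set p. rk (cur p) < rk (head a))" for p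
  have tr: "trace t T = pushes (\<lambda>a p. head a = cur p) T" by (simp add: trace_def cur_def)
  have "I []" by (simp add: I_def cur_def)
  moreover have "I (a # p)" if "I p" "a \<in> set T" "head a = cur p" for a p
    using that rk[OF that(2)] by (fastforce simp: I_def cur_def)
  moreover have "distinct p" if "I p" for p using that by (simp add: I_def)
  ultimately have *: "I (trace t T)" "\<And>a. a \<in> set T \<Longrightarrow> head a \<noteq> cur (trace t T)"
    using pushes_final[of I T "\<lambda>a p. head a = cur p", folded tr] by blast+
  \<comment> \<open>The trace stops at a tree vertex that no tree arc enters, which leaves only the
    root.\<close>
  have "cur (trace t T) \<in> set (s # map head T)"
  proof (cases "trace t T")
    case Nil then show ?thesis using t by (simp add: cur_def)
  next
    case (Cons b p)
    then have "b \<in> set T" using *(1) by (auto simp: I_def)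
    then show ?thesis using arborescence_tail[OF T] Cons by (simp add: cur_def)
  qed
  then have "cur (trace t T) = s" using *(2) by (metis imageE insertE list.simps(15) list.set_map)
  then show "walk s (trace t T) t" "distinct (trace t T)" "set (trace t T) \<subseteq> set T"
    using *(1) by (auto simp: I_def)
qed

section \<open>Reorientations\<close>

definition reorients :: "('i, 'a) arc list \<Rightarrow> ('i, 'a) arc list \<Rightarrow> bool" where
  "reorients E D \<longleftrightarrow> list_all2 (\<lambda>a b. b = a \<or> b = turn a) E D"

lemma reorients_map_if: "reorients D (map (\<lambda>a. if Q a then turn a else a) D)"
  unfolding reorients_def by (induction D) auto

lemma reorients_trans:
  assumes "reorients D D'" "reorients D' D''"
  shows "reorients D D''"
  unfolding reorients_def by (rule list_all2_trans[OF _ assms[unfolded reorients_def]]) auto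

lemma reorients_fst: "reorients E D \<Longrightarrow> map fst D = map fst E"
  unfolding reorients_def by (induction rule: list_all2_induct) auto

lemma reorients_mem: "reorients E D \<Longrightarrow> a \<in> set D \<Longrightarrow> \<exists>b\<in>set E. a = b \<or> a = turn b"
  unfolding reorients_def by (induction rule: list_all2_induct) auto

text \<open>What all orientations have in common; degrees and \<open>inside\<close> depend on it
  alone.\<close>

definition uedges :: "('i, 'a) arc list \<Rightarrow> 'a uprod multiset" where
  "uedges D = mset (map (\<lambda>a. Upair (tail a) (head a)) D)"

lemma reorients_uedges: "reorients E D \<Longrightarrow> uedges D = uedges E"
  unfolding reorients_def uedges_def
  by (induction rule: list_all2_induct) (auto intro: Upair_inject[THEN iffD2])

definition inside :: "('i, 'a) arc list \<Rightarrow> 'a set \<Rightarrow> nat" where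
  "inside D X = length (filter (\<lambda>a. tail a \<in> X \<and> head a \<in> X) D)"

lemma inside_uedges: "inside D X = size {#e \<in># uedges D. set_uprod e \<subseteq> X#}"
  unfolding inside_def uedges_def by (induction D) auto

lemma incid_uedges: "length (incid D v) = size {#e \<in># uedges D. v \<in> set_uprod e#} + count (uedges D) (Upair v v)"
  unfolding incid_def into_def uedges_def by (induction D) auto

lemma length_uedges: "size (uedges D) = length D"
  by (simp add: uedges_def)

lemma length_filter_sum:
  "finite X \<Longrightarrow> length (filter (\<lambda>a. f a \<in> X) D) = (\<Sum>x\<in>X. length (filter (\<lambda>a. f a = x) D))"
proof (induction D)
  case (Cons a D)
  have "(\<Sum>x\<in>X. length (filter (\<lambda>a. f a = x) (a # D))) = (\<Sum>x\<in>X. (if f a = x then 1 else 0) + length (filter (\<lambda>a. f a = x) D))"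
    by (intro sum.cong) auto
  then show ?case using Cons by (simp add: sum.distrib)
qed simp

definition ncopies :: "'a \<Rightarrow> ('i, 'a) arc list \<Rightarrow> 'a \<Rightarrow> nat" where
  "ncopies r D v = (if v = r then 1 else 0) + length (into D v)"

lemma length_copies: "length (copies \<rho> r D v) = ncopies r D v"
  by (simp add: copies_def ncopies_def)

lemma sum_ncopies: "finite X \<Longrightarrow> sum (ncopies r D) X = (if r \<in> X then 1 else 0) + length (filter (\<lambda>a. head a \<in> X) D)"
  by (simp add: ncopies_def sum.distrib length_filter_sum into_def)

lemma rtrancl_enters:
  assumes "(x, y) \<in> R\<^sup>*" "x \<notin> X" "y \<in> X"
  shows "\<exists>u v. (u, v) \<in> R \<and> u \<notin> X \<and> v \<in> X"
  using assms by (induction rule: rtrancl_induct) auto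

lemma length_filter_less:
  assumes "a \<in> set D" "Q a" "\<not> P a" "\<And>b. P b \<Longrightarrow> Q b"
  shows "length (filter P D) < length (filter Q D)"
  using assms(1)
proof (induction D)
  case (Cons b D)
  have "length (filter P D) \<le> length (filter Q D)" for D
    using assms(4) by (induction D) auto
  from this[of D] Cons assms show ?case by (auto simp: less_Suc_eq_le)
qed simp

text \<open>The additional 1 is the root copy if \<open>r\<close> lies in \<open>X\<close>;
  otherwise it is an arc by which a path from \<open>r\<close> enters \<open>X\<close>, whose head
  counts although the arc is not inside.\<close>

lemma ncopies_inside:
  assumes "finite X" "v \<in> X" "(r, v) \<in> (rel D)\<^sup>*"
  shows "inside D X + 1 \<le> sum (ncopies r D) X"
proof (cases "r \<in> X")
  case True
  have "inside D X \<le> length (filter (\<lambda>a. head a \<in> X) D)" unfolding inside_def by (induction D) auto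
  then show ?thesis using True assms(1) by (simp add: sum_ncopies)
next
  case False
  then obtain a where "a \<in> set D" "tail a \<notin> X" "head a \<in> X"
    using rtrancl_enters[OF assms(3) _ assms(2)] by (auto simp: rel_def)
  then have "inside D X < length (filter (\<lambda>a. head a \<in> X) D)"
    unfolding inside_def by (intro length_filter_less[of a]) auto
  then show ?thesis using False assms(1) by (simp add: sum_ncopies)
qed

text \<open>No arc enters \<open>X\<close>. If \<open>r\<close> is outside, the sum misses the bound
  of \<open>ncopies_inside\<close> by one, which is how unreachable sets are recognized; if
  \<open>r\<close> is inside, \<open>X\<close> is tight.\<close>

lemma ncopies_closed:
  assumes "finite X" "\<And>a. a \<in> set D \<Longrightarrow> head a \<in> X \<Longrightarrow> tail a \<in> X"
  shows "sum (ncopies r D) X = (if r \<in> X then 1 else 0) + inside D X"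
proof -
  have "filter (\<lambda>a. head a \<in> X) D = filter (\<lambda>a. tail a \<in> X \<and> head a \<in> X) D"
    using assms(2) by (intro filter_cong) auto
  then show ?thesis using assms(1) by (simp add: sum_ncopies inside_def)
qed

lemma inside_supermodular: "inside D X + inside D Y \<le> inside D (X \<union> Y) + inside D (X \<inter> Y)"
  unfolding inside_def by (induction D) auto

text \<open>An inner vertex of the reversed path gains as many entering arcs as it loses, so only
  the ends change. The additive form avoids truncated subtraction and covers
  \<open>s = t\<close>.\<close>

lemma reroute_ncopies:
  fixes D :: "('i, 'a) arc list"
  assumes "distinct D" "(s, t) \<in> (rel D)\<^sup>*"
  shows "ncopies r (reroute s t D) v + (if v = t then 1 else 0) = ncopies r D v + (if v = s then 1 else 0)"
proof -
  let ?T = "grow s D"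
  have t: "t \<in> set (s # map head ?T)" using assms(2) unfolding reached_iff[symmetric] reached_def .
  define p where "p = trace t ?T"
  note w = trace_walk[OF arborescence_grow t, folded p_def]
  have sub: "set p \<subseteq> set D" using w(3) grow_subset[of s D] by auto
  have tele: "walk x q t \<Longrightarrow> length (filter (\<lambda>a. tail a = v) q) + (if v = t then 1 else 0) =
      length (filter (\<lambda>a. head a = v) q) + (if v = x then 1 else 0)" for x and q :: "('i, 'a) arc list"
  proof (induction q arbitrary: x)
    case (Cons a q)
    from Cons.IH[of "head a"] Cons.prems show ?case by (cases "v = x"; cases "v = head a") auto
  qed simp
  have flip: "length (filter (\<lambda>a. head a = v) (map (\<lambda>a. if a \<in> S then turn a else a) D')) + length (filter (\<lambda>a. a \<in> S \<and> head a = v) D')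
      = length (filter (\<lambda>a. head a = v) D') + length (filter (\<lambda>a. a \<in> S \<and> tail a = v) D')" for S and D' :: "('i, 'a) arc list"
    by (induction D') auto
  \<comment> \<open>Both \<open>D\<close> and the path are free of repetitions, so selecting the
    path's arcs from \<open>D\<close> counts each of them once.\<close>
  have cnt: "length (filter (\<lambda>a. a \<in> set p \<and> Q a) D) = length (filter Q p)" for Q
  proof -
    have "length (filter (\<lambda>a. a \<in> set p \<and> Q a) D) = card (set (filter (\<lambda>a. a \<in> set p \<and> Q a) D))"
      by (rule distinct_card[symmetric]) (simp add: assms(1))
    also have "set (filter (\<lambda>a. a \<in> set p \<and> Q a) D) = set (filter Q p)" using sub by auto
    also have "card \<dots> = length (filter Q p)" by (rule distinct_card) (simp add: w(2))
    finally show ?thesis .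
  qed
  show ?thesis
    using flip[of "set p" D] tele[OF w(1)]
    unfolding cnt ncopies_def into_def reroute_def p_def[symmetric] by linarith
qed

section \<open>Optimality of the local search\<close>

text \<open>Replacing two intersecting members by their union keeps the total union and lowers the
  number of sets.\<close>

lemma disjoint_refinement:
  assumes "finite F" "\<And>X. X \<in> F \<Longrightarrow> P X" "\<And>X Y. P X \<Longrightarrow> P Y \<Longrightarrow> X \<inter> Y \<noteq> {} \<Longrightarrow> P (X \<union> Y)"
  obtains F' where "finite F'" "\<Union>F' = \<Union>F" "\<And>X. X \<in> F' \<Longrightarrow> P X" "pairwise disjnt F'"
proof -
  have "\<exists>F'. finite F' \<and> \<Union>F' = \<Union>F \<and> (\<forall>X\<in>F'. P X) \<and> pairwise disjnt F'"
    using assms(1,2)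
  proof (induction "card F" arbitrary: F rule: less_induct)
    case less
    show ?case
    proof (cases "pairwise disjnt F")
      case False
      then obtain X Y where XY: "X \<in> F" "Y \<in> F" "X \<noteq> Y" "X \<inter> Y \<noteq> {}"
        by (auto simp: pairwise_def disjnt_def)
      let ?F = "insert (X \<union> Y) (F - {X, Y})"
      have "card (F - {X, Y}) = card F - 2" "2 \<le> card F"
        using XY less.prems(1) card_mono[of F "{X, Y}"] by (simp_all add: card_Diff_subset)
      then have "card ?F < card F"
        using XY less.prems(1) card_insert_le_m1[of "card F - 1" "F - {X, Y}" "X \<union> Y"] by simp
      moreover have "\<Union>?F = \<Union>F" using XY by auto
      moreover have "P Z" if "Z \<in> ?F" for Z using that less.prems(2) XY assms(3) by blast
      ultimately show ?thesis using less.hyps[of ?F] less.prems(1) by auto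
    qed (use less.prems in blast)
  qed
  then show ?thesis using that by blast
qed

text \<open>
  Tight sets are closed under intersecting unions, so the tight sets that avoid s can be merged into
  disjoint ones; on their union y is at least z.
\<close>

lemma tight_sets:
  fixes y z :: "'a \<Rightarrow> nat" and f :: "'a set \<Rightarrow> nat"
  assumes V: "finite V"
    and super: "\<And>X Y. f X + f Y \<le> f (X \<union> Y) + f (X \<inter> Y)"
    and y: "\<And>X. X \<subseteq> V \<Longrightarrow> X \<noteq> {} \<Longrightarrow> f X + 1 \<le> sum y X"
    and z: "\<And>X. X \<subseteq> V \<Longrightarrow> X \<noteq> {} \<Longrightarrow> f X + 1 \<le> sum z X"
    and total: "sum y V \<le> sum z V"
    and s: "s \<in> V" "z s < y s"
    and tight: "\<And>t. t \<in> V \<Longrightarrow> y t < z t \<Longrightarrow> \<exists>X\<subseteq>V. t \<in> X \<and> s \<notin> X \<and> sum z X \<le> f X + 1"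
  shows False
proof -
  define P where "P X \<longleftrightarrow> X \<subseteq> V \<and> X \<noteq> {} \<and> s \<notin> X \<and> sum z X = f X + 1" for X
  have un: "P (X \<union> Y)" if "P X" "P Y" "X \<inter> Y \<noteq> {}" for X Y
  proof -
    have fin: "finite X" "finite Y" using that V finite_subset unfolding P_def by blast+
    have "sum z (X \<union> Y) + sum z (X \<inter> Y) = sum z X + sum z Y" using sum.union_inter[OF fin] .
    \<comment> \<open>Union and intersection are nonempty, so \<open>z\<close> obeys its lower bound
      on both; supermodularity leaves no slack in either inequality.\<close>
    moreover have "f (X \<inter> Y) + 1 \<le> sum z (X \<inter> Y)" "f (X \<union> Y) + 1 \<le> sum z (X \<union> Y)"
      by (rule z; use that in \<open>auto simp: P_def\<close>)+
    ultimately have "sum z (X \<union> Y) = f (X \<union> Y) + 1" using super[of X Y] that by (simp add: P_def)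
    then show ?thesis using that by (auto simp: P_def)
  qed
  define F where "F = {X. P X}"
  have "finite F" using V by (rule finite_subset[rotated, OF finite_Pow_iff[THEN iffD2]]) (auto simp: F_def P_def)
  then obtain F' where F': "finite F'" "\<Union>F' = \<Union>F" "\<And>X. X \<in> F' \<Longrightarrow> P X" "pairwise disjnt F'"
    using disjoint_refinement[of F P] un unfolding F_def by blast
  let ?U = "\<Union>F"
  have U: "?U \<subseteq> V" "s \<notin> ?U" by (auto simp: F_def P_def)
  have sums: "sum g ?U = (\<Sum>X\<in>F'. sum g X)" for g :: "'a \<Rightarrow> nat"
  proof -
    have "\<forall>A\<in>F'. finite A" using F'(3) V finite_subset unfolding P_def by blast
    moreover have "\<forall>A\<in>F'. \<forall>B\<in>F'. A \<noteq> B \<longrightarrow> A \<inter> B = {}" using F'(4) by (auto simp: pairwise_def disjnt_def)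
    ultimately show ?thesis using sum.Union_disjoint[of F' g] F'(2) by simp
  qed
  have "sum z ?U \<le> sum y ?U" unfolding sums
  proof (rule sum_mono)
    fix X assume "X \<in> F'"
    then have "P X" by (rule F'(3))
    then show "sum z X \<le> sum y X" using y[of X] by (simp add: P_def)
  qed
  \<comment> \<open>A vertex with \<open>y t < z t\<close> lies in a tight set and hence in the
    union. Outside it \<open>y\<close> dominates pointwise, and strictly at \<open>s\<close>;
    together with the union this contradicts \<open>total\<close>.\<close>
  moreover have "sum z (V - ?U) < sum y (V - ?U)"
  proof (rule sum_strict_mono_ex1)
    show "\<forall>t\<in>V - ?U. z t \<le> y t"
    proof (rule ccontr)
      assume "\<not> ?thesis"
      then obtain t where t: "t \<in> V" "t \<notin> ?U" "y t < z t" by (auto simp: not_le)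
      then obtain X where X: "X \<subseteq> V" "t \<in> X" "s \<notin> X" "sum z X \<le> f X + 1" using tight by blast
      then have "X \<noteq> {}" by blast
      then have "P X" using z[of X] X by (simp add: P_def)
      then show False using t X by (auto simp: F_def)
    qed
  qed (use V U s in auto)
  moreover have "sum g V = sum g ?U + sum g (V - ?U)" for g :: "'a \<Rightarrow> nat"
    using sum.subset_diff[OF U(1) V, of g] by simp
  ultimately show False using total by simp
qed

lemma reroute_reorients: "reorients D (reroute s t D)"
  unfolding reroute_def by (rule reorients_map_if)

lemma reorients_inside: "reorients E D \<Longrightarrow> inside D X = inside E X"
  and reorients_incid: "reorients E D \<Longrightarrow> length (incid D v) = length (incid E v)"
  by (simp_all add: inside_uedges incid_uedges reorients_uedges)

lemma enough_iff: "enough K \<rho> r D v \<longleftrightarrow> length (incid D v) \<le> length K * ncopies r D v"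
  by (simp add: enough_def length_copies)

lemma spare_iff:
  "spare K \<rho> r D v \<longleftrightarrow> into D v \<noteq> [] \<and> length (incid D v) \<le> length K * (ncopies r D v - 1)"
  by (simp add: spare_def length_copies)

lemma spare_enough: "spare K \<rho> r D t \<Longrightarrow> enough K \<rho> r D t"
  unfolding spare_iff enough_iff by (meson diff_le_self mult_le_mono2 order_trans)

text \<open>A candidate differs from D in the multiplicity of s, so that D = improve D means that there is none.\<close>

lemma improve_fixed:
  assumes "distinct D" "improve K \<rho> r V D = D" "s \<in> set V" "t \<in> set V"
    "\<not> enough K \<rho> r D s" "spare K \<rho> r D t" "(s, t) \<in> (rel D)\<^sup>*"
  shows "\<not> rooted r V (reroute s t D)"
proof
  let ?C = "filter (rooted r V) (map (\<lambda>p. reroute (fst p) (snd p) D)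
    (filter (\<lambda>p. \<not> enough K \<rho> r D (fst p) \<and> spare K \<rho> r D (snd p) \<and> snd p \<in> set (reached (fst p) D))
      (List.product V V)))"
  assume "rooted r V (reroute s t D)"
  then have "reroute s t D \<in> set ?C" using assms by (force simp: reached_iff)
  then have "improve K \<rho> r V D \<in> set ?C" by (cases ?C) (auto simp: improve_def first_or_def)
  then obtain s' t' where C: "improve K \<rho> r V D = reroute s' t' D" "\<not> enough K \<rho> r D s'" "spare K \<rho> r D t'"
      "(s', t') \<in> (rel D)\<^sup>*"
    by (auto simp: reached_iff)
  have "s' \<noteq> t'" using C(2) spare_enough[OF C(3)] by metis
  then show False using reroute_ncopies[OF assms(1) C(4), of r s'] C(1) assms(2) by simp
qed

text \<open>Instance of \<open>tight_sets\<close> where \<open>z\<close> counts copies and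
  \<open>y\<close> is a hypothetical solution. For each \<open>t\<close> with more copies than
  \<open>y t\<close>, the failure of a reversal from \<open>s\<close> to \<open>t\<close> must
  supply a tight set containing \<open>t\<close> but not \<open>s\<close>.\<close>

lemma improve_optimal:
  assumes D: "distinct D" "rooted r V D" "improve K \<rho> r V D = D"
    and arcs: "\<And>a. a \<in> set D \<Longrightarrow> tail a \<in> set V \<and> head a \<in> set V" and r: "r \<in> set V"
    and y: "\<And>X. X \<subseteq> set V \<Longrightarrow> X \<noteq> {} \<Longrightarrow> inside D X + 1 \<le> sum y X"
    and total: "sum y (set V) \<le> length D + 1"
    and demand: "\<And>v. v \<in> set V \<Longrightarrow> length (incid D v) \<le> length K * y v"
  shows "\<forall>v\<in>set V. enough K \<rho> r D v"
proof (rule ccontr)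
  assume "\<not> ?thesis"
  then obtain s where s: "s \<in> set V" "\<not> enough K \<rho> r D s" by blast
  have reach: "(r, v) \<in> (rel D)\<^sup>*" if "v \<in> set V" for v using D(2) that by (simp add: rooted_iff)
  have tot: "sum (ncopies r D) (set V) = length D + 1"
  proof -
    have "inside D (set V) = length D" using arcs by (auto simp: inside_def)
    then show ?thesis using ncopies_closed[of "set V" D r] arcs r by simp
  qed
  show False
  proof (rule tight_sets[of "set V" "inside D" y "ncopies r D" s])
    show "inside D X + 1 \<le> sum (ncopies r D) X" if X: "X \<subseteq> set V" "X \<noteq> {}" for X
    proof -
      obtain v where "v \<in> X" using X by blast
      then show ?thesis using ncopies_inside[of X v r D] reach X finite_subset[OF X(1)] by auto
    qed
    have "length K * ncopies r D s < length K * y s" using s demand[OF s(1)] unfolding enough_iff by linarith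
    then show "ncopies r D s < y s" by simp
    fix t assume t: "t \<in> set V" "y t < ncopies r D t"
    \<comment> \<open>Thus \<open>t\<close> has at least two copies, and an arc enters it even if
      one of them is the root copy.\<close>
    have "1 \<le> y t" using y[of "{t}"] t(1) by simp
    then have "into D t \<noteq> []" using t(2) by (auto simp: ncopies_def split: if_splits)
    moreover have "length K * y t \<le> length K * (ncopies r D t - 1)" using t(2) by (intro mult_le_mono2) simp
    ultimately have sp: "spare K \<rho> r D t" using order_trans[OF demand[OF t(1)]] unfolding spare_iff by blast
    show "\<exists>X\<subseteq>set V. t \<in> X \<and> s \<notin> X \<and> sum (ncopies r D) X \<le> inside D X + 1"
    proof (cases "(s, t) \<in> (rel D)\<^sup>*")
      case False
      \<comment> \<open>No arc leads from a vertex reachable from \<open>s\<close> into this set, so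
        its sum exceeds \<open>inside\<close> by at most the root copy.\<close>
      let ?X = "{v \<in> set V. (s, v) \<notin> (rel D)\<^sup>*}"
      have "sum (ncopies r D) ?X = (if r \<in> ?X then 1 else 0) + inside D ?X"
      proof (rule ncopies_closed)
        fix a assume a: "a \<in> set D" "head a \<in> ?X"
        then have "(tail a, head a) \<in> rel D" by (auto simp: rel_def)
        then have "(s, tail a) \<notin> (rel D)\<^sup>*" using a(2) rtrancl_into_rtrancl[of s "tail a" "rel D" "head a"] by auto
        then show "tail a \<in> ?X" using arcs a(1) by simp
      qed simp
      then show ?thesis using False t(1) by (intro exI[of _ ?X]) auto
    next
      case True
      let ?D = "reroute s t D"
      \<comment> \<open>The vertices that the reversal cuts off from \<open>r\<close>. Afterwards no
        arc enters them, so their sum equals \<open>inside\<close>, while before it was at least one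
        more. The reversal changes the sum by at most one, so \<open>t\<close> is in the set,
        \<open>s\<close> is not, and the set was tight.\<close>
      let ?X = "{v \<in> set V. (r, v) \<notin> (rel ?D)\<^sup>*}"
      have "\<not> rooted r V ?D" by (rule improve_fixed[OF D(1,3) s(1) t(1) s(2) sp True])
      then have ne: "?X \<noteq> {}" by (auto simp: rooted_iff)
      have arcs': "tail a \<in> set V \<and> head a \<in> set V" if "a \<in> set ?D" for a
      proof -
        obtain b where b: "b \<in> set D" "a = b \<or> a = turn b"
          using reorients_mem[OF reroute_reorients \<open>a \<in> set ?D\<close>] by blast
        from b(2) arcs[OF b(1)] show ?thesis by (elim disjE) simp_all
      qed
      have "sum (ncopies r ?D) ?X = (if r \<in> ?X then 1 else 0) + inside ?D ?X"
      proof (rule ncopies_closed)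
        fix a assume a: "a \<in> set ?D" "head a \<in> ?X"
        then have "(tail a, head a) \<in> rel ?D" by (auto simp: rel_def)
        then have "(r, tail a) \<notin> (rel ?D)\<^sup>*" using a(2) rtrancl_into_rtrancl[of r "tail a" "rel ?D" "head a"] by auto
        then show "tail a \<in> ?X" using arcs' a(1) by simp
      qed simp
      then have 1: "sum (ncopies r ?D) ?X = inside D ?X" by (simp add: reorients_inside[OF reroute_reorients])
      have "(\<Sum>v\<in>?X. ncopies r ?D v + (if v = t then 1 else 0)) = (\<Sum>v\<in>?X. ncopies r D v + (if v = s then 1 else 0))"
        by (intro sum.cong refl reroute_ncopies D True)
      then have 2: "sum (ncopies r ?D) ?X + (if t \<in> ?X then 1 else 0) = sum (ncopies r D) ?X + (if s \<in> ?X then 1 else 0)"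
        by (simp add: sum.distrib)
      obtain v where v: "v \<in> ?X" using ne by blast
      have 3: "inside D ?X + 1 \<le> sum (ncopies r D) ?X" using v by (intro ncopies_inside[OF _ v] reach) auto
      have "t \<in> ?X" "s \<notin> ?X" "sum (ncopies r D) ?X \<le> inside D ?X + 1"
        using 1 2 3 by (auto split: if_splits)
      then show ?thesis by (intro exI[of _ ?X]) blast
    qed
  qed (use inside_supermodular tot total y s(1) in auto)
qed

text \<open>Every round that changes something costs potential, so after as many rounds as the
  initial potential a fixed point has been reached.\<close>

lemma funpow_fixed:
  fixes \<Phi> :: "'x \<Rightarrow> nat"
  assumes "I x" "\<And>y. I y \<Longrightarrow> I (F y)" "\<And>y. I y \<Longrightarrow> F y = y \<or> \<Phi> (F y) < \<Phi> y" "\<Phi> x \<le> n"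
  shows "I ((F ^^ n) x)" "F ((F ^^ n) x) = (F ^^ n) x"
proof -
  have *: "I ((F ^^ i) x) \<and> (F ((F ^^ i) x) = (F ^^ i) x \<or> \<Phi> ((F ^^ i) x) + i \<le> \<Phi> x)" for i
  proof (induction i)
    case (Suc i)
    then show ?case using assms(2) assms(3)[of "(F ^^ i) x"] by auto
  qed (simp add: assms(1))
  show "I ((F ^^ n) x)" using * by blast
  show "F ((F ^^ n) x) = (F ^^ n) x" using *[of n] assms(3)[of "(F ^^ n) x"] assms(4) by auto
qed

lemma orient0_rooted:
  assumes "\<And>v. v \<in> set V \<Longrightarrow> (r, v) \<in> (rel (E @ map turn E))\<^sup>*"
  shows "rooted r V (orient0 r E)"
  unfolding rooted_iff
proof
  let ?T = "grow r (E @ map turn E)"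
  fix v assume "v \<in> set V"
  then have "v \<in> set (reached r (E @ map turn E))" using assms reached_iff by metis
  then have "(r, v) \<in> (rel ?T)\<^sup>*" using arborescence_reach[OF arborescence_grow] unfolding reached_def by metis
  moreover have "rel ?T \<subseteq> rel (orient0 r E)"
  proof -
    obtain rk :: "'a \<Rightarrow> nat" where rk: "\<And>a. a \<in> set ?T \<Longrightarrow> rk (tail a) < rk (head a)"
      using arborescence_rank[OF arborescence_grow] by metis
    have "a \<in> set (orient0 r E)" if a: "a \<in> set ?T" for a
    proof -
      \<comment> \<open>The tree never uses an edge in both directions, so the directions it
        prescribes are consistent.\<close>
      have nt: "turn a \<notin> set ?T" using rk[OF a] rk[of "turn a"] by auto
      from a grow_subset[of r "E @ map turn E"] consider "a \<in> set E" | b where "b \<in> set E" "a = turn b" by fastforce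
      then show ?thesis
      proof cases
        case 1
        then show ?thesis using nt unfolding orient0_def by force
      next
        case 2
        then show ?thesis using a unfolding orient0_def by force
      qed
    qed
    then show ?thesis by (auto simp: rel_def)
  qed
  ultimately show "(r, v) \<in> (rel (orient0 r E))\<^sup>*" using rtrancl_mono by blast
qed

text \<open>Handshaking, which bounds the potentials of both local searches.\<close>

lemma sum_incid:
  assumes "finite W" "\<And>a. a \<in> set D \<Longrightarrow> tail a \<in> W \<and> head a \<in> W"
  shows "(\<Sum>v\<in>W. length (incid D v)) = 2 * length D"
proof -
  have "filter (\<lambda>a. tail a \<in> W) D = D" "filter (\<lambda>a. head a \<in> W) D = D"
    using assms(2) by (simp_all add: filter_id_conv)
  then show ?thesis
    using length_filter_sum[OF assms(1), of tail D] length_filter_sum[OF assms(1), of head D]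
    by (simp add: incid_def into_def sum.distrib)
qed

lemma optimum_props:
  fixes \<rho> :: 'i and E :: "('i, 'a) arc list"
  assumes E: "distinct (map fst E)" "\<And>a. a \<in> set E \<Longrightarrow> tail a \<in> set V \<and> head a \<in> set V"
    and conn: "\<And>v. v \<in> set V \<Longrightarrow> (r, v) \<in> (rel (E @ map turn E))\<^sup>*" and K: "K \<noteq> []"
  defines "D \<equiv> optimum K \<rho> r V E"
  shows "reorients E D" "rooted r V D" "improve K \<rho> r V D = D"
proof -
  define I where "I D \<longleftrightarrow> reorients E D \<and> rooted r V D" for D :: "('i, 'a) arc list"
  \<comment> \<open>Truncated subtraction: surplus at one vertex does not compensate a deficit at
    another.\<close>
  define \<Phi> where "\<Phi> D = (\<Sum>v\<in>set V. length (incid D v) - length K * ncopies r D v)" for D :: "('i, 'a) arc list"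
  have imp: "I (improve K \<rho> r V D) \<and> (improve K \<rho> r V D = D \<or> \<Phi> (improve K \<rho> r V D) < \<Phi> D)" if D: "I D" for D
  proof (cases rule: improve_cases[of K \<rho> r V D])
    case (2 s t)
    have "distinct (map fst D)" using D E(1) reorients_fst unfolding I_def by metis
    then have dist: "distinct D" by (simp add: distinct_map)
    have st: "(s, t) \<in> (rel D)\<^sup>*" using 2(6) by (simp add: reached_iff)
    note nc = reroute_ncopies[OF dist st, of r]
    have ne: "s \<noteq> t" using 2(4) spare_enough[OF 2(5)] by metis
    have inc: "length (incid (reroute s t D) v) = length (incid D v)" for v
      by (rule reorients_incid[OF reroute_reorients])
    have "\<Phi> (reroute s t D) < \<Phi> D" unfolding \<Phi>_def inc
    proof (rule sum_strict_mono_ex1)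
      show "\<forall>v\<in>set V. length (incid D v) - length K * ncopies r (reroute s t D) v \<le> length (incid D v) - length K * ncopies r D v"
      proof
        fix v
        show "length (incid D v) - length K * ncopies r (reroute s t D) v \<le> length (incid D v) - length K * ncopies r D v"
        proof (cases "v = t")
          case True
          \<comment> \<open>Only \<open>t\<close> loses a copy, and being spare it stays without
            deficit.\<close>
          then have "ncopies r (reroute s t D) v = ncopies r D v - 1" using nc[of t] ne by simp
          then show ?thesis using 2(5) True by (simp add: spare_iff)
        next
          case False
          then have "ncopies r D v \<le> ncopies r (reroute s t D) v" using nc[of v] by simp
          then show ?thesis by (intro diff_le_mono2 mult_le_mono2)
        qed
      qed
      have "length K * ncopies r D s < length (incid D s)" using 2(4) by (simp add: enough_iff)
      moreover have "ncopies r (reroute s t D) s = ncopies r D s + 1" using nc[of s] ne by simp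
      moreover have "0 < length K" using K by simp
      ultimately have "length (incid D s) - length K * ncopies r (reroute s t D) s < length (incid D s) - length K * ncopies r D s"
        by (simp only: distrib_left mult_1_right)
      then show "\<exists>v\<in>set V. length (incid D v) - length K * ncopies r (reroute s t D) v < length (incid D v) - length K * ncopies r D v"
        using 2(2) by blast
    qed simp
    moreover have "reorients E D" using D by (simp add: I_def)
    from reorients_trans[OF this reroute_reorients] have "I (reroute s t D)" using 2(7) by (simp add: I_def)
    ultimately show ?thesis using 2(1) by simp
  qed (use D in simp)
  have "\<Phi> (orient0 r E) \<le> length (E @ E)"
  proof -
    have "\<Phi> (orient0 r E) \<le> (\<Sum>v\<in>set V. length (incid (orient0 r E) v))" unfolding \<Phi>_def by (intro sum_mono) simp
    also have "\<dots> = (\<Sum>v\<in>set V. length (incid E v))"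
      by (intro sum.cong refl reorients_incid) (simp add: orient0_def reorients_map_if)
    also have "\<dots> = 2 * length E" using E(2) by (intro sum_incid) auto
    finally show ?thesis by simp
  qed
  moreover have "I (orient0 r E)"
  proof -
    have "rooted r V (orient0 r E)" by (rule orient0_rooted) (rule conn)
    moreover have "reorients E (orient0 r E)" unfolding orient0_def by (rule reorients_map_if)
    ultimately show ?thesis by (simp add: I_def)
  qed
  moreover have "I (improve K \<rho> r V D)" if "I D" for D by (rule conjunct1[OF imp[OF that]])
  moreover have "improve K \<rho> r V D = D \<or> \<Phi> (improve K \<rho> r V D) < \<Phi> D" if "I D" for D
    by (rule conjunct2[OF imp[OF that]])
  ultimately have "I D \<and> improve K \<rho> r V D = D"
    using funpow_fixed[of I "orient0 r E" "improve K \<rho> r V" \<Phi> "length (E @ E)"]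
    unfolding D_def optimum_def by metis
  then show "reorients E D" "rooted r V D" "improve K \<rho> r V D = D" by (auto simp: I_def)
qed

section \<open>Trails yield demands\<close>

lemma vdegree_incid: "edges G = uedges D \<Longrightarrow> vdegree G v = length (incid D v)"
  by (simp add: vdegree_def incid_uedges)

text \<open>\<open>hom_image\<close> compares multiplicities only for pairs of vertices of
  \<open>G\<close>; since all edges join vertices of their graph, this determines the whole
  multiset.\<close>

lemma hom_image_edges:
  fixes G :: "'v multigraph" and H :: "'w multigraph"
  assumes h: "hom_image G H \<phi>" and G: "is_graph G" and H: "is_graph H"
  shows "edges G = image_mset (map_uprod \<phi>) (edges H)"
proof (rule multiset_eqI)
  fix e :: "'v uprod"
  obtain u v where e: "e = Upair u v" by (cases e)
  have cnt: "count (image_mset (map_uprod \<phi>) M) e = size {#f \<in># M. map_uprod \<phi> f = e#}" for M :: "'w uprod multiset"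
    by (induction M) auto
  show "count (edges G) e = count (image_mset (map_uprod \<phi>) (edges H)) e"
  proof (cases "u \<in> verts G \<and> v \<in> verts G")
    case True
    then show ?thesis using h cnt[of "edges H"] by (simp add: hom_image_def e)
  next
    case False
    have "e \<notin># edges G" using False G by (auto simp: is_graph_def e)
    moreover have "e \<notin># image_mset (map_uprod \<phi>) (edges H)"
    proof
      assume "e \<in># image_mset (map_uprod \<phi>) (edges H)"
      then obtain f where f: "f \<in># edges H" "e = map_uprod \<phi> f" by auto
      have "set_uprod f \<subseteq> verts H" using f(1) H by (auto simp: is_graph_def)
      then have "set_uprod e \<subseteq> verts G" using h f(2) by (auto simp: hom_image_def uprod.set_map)
      then show False using False e by simp
    qed
    ultimately show ?thesis by (metis not_in_iff)
  qed
qed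

text \<open>Edges are directed towards the endpoint farther from \<open>w0\<close>. Shortest paths
  use only edges along which the distance grows, so ties may be oriented arbitrarily.\<close>

lemma connected_orientation:
  assumes H: "is_graph H" and w0: "w0 \<in> verts H"
  obtains A :: "(unit, 'a) arc list" where "uedges A = edges H" "\<And>w. w \<in> verts H \<Longrightarrow> (w0, w) \<in> (rel A)\<^sup>*"
proof -
  define dst where "dst w = (LEAST n. (w0, w) \<in> adj H ^^ n)" for w
  have "\<exists>L :: ('a \<times> 'a) list. mset (map (\<lambda>p. Upair (fst p) (snd p)) L) = M" for M :: "'a uprod multiset"
  proof (induction M)
    case (add e M)
    then obtain L :: "('a \<times> 'a) list" where "mset (map (\<lambda>p. Upair (fst p) (snd p)) L) = M" by blast
    moreover obtain u v where "e = Upair u v" by (cases e)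
    ultimately show ?case by (intro exI[of _ "(u, v) # L"]) simp
  qed simp
  then obtain L :: "('a \<times> 'a) list" where L: "mset (map (\<lambda>p. Upair (fst p) (snd p)) L) = edges H" by blast
  define A :: "(unit, 'a) arc list" where "A = map (\<lambda>p. if dst (fst p) \<le> dst (snd p) then ((), fst p, snd p) else ((), snd p, fst p)) L"
  have "map (\<lambda>a. Upair (tail a) (head a)) A = map (\<lambda>p. Upair (fst p) (snd p)) L"
    unfolding A_def by (simp add: tail_def head_def)
  then have uA: "uedges A = edges H" by (simp only: uedges_def L)
  have arc: "(u, v) \<in> rel A" if uv: "(u, v) \<in> adj H" "dst u < dst v" for u v
  proof -
    have "Upair u v \<in> set (map (\<lambda>p. Upair (fst p) (snd p)) L)"
      using uv(1) L by (metis (mono_tags, lifting) adj_def case_prodD mem_Collect_eq set_mset_mset)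
    then obtain p where p: "p \<in> set L" "Upair u v = Upair (fst p) (snd p)" by auto
    from p(2) consider "fst p = u" "snd p = v" | "fst p = v" "snd p = u" by auto
    then have "((), u, v) \<in> set A" unfolding A_def
      by cases (use p(1) uv(2) in \<open>force+\<close>)
    then show ?thesis by (force simp: rel_def)
  qed
  have reach: "(w0, w) \<in> (rel A)\<^sup>*" if w: "(w0, w) \<in> (adj H)\<^sup>*" for w
    using w
  proof (induction "dst w" arbitrary: w rule: less_induct)
    case less
    obtain n where n: "(w0, w) \<in> adj H ^^ n" using less.prems rtrancl_imp_relpow by blast
    have d: "(w0, w) \<in> adj H ^^ dst w" unfolding dst_def using n by (rule LeastI)
    show ?case
    proof (cases "dst w")
      case 0
      then show ?thesis using d by simp
    next
      case (Suc m)
      with d obtain u where u: "(w0, u) \<in> adj H ^^ m" "(u, w) \<in> adj H" by auto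
      have "dst u \<le> m" unfolding dst_def using u(1) by (rule Least_le)
      then have lt: "dst u < dst w" using Suc by simp
      have "(w0, u) \<in> (adj H)\<^sup>*" using u(1) relpow_imp_rtrancl by blast
      then have "(w0, u) \<in> (rel A)\<^sup>*" using less.hyps lt by blast
      then show ?thesis using arc[OF u(2) lt] by simp
    qed
  qed
  show ?thesis
    using that[OF uA] reach H w0 by (auto simp: is_graph_def connected_graph_def)
qed

lemma trail_demand:
  assumes G: "is_graph G" and trail: "k_trail k G"
  obtains y where "\<And>X. X \<subseteq> verts G \<Longrightarrow> X \<noteq> {} \<Longrightarrow> size {#e \<in># edges G. set_uprod e \<subseteq> X#} + 1 \<le> sum y X"
    "sum y (verts G) = size (edges G) + 1" "\<And>v. v \<in> verts G \<Longrightarrow> vdegree G v \<le> k * y v"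
proof -
  obtain H :: "nat multigraph" and \<phi> where H: "is_graph H" "max_degree_le H k" and hom: "hom_image G H \<phi>"
    using trail unfolding k_trail_def by blast
  have eG: "edges G = image_mset (map_uprod \<phi>) (edges H)" by (rule hom_image_edges[OF hom G H(1)])
  have finH: "finite (verts H)" and finG: "finite (verts G)" using H(1) G by (auto simp: is_graph_def)
  have img: "\<phi> ` verts H = verts G" using hom by (simp add: hom_image_def)
  obtain w0 where w0: "w0 \<in> verts H" using H(1) by (fastforce simp: is_graph_def)
  obtain A :: "(unit, nat) arc list" where A: "uedges A = edges H" "\<And>w. w \<in> verts H \<Longrightarrow> (w0, w) \<in> (rel A)\<^sup>*"
    using connected_orientation[OF H(1) w0] by metis
  define B :: "(unit, 'a) arc list" where "B = map (\<lambda>a. ((), \<phi> (tail a), \<phi> (head a))) A"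
  have uB: "uedges B = edges G"
  proof -
    have "uedges B = image_mset (map_uprod \<phi>) (uedges A)"
      unfolding B_def uedges_def by (simp add: multiset.map_comp comp_def)
    then show ?thesis by (simp add: A(1) eG)
  qed
  have arcsA: "tail a \<in> verts H \<and> head a \<in> verts H" if "a \<in> set A" for a
  proof -
    have "Upair (tail a) (head a) \<in># uedges A" using that by (auto simp: uedges_def)
    then show ?thesis using A(1) H(1) by (auto simp: is_graph_def)
  qed
  have reachB: "(\<phi> w0, v) \<in> (rel B)\<^sup>*" if v: "v \<in> verts G" for v
  proof -
    obtain w where w: "w \<in> verts H" "v = \<phi> w" using img v by blast
    have "(\<phi> w0, \<phi> w) \<in> (rel B)\<^sup>*" using A(2)[OF w(1)]
    proof (induction rule: rtrancl_induct)
      case (step x z)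
      then have "(\<phi> x, \<phi> z) \<in> rel B" unfolding rel_def B_def by (force simp: image_iff)
      then show ?case using step.IH by simp
    qed simp
    then show ?thesis using w by simp
  qed
  \<comment> \<open>The numbers of preimages themselves would not do: if \<open>H\<close> has a
    cycle, they add up to less than |E| + 1. Counting entering arcs makes the total exact.\<close>
  let ?y = "ncopies (\<phi> w0) B"
  show ?thesis
  proof
    show "size {#e \<in># edges G. set_uprod e \<subseteq> X#} + 1 \<le> sum ?y X" if X: "X \<subseteq> verts G" "X \<noteq> {}" for X
    proof -
      obtain v where v: "v \<in> X" using X(2) by blast
      then have "inside B X + 1 \<le> sum ?y X"
        using ncopies_inside[of X v "\<phi> w0" B] reachB X(1) finG finite_subset by blast
      then show ?thesis by (simp add: inside_uedges uB)
    qed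
    have "head a \<in> verts G" if "a \<in> set B" for a
      using that arcsA img by (auto simp: B_def)
    then have "filter (\<lambda>a. head a \<in> verts G) B = B" by (simp add: filter_id_conv)
    then show "sum ?y (verts G) = size (edges G) + 1"
      using finG w0 img length_uedges[of B] uB by (auto simp: sum_ncopies)
    fix v assume v: "v \<in> verts G"
    let ?W = "{w \<in> verts H. \<phi> w = v}"
    have W: "finite ?W" using finH by simp
    have cnt: "length (filter (\<lambda>a. \<phi> (f a) = v) A) = (\<Sum>w\<in>?W. length (filter (\<lambda>a. f a = w) A))"
      if "\<And>a. a \<in> set A \<Longrightarrow> f a \<in> verts H" for f
      unfolding length_filter_sum[OF W, symmetric] using that by (intro arg_cong[where f = length] filter_cong) auto
    have "vdegree G v = length (incid B v)" by (rule vdegree_incid) (simp add: uB)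
    also have "\<dots> = length (filter (\<lambda>a. \<phi> (tail a) = v) A) + length (filter (\<lambda>a. \<phi> (head a) = v) A)"
      by (simp add: incid_def into_def B_def filter_map comp_def)
    also have "\<dots> = (\<Sum>w\<in>?W. length (incid A w))"
      using cnt[of tail] cnt[of head] arcsA by (simp add: incid_def into_def sum.distrib)
    \<comment> \<open>Every vertex of \<open>H\<close> is \<open>w0\<close> or is entered by an arc,
      so it contributes at least one.\<close>
    also have "\<dots> \<le> (\<Sum>w\<in>?W. k * ncopies w0 A w)"
    proof (rule sum_mono)
      fix w assume w: "w \<in> ?W"
      have "vdegree H w \<le> k" using H(2) w by (simp add: max_degree_le_def)
      moreover have "vdegree H w = length (incid A w)" by (rule vdegree_incid) (simp add: A(1))
      moreover have "1 \<le> ncopies w0 A w"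
        using ncopies_inside[of "{w}" w w0 A] A(2) w by simp
      then have "k * 1 \<le> k * ncopies w0 A w" by (rule mult_le_mono2)
      ultimately show "length (incid A w) \<le> k * ncopies w0 A w" by linarith
    qed
    also have "\<dots> = k * sum (ncopies w0 A) ?W" by (simp add: sum_distrib_left)
    also have "sum (ncopies w0 A) ?W \<le> ?y v"
    proof -
      have "length (filter (\<lambda>a. head a \<in> ?W) A) \<le> length (into B v)"
        unfolding into_def B_def by (simp add: filter_map comp_def) (induction A; simp)
      moreover have "sum (ncopies w0 A) ?W = (if w0 \<in> ?W then 1 else 0) + length (filter (\<lambda>a. head a \<in> ?W) A)"
        by (rule sum_ncopies[OF W])
      moreover have "?y v = (if v = \<phi> w0 then 1 else 0) + length (into B v)" by (simp only: ncopies_def)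
      ultimately show ?thesis by auto
    qed
    finally show "vdegree G v \<le> k * ?y v" by simp
  qed
qed

section \<open>Splitting the vertices\<close>

text \<open>Cut the path at its first visit to \<open>p\<close>.\<close>

lemma rtrancl_avoid_source:
  assumes "(x, p) \<in> R\<^sup>*"
  shows "(x, p) \<in> (R - {p} \<times> UNIV)\<^sup>*"
  using assms
proof (induction rule: converse_rtrancl_induct)
  case (step y z)
  then show ?case by (cases "y = p") (auto intro: converse_rtrancl_into_rtrancl)
qed simp

text \<open>A path may be assumed to visit \<open>p\<close> only once, and then it leaves
  \<open>p\<close> by at most one of the two arcs.\<close>

lemma rtrancl_avoid_one:
  assumes "(x, q) \<in> R\<^sup>*" "c \<noteq> d"
  shows "(x, q) \<in> (R - {(p, c)})\<^sup>* \<or> (x, q) \<in> (R - {(p, d)})\<^sup>*"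
  using assms(1)
proof (induction rule: rtrancl_induct)
  case (step y z)
  have both: "(x, y) \<in> (R - {(p, c)})\<^sup>* \<and> (x, y) \<in> (R - {(p, d)})\<^sup>*" if "y = p"
  proof -
    have "(x, y) \<in> (R - {y} \<times> UNIV)\<^sup>*" using step.hyps(1) by (rule rtrancl_avoid_source)
    moreover have "(R - {y} \<times> UNIV)\<^sup>* \<subseteq> (R - {(p, c)})\<^sup>*" "(R - {y} \<times> UNIV)\<^sup>* \<subseteq> (R - {(p, d)})\<^sup>*"
      using that by (intro rtrancl_mono; auto)+
    ultimately show ?thesis by blast
  qed
  show ?case
  proof (cases "y = p")
    case True
    then have "(y, z) \<in> R - {(p, c)} \<or> (y, z) \<in> R - {(p, d)}" using step.hyps(2) assms(2) by auto
    then show ?thesis using both[OF True] by (meson rtrancl_into_rtrancl)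
  next
    case False
    then have "(y, z) \<in> R - {(p, c)}" "(y, z) \<in> R - {(p, d)}" using step.hyps(2) by auto
    then show ?thesis using step.IH by (meson rtrancl_into_rtrancl)
  qed
qed simp

section \<open>Moving a subtree to another copy\<close>

lemma rehang_rel: "rel H - {(tail h, head h)} \<subseteq> rel (rehang h b H)"
proof
  fix x assume "x \<in> rel H - {(tail h, head h)}"
  then obtain a where a: "a \<in> set H" "x = (tail a, head a)" "a \<noteq> h" unfolding rel_def by blast
  then have "a \<in> set (rehang h b H)" unfolding rehang_def by simp
  then show "x \<in> rel (rehang h b H)" unfolding rel_def a(2) by (rule imageI)
qed

lemma rehang_new:
  assumes "h \<in> set H"
  shows "(b, head h) \<in> rel (rehang h b H)"
proof -
  have "(fst h, b, head h) \<in> set (rehang h b H)"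
    unfolding rehang_def using assms by simp
  from imageI[OF this, of "\<lambda>a. (tail a, head a)"] show ?thesis unfolding rel_def by simp
qed

text \<open>If \<open>q\<close> can be reached without the moved arc, then so can the head of that
  arc through \<open>q\<close> after the move, and paths that used the old arc can start afresh from
  there.\<close>

lemma rehang_rooted:
  assumes h: "h \<in> set H" and q: "(\<rho>, q) \<in> (rel H - {(tail h, head h)})\<^sup>*" and root: "rooted \<rho> W H"
  shows "rooted \<rho> W (rehang h q H)"
  unfolding rooted_iff
proof
  let ?R = "rel (rehang h q H)"
  have "(\<rho>, q) \<in> ?R\<^sup>*" by (rule subsetD[OF rtrancl_mono[OF rehang_rel] q])
  then have c: "(\<rho>, head h) \<in> ?R\<^sup>*" using rehang_new[OF h] by (rule rtrancl_into_rtrancl)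
  fix w assume "w \<in> set W"
  then have "(\<rho>, w) \<in> (rel H)\<^sup>*" using root by (simp add: rooted_iff)
  then show "(\<rho>, w) \<in> ?R\<^sup>*"
  proof (induction rule: rtrancl_induct)
    case (step y z)
    show ?case
    proof (cases "(y, z) = (tail h, head h)")
      case False
      then have "(y, z) \<in> ?R" using step.hyps(2) by (intro subsetD[OF rehang_rel]) simp
      then show ?thesis using step.IH by (rule rtrancl_into_rtrancl[rotated])
    qed (use c in simp)
  qed simp
qed

lemma rehang_incid:
  assumes "distinct H" "h \<in> set H"
  shows "length (incid (rehang h b H) p) + (if p = tail h then 1 else 0) = length (incid H p) + (if p = b then 1 else 0)"
proof -
  have id: "h \<notin> set H \<Longrightarrow> rehang h b H = H" for H :: "('a, 'b) arc list"
    unfolding rehang_def by (rule map_idI) auto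
  have "length (into (rehang h b H) p) = length (into H p)"
    unfolding into_def rehang_def by (induction H) auto
  moreover have "length (filter (\<lambda>a. tail a = p) (rehang h b H)) + (if p = tail h then 1 else 0)
      = length (filter (\<lambda>a. tail a = p) H) + (if p = b then 1 else 0)"
    using assms
  proof (induction H)
    case (Cons a H)
    show ?case
    proof (cases "a = h")
      case True
      then have "rehang h b (a # H) = (fst h, b, head h) # H" using Cons.prems id[of H] by (simp add: rehang_def)
      then show ?thesis using True by auto
    next
      case False
      then have "rehang h b (a # H) = a # rehang h b H" by (simp add: rehang_def)
      then show ?thesis using Cons False by auto
    qed
  qed simp
  ultimately show ?thesis by (simp add: incid_def)
qed

lemma filter_map_memI: "x \<in> set xs \<Longrightarrow> P (f x) \<Longrightarrow> f x \<in> set (filter P (map f xs))"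
  by auto

lemma length_filter_eq_distinct: "distinct xs \<Longrightarrow> length (filter (\<lambda>x. x = p) xs) = (if p \<in> set xs then 1 else 0)"
  by (induction xs) auto

text \<open>What a successful search for an orientation provides. From here on \<open>\<rho>\<close>
  and the tags are the vertices of the preimage.\<close>

locale oriented =
  fixes K :: "unit list" and \<rho> :: 'i and r :: 'a and V :: "'a list" and D :: "('i, 'a) arc list"
  assumes ids: "distinct (map fst D)" and root_id: "\<rho> \<notin> fst ` set D"
    and arcs: "\<And>a. a \<in> set D \<Longrightarrow> tail a \<in> set V \<and> head a \<in> set V"
    and root: "rooted r V D" and demand: "\<And>v. v \<in> set V \<Longrightarrow> enough K \<rho> r D v" and K: "K \<noteq> []"
    and r: "r \<in> set V"
begin

abbreviation "cp \<equiv> copies \<rho> r D"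
abbreviation "names \<equiv> \<rho> # map fst D"

lemma distinct_names: "distinct names"
  using ids root_id by simp

lemma id_inj: "a \<in> set D \<Longrightarrow> b \<in> set D \<Longrightarrow> fst a = fst b \<Longrightarrow> a = b"
  using ids by (simp add: distinct_map inj_on_def)

lemma in_cp: "p \<in> set (cp v) \<longleftrightarrow> p = \<rho> \<and> v = r \<or> (\<exists>a\<in>set D. p = fst a \<and> head a = v)"
  unfolding copies_def into_def by auto

text \<open>Together with \<open>names_cp\<close>: the copies partition the names, so the map from
  names to vertices is well defined.\<close>

lemma cp_disjoint:
  assumes "p \<in> set (cp u)" "p \<in> set (cp v)"
  shows "u = v"
proof (cases "p \<in> fst ` set D")
  case True
  then have "p \<noteq> \<rho>" using root_id by metis
  then obtain a b where "a \<in> set D" "p = fst a" "head a = u" "b \<in> set D" "p = fst b" "head b = v"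
    using assms unfolding in_cp by blast
  then show ?thesis using id_inj[of a b] by simp
next
  case False
  then show ?thesis using assms unfolding in_cp by blast
qed

lemma cp_names: "p \<in> set (cp v) \<Longrightarrow> p \<in> set names"
  unfolding in_cp by auto

lemma names_cp: "p \<in> set names \<Longrightarrow> \<exists>v\<in>set V. p \<in> set (cp v)"
proof -
  assume "p \<in> set names"
  then consider "p = \<rho>" | a where "a \<in> set D" "p = fst a" by auto
  then show ?thesis
  proof cases
    case 1
    then show ?thesis using r by (intro bexI[of _ r]) (simp_all add: in_cp)
  next
    case 2
    then show ?thesis using arcs[OF 2(1)] by (intro bexI[of _ "head a"]) (auto simp: in_cp)
  qed
qed

lemma cp_id:
  assumes "a \<in> set D"
  shows "fst a \<in> set (cp v) \<longleftrightarrow> head a = v"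
proof -
  have "fst a \<in> set (cp (head a))" using assms unfolding in_cp by blast
  then show ?thesis using cp_disjoint by metis
qed

lemma distinct_cp: "distinct (cp v)"
proof -
  have "distinct (map fst (into D v))" unfolding into_def by (rule distinct_map_filter[OF ids])
  then show ?thesis unfolding copies_def using root_id by (auto simp: into_def)
qed

text \<open>An arc of \<open>D\<close> from u with tag i becomes an arc tagged u into the copy i;
  only which copy of u is its tail is left open. Each name except \<open>\<rho>\<close> is thus the
  head of exactly one arc, and with \<open>rooted\<close> this makes \<open>H\<close> an
  arborescence.\<close>

definition splits :: "('a, 'i) arc list \<Rightarrow> bool" where
  "splits H \<longleftrightarrow> map (\<lambda>h. (fst h, head h)) H = map (\<lambda>a. (tail a, fst a)) D \<and>
     (\<forall>h\<in>set H. tail h \<in> set (cp (fst h))) \<and> rooted \<rho> names H"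

lemma splits_heads: "splits H \<Longrightarrow> map head H = map fst D"
proof -
  assume "splits H"
  then have "map snd (map (\<lambda>h. (fst h, head h)) H) = map snd (map (\<lambda>a. (tail a, fst a)) D)"
    unfolding splits_def by (simp only:)
  then show ?thesis by (simp add: comp_def)
qed

lemma splits_distinct: "splits H \<Longrightarrow> distinct H"
proof -
  assume "splits H"
  from splits_heads[OF this] have "distinct (map head H)" using ids by simp
  then show ?thesis by (simp add: distinct_map)
qed

lemma splits_head_inj: "splits H \<Longrightarrow> h \<in> set H \<Longrightarrow> h' \<in> set H \<Longrightarrow> head h = head h' \<Longrightarrow> h = h'"
proof -
  assume "splits H" "h \<in> set H" "h' \<in> set H" "head h = head h'"
  moreover have "distinct (map head H)" using splits_heads[OF \<open>splits H\<close>] ids by simp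
  ultimately show ?thesis by (simp add: distinct_map inj_on_def)
qed

lemma splits_names:
  assumes "splits H" "h \<in> set H"
  shows "tail h \<in> set names" "head h \<in> fst ` set D" "tail h \<in> set (cp (fst h))"
proof -
  show t: "tail h \<in> set (cp (fst h))" using assms by (simp add: splits_def)
  show "tail h \<in> set names" by (rule cp_names[OF t])
  have "head h \<in> set (map head H)" using assms(2) by simp
  then show "head h \<in> fst ` set D" unfolding splits_heads[OF assms(1)] by simp
qed

text \<open>Arc ends at copies of \<open>v\<close> correspond to arc ends at \<open>v\<close>, so
  the average degree of the copies is known whatever the distribution.\<close>

lemma splits_degree:
  assumes "splits H"
  shows "(\<Sum>q\<in>set (cp v). length (incid H q)) = length (incid D v)"
proof -
  have "tail h \<in> set (cp v) \<longleftrightarrow> fst h = v" if "h \<in> set H" for h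
    using splits_names(3)[OF assms that] cp_disjoint by metis
  then have "filter (\<lambda>h. tail h \<in> set (cp v)) H = filter (\<lambda>h. fst h = v) H"
    by (rule filter_cong[OF refl])
  then have "length (filter (\<lambda>h. tail h \<in> set (cp v)) H) = length (filter (\<lambda>x. fst x = v) (map (\<lambda>h. (fst h, head h)) H))"
    by (simp add: filter_map comp_def)
  also have "\<dots> = length (filter (\<lambda>a. tail a = v) D)"
    using assms unfolding splits_def by (simp add: filter_map comp_def)
  finally have 1: "length (filter (\<lambda>h. tail h \<in> set (cp v)) H) = length (filter (\<lambda>a. tail a = v) D)" .
  have "length (filter (\<lambda>h. head h \<in> set (cp v)) H) = length (filter (\<lambda>p. p \<in> set (cp v)) (map head H))"
    by (simp add: filter_map comp_def)
  also have "\<dots> = length (filter (\<lambda>a. fst a \<in> set (cp v)) D)"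
    by (simp add: splits_heads[OF assms] filter_map comp_def)
  also have "\<dots> = length (filter (\<lambda>a. head a = v) D)"
    by (intro arg_cong[where f = length] filter_cong) (auto simp: cp_id)
  finally have 2: "length (filter (\<lambda>h. head h \<in> set (cp v)) H) = length (filter (\<lambda>a. head a = v) D)" .
  show ?thesis
    using 1 2 by (simp add: incid_def into_def sum.distrib length_filter_sum)
qed

text \<open>The origin copies are reached along the search tree of \<open>D\<close>, by induction on
  the rank; any other copy hangs directly on the origin copy of the tail of its arc.\<close>

lemma splits_split0: "splits (split0 \<rho> r D)"
proof -
  let ?T = "grow r D"
  let ?o = "origin \<rho> r D"
  let ?H = "split0 \<rho> r D"
  obtain rk :: "'a \<Rightarrow> nat" where rk: "\<And>a. a \<in> set ?T \<Longrightarrow> rk (tail a) < rk (head a)"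
    using arborescence_rank[OF arborescence_grow] by metis
  have origin: "?o u = \<rho> \<and> u = r \<or> (\<exists>b\<in>set ?T. ?o u = fst b \<and> head b = u)" if u: "u \<in> set V" for u
  proof (cases "u = r")
    case False
    then have "u \<in> head ` set ?T" using root u by (auto simp: rooted_def reached_def)
    then have "into ?T u \<noteq> []" by (auto simp: into_def filter_empty_conv)
    then obtain b bs where b: "into ?T u = b # bs" by (cases "into ?T u") auto
    then have "b \<in> set (into ?T u)" by simp
    then show ?thesis using False b by (auto simp: origin_def first_or_def into_def)
  qed (simp add: origin_def)
  have reach: "(\<rho>, ?o u) \<in> (rel ?H)\<^sup>*" if "u \<in> set V" for u
    using that
  proof (induction "rk u" arbitrary: u rule: less_induct)
    case less
    from origin[OF less.prems] show ?case
    proof (elim disjE conjE bexE)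
      fix b assume b: "b \<in> set ?T" "?o u = fst b" "head b = u"
      have bD: "b \<in> set D" using b(1) grow_subset by fastforce
      then have "(\<rho>, ?o (tail b)) \<in> (rel ?H)\<^sup>*" using rk[OF b(1)] b(3) arcs by (intro less.hyps) auto
      moreover have "(?o (tail b), fst b) \<in> rel ?H" using bD by (force simp: rel_def split0_def image_iff)
      ultimately show ?thesis using b(2) by simp
    qed simp
  qed
  have "rooted \<rho> names ?H" unfolding rooted_iff
  proof
    fix p assume "p \<in> set names"
    then consider "p = \<rho>" | a where "a \<in> set D" "p = fst a" by auto
    then show "(\<rho>, p) \<in> (rel ?H)\<^sup>*"
    proof cases
      case 2
      then have "(?o (tail a), p) \<in> rel ?H" by (force simp: rel_def split0_def image_iff)
      then show ?thesis using reach[of "tail a"] arcs[OF 2(1)] by (meson rtrancl_into_rtrancl)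
    qed simp
  qed
  moreover have "tail h \<in> set (cp (fst h))" if h: "h \<in> set ?H" for h
  proof -
    obtain a where a: "a \<in> set D" "h = (tail a, ?o (tail a), fst a)" using h by (auto simp: split0_def)
    have "?o (tail a) \<in> set (cp (tail a))"
      using origin[of "tail a"] arcs[OF a(1)] grow_subset[of r D] unfolding in_cp by blast
    then show ?thesis using a(2) by simp
  qed
  ultimately show ?thesis unfolding splits_def by (simp add: split0_def)
qed

lemma splits_rehang:
  assumes "splits H" "h \<in> set H" "b \<in> set (cp (fst h))" "rooted \<rho> names (rehang h b H)"
  shows "splits (rehang h b H)"
proof -
  have "map (\<lambda>h. (fst h, head h)) (rehang h b H) = map (\<lambda>h. (fst h, head h)) H"
    unfolding rehang_def by simp
  moreover have "tail h' \<in> set (cp (fst h'))" if "h' \<in> set (rehang h b H)" for h'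
    using that assms(1,3) unfolding rehang_def splits_def by fastforce
  ultimately show ?thesis using assms(1,4) unfolding splits_def by simp
qed

text \<open>The overfull copy loses one excess neighbour, and the receiving one was below the bound,
  so it acquires no excess.\<close>

lemma balance_decreases:
  assumes "splits H"
  defines "\<Phi> \<equiv> \<lambda>H. \<Sum>p\<in>set names. length (incid H p) - length K"
  shows "splits (balance K \<rho> r D H)" "balance K \<rho> r D H = H \<or> \<Phi> (balance K \<rho> r D H) < \<Phi> H"
proof -
  have "splits (balance K \<rho> r D H) \<and> (balance K \<rho> r D H = H \<or> \<Phi> (balance K \<rho> r D H) < \<Phi> H)"
  proof (cases rule: balance_cases[of K \<rho> r D H])
    case (2 h b)
    have ne: "tail h \<noteq> b" using 2(5,6) by auto
    note inc = rehang_incid[OF splits_distinct[OF assms(1)] 2(2), of b]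
    have "\<Phi> (rehang h b H) < \<Phi> H" unfolding \<Phi>_def
    proof (rule sum_strict_mono_ex1)
      show "\<forall>p\<in>set names. length (incid (rehang h b H) p) - length K \<le> length (incid H p) - length K"
      proof
        fix p
        show "length (incid (rehang h b H) p) - length K \<le> length (incid H p) - length K"
          using inc[of p] 2(6) by (cases "p = b") auto
      qed
      show "\<exists>p\<in>set names. length (incid (rehang h b H) p) - length K < length (incid H p) - length K"
        using inc[of "tail h"] 2(5) ne splits_names(1)[OF assms(1) 2(2)] by (intro bexI[of _ "tail h"]) auto
    qed simp
    then show ?thesis using splits_rehang[OF assms(1) 2(2,3,7)] 2(1) by simp
  qed (use assms(1) in simp)
  then show "splits (balance K \<rho> r D H)" "balance K \<rho> r D H = H \<or> \<Phi> (balance K \<rho> r D H) < \<Phi> H" by blast+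
qed

text \<open>Every candidate lowers the degree of an overfull copy and hence differs from
  \<open>H\<close>; getting \<open>H\<close> back means that there was no candidate.\<close>

lemma balance_fixed:
  assumes "splits H" "balance K \<rho> r D H = H" "h \<in> set H" "b \<in> set (cp (fst h))"
    "length K < length (incid H (tail h))" "length (incid H b) < length K"
  shows "\<not> rooted \<rho> names (rehang h b H)"
proof
  let ?C = "filter (rooted \<rho> names) (map (\<lambda>p. rehang (fst p) (snd p) H)
      (filter (\<lambda>p. snd p \<in> set (cp (fst (fst p))) \<and>
          \<not> length (incid H (tail (fst p))) \<le> length K \<and> \<not> length K \<le> length (incid H (snd p)))
        (List.product H names)))"
  assume rt: "rooted \<rho> names (rehang h b H)"
  have mem: "(h, b) \<in> set (filter (\<lambda>p. snd p \<in> set (cp (fst (fst p))) \<and>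
          \<not> length (incid H (tail (fst p))) \<le> length K \<and> \<not> length K \<le> length (incid H (snd p)))
        (List.product H names))"
    using assms(3-6) cp_names[OF assms(4)] by simp
  have "rehang h b H \<in> set ?C"
    using filter_map_memI[OF mem, of "rooted \<rho> names" "\<lambda>p. rehang (fst p) (snd p) H"] rt
    by (simp only: fst_conv snd_conv)
  then have "balance K \<rho> r D H \<in> set ?C" by (cases ?C) (auto simp: balance_def first_or_def)
  from filter_map_mem[OF this] obtain p where p: "fst p \<in> set H" "length K < length (incid H (tail (fst p)))"
      "length (incid H (snd p)) < length K" "balance K \<rho> r D H = rehang (fst p) (snd p) H"
    by (auto simp: not_le)
  then show False
    using rehang_incid[OF splits_distinct[OF assms(1)] p(1), of "snd p" "tail (fst p)"] assms(2)
    by (auto split: if_splits)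
qed

text \<open>
  If a copy has too many neighbours, another copy of the same vertex has few. One of two children can
  be moved there, since no path visits both. With only one child the degree bound is 1, and then the
  root copy would have no children.
\<close>

lemma balance_optimal:
  assumes H: "splits H" and fixed: "balance K \<rho> r D H = H" and p: "p \<in> set names"
  shows "length (incid H p) \<le> length K"
proof (rule ccontr)
  assume "\<not> ?thesis"
  then have big: "length K < length (incid H p)" by simp
  obtain v where v: "v \<in> set V" "p \<in> set (cp v)" using names_cp[OF p] by blast
  have reach: "(\<rho>, w) \<in> (rel H)\<^sup>*" if "w \<in> set names" for w
    using H that by (auto simp: splits_def rooted_iff)
  \<comment> \<open>Otherwise the copies of \<open>v\<close> would together have a degree above
    \<open>length K\<close> times their number, against \<open>demand\<close>.\<close>
  have "\<exists>q\<in>set (cp v). length (incid H q) < length K"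
  proof (rule ccontr)
    assume "\<not> ?thesis"
    then have all: "\<forall>q\<in>set (cp v). length K \<le> length (incid H q)" by (simp add: not_less)
    have "(\<Sum>q\<in>set (cp v). length K) < (\<Sum>q\<in>set (cp v). length (incid H q))"
      by (rule sum_strict_mono_ex1) (use all big v(2) in auto)
    then have "length K * ncopies r D v < length (incid D v)"
      using splits_degree[OF H] distinct_card[OF distinct_cp, of v] by (simp add: length_copies mult.commute)
    then show False using demand[OF v(1)] by (simp add: enough_iff)
  qed
  then obtain q where q: "q \<in> set (cp v)" "length (incid H q) < length K" by blast
  define kids where "kids = filter (\<lambda>h. tail h = p) H"
  have kid: "h \<in> set H" "tail h = p" "fst h = v" if "h \<in> set kids" for h
  proof -
    show h: "h \<in> set H" "tail h = p" using that by (auto simp: kids_def)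
    show "fst h = v" using splits_names(3)[OF H h(1)] v(2) cp_disjoint h(2) by auto
  qed
  have dk: "distinct kids" unfolding kids_def using splits_distinct[OF H] by simp
  have stuck: "\<not> rooted \<rho> names (rehang h q H)" if "h \<in> set kids" for h
    using balance_fixed[OF H fixed, of h q] kid[OF that] q big by simp
  have into: "length (into H p) \<le> (if p = \<rho> then 0 else 1)"
  proof -
    have "length (into H p) = length (filter (\<lambda>x. x = p) (map head H))" by (simp add: into_def filter_map comp_def)
    also have "\<dots> = (if p \<in> fst ` set D then 1 else 0)"
      unfolding splits_heads[OF H] length_filter_eq_distinct[OF ids] by simp
    finally show ?thesis using root_id by auto
  qed
  have deg: "length (incid H p) = length kids + length (into H p)" by (simp add: incid_def kids_def)
  show False
  proof (cases "length kids \<le> 1")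
    case True
    have "length K \<ge> 1" using K by (cases K) auto
    \<comment> \<open>The degree of \<open>p\<close> is at least 2, with at most one child and at
      most one entering arc, so all these bounds are attained.\<close>
    then have K1: "length K = 1" "length kids = 1" "p \<noteq> \<rho>" using deg big into True by (auto split: if_splits)
    then obtain h where h: "kids = [h]" by (auto simp: length_Suc_conv)
    \<comment> \<open>The arcs entering \<open>v\<close> occur on both sides; cancelling them leaves
      no leaving arc, or at most one if \<open>v = r\<close>.\<close>
    have "length (incid D v) \<le> ncopies r D v" using demand[OF v(1)] K1(1) by (simp add: enough_iff)
    then have out: "length (filter (\<lambda>a. tail a = v) D) \<le> (if v = r then 1 else 0)"
      by (simp add: incid_def ncopies_def)
    have "map fst H = map fst (map (\<lambda>h. (fst h, head h)) H)" by simp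
    also have "\<dots> = map tail D" using H unfolding splits_def by (simp add: comp_def)
    finally have "length (filter (\<lambda>x. x = v) (map fst H)) = length (filter (\<lambda>x. x = v) (map tail D))" by simp
    then have fv: "length (filter (\<lambda>h. fst h = v) H) \<le> (if v = r then 1 else 0)"
      using out by (simp add: filter_map comp_def)
    have hH: "h \<in> set (filter (\<lambda>h. fst h = v) H)" using kid[of h] h by simp
    then have vr: "v = r" using fv by (auto split: if_splits simp: filter_empty_conv)
    have only: "h' = h" if "h' \<in> set H" "fst h' = r" for h'
    proof -
      have "h' \<in> set (filter (\<lambda>h. fst h = v) H)" using that vr by simp
      moreover have "length (filter (\<lambda>h. fst h = v) H) \<le> 1" using fv vr by simp
      ultimately show ?thesis using hH by (cases "filter (\<lambda>h. fst h = v) H") auto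
    qed
    \<comment> \<open>A path from \<open>\<rho>\<close> to the different copy \<open>p\<close>
      starts with an arc tagged \<open>r\<close>; but the only such arc has its tail at
      \<open>p\<close>.\<close>
    have "(\<rho>, p) \<in> (rel H)\<^sup>*" by (rule reach[OF p])
    then obtain w where "(\<rho>, w) \<in> rel H"
      using K1(3) by (cases rule: converse_rtranclE) auto
    then obtain h' where h': "h' \<in> set H" "tail h' = \<rho>" by (auto simp: rel_def)
    then have "fst h' = r" using splits_names(3)[OF H h'(1)] cp_disjoint[of \<rho> "fst h'" r] by (simp add: in_cp)
    then have "h' = h" by (rule only[OF h'(1)])
    then show False using kid[of h] h h'(2) K1(3) by simp
  next
    case False
    then obtain h1 h2 ks where ks: "kids = h1 # h2 # ks" by (cases kids; cases "tl kids") auto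
    then have hs: "h1 \<in> set kids" "h2 \<in> set kids" "h1 \<noteq> h2" using dk by auto
    have "head h1 \<noteq> head h2" using splits_head_inj[OF H] kid hs by blast
    moreover have "(\<rho>, q) \<in> (rel H)\<^sup>*" by (rule reach[OF cp_names[OF q(1)]])
    ultimately have "(\<rho>, q) \<in> (rel H - {(p, head h1)})\<^sup>* \<or> (\<rho>, q) \<in> (rel H - {(p, head h2)})\<^sup>*"
      by (rule rtrancl_avoid_one[rotated])
    then obtain h where h: "h \<in> set kids" "(\<rho>, q) \<in> (rel H - {(p, head h)})\<^sup>*" using hs(1,2) by blast
    have "rooted \<rho> names (rehang h q H)"
    proof (rule rehang_rooted)
      show "h \<in> set H" by (rule kid(1)[OF h(1)])
      show "(\<rho>, q) \<in> (rel H - {(tail h, head h)})\<^sup>*" using h(2) kid(2)[OF h(1)] by simp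
      show "rooted \<rho> names H" using H by (simp add: splits_def)
    qed
    then show False using stuck[OF h(1)] by contradiction
  qed
qed

lemma splitting_props:
  shows "splits (splitting K \<rho> r D)" "p \<in> set names \<Longrightarrow> length (incid (splitting K \<rho> r D) p) \<le> length K"
proof -
  define \<Phi> where "\<Phi> H = (\<Sum>p\<in>set names. length (incid H p) - length K)" for H :: "('a, 'i) arc list"
  have "\<Phi> (split0 \<rho> r D) \<le> (\<Sum>p\<in>set names. length (incid (split0 \<rho> r D) p))"
    unfolding \<Phi>_def by (intro sum_mono) simp
  also have "\<dots> = 2 * length (split0 \<rho> r D)"
  proof (rule sum_incid)
    show "tail h \<in> set names \<and> head h \<in> set names" if "h \<in> set (split0 \<rho> r D)" for h
      using splits_names(1,2)[OF splits_split0 that] by simp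
  qed simp
  finally have bound: "\<Phi> (split0 \<rho> r D) \<le> length (D @ D)" by (simp add: split0_def)
  have decr: "balance K \<rho> r D H = H \<or> \<Phi> (balance K \<rho> r D H) < \<Phi> H" if "splits H" for H
    unfolding \<Phi>_def by (rule balance_decreases(2)[OF that])
  note fixed = funpow_fixed[where \<Phi> = \<Phi>, OF splits_split0 balance_decreases(1) decr bound, folded splitting_def]
  show "splits (splitting K \<rho> r D)" by (rule fixed(1))
  show "length (incid (splitting K \<rho> r D) p) \<le> length K" if "p \<in> set names"
    by (rule balance_optimal[OF fixed that])
qed

end

section \<open>Correctness\<close>

lemma uedges_mem: "e \<in># uedges D \<longleftrightarrow> (\<exists>h\<in>set D. e = Upair (tail h) (head h))"
  unfolding uedges_def by (simp add: image_iff)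

lemma length_filter_mset_le_1:
  assumes "distinct (map head H)" "\<And>h. h \<in> set H \<Longrightarrow> Q (Upair (tail h) (head h)) \<Longrightarrow> head h = v"
  shows "size (filter_mset Q (uedges H)) \<le> 1"
proof -
  have "size (filter_mset Q (uedges H)) = length (filter (\<lambda>h. Q (Upair (tail h) (head h))) H)"
    unfolding uedges_def by (induction H) auto
  also have "\<dots> \<le> length (filter (\<lambda>h. head h = v) H)"
    using assms(2)
  proof (induction H)
    case (Cons a H)
    from Cons.prems[of a] have "Q (Upair (tail a) (head a)) \<Longrightarrow> head a = v" by simp
    with Cons show ?case by simp
  qed simp
  also have "\<dots> = length (filter (\<lambda>x. x = v) (map head H))" by (simp add: filter_map comp_def)
  also have "\<dots> \<le> 1" unfolding length_filter_eq_distinct[OF assms(1)] by simp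
  finally show ?thesis .
qed

text \<open>
  The vertex of maximal rank on a cycle would be entered by both of its cycle edges, while the heads
  are distinct.
\<close>

lemma ranked_acyclic:
  fixes rk :: "'a \<Rightarrow> nat"
  assumes rk: "\<And>h. h \<in> set H \<Longrightarrow> rk (tail h) < rk (head h)" and heads: "distinct (map head H)"
    and Q: "edges Q = uedges H"
  shows "\<not> is_cycle Q vs"
proof
  assume "is_cycle Q vs"
  then have vs: "vs \<noteq> []" and sub: "mset (map2 Upair vs (rotate1 vs)) \<subseteq># uedges H"
    using Q by (auto simp: is_cycle_def)
  define n where "n = length vs"
  define L where "L = map2 Upair vs (rotate1 vs)"
  have n: "0 < n" using vs by (simp add: n_def)
  have L: "length L = n" "\<And>i. i < n \<Longrightarrow> L ! i = Upair (vs ! i) (vs ! (Suc i mod n))"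
    by (simp_all add: L_def n_def nth_rotate1)
  have "Max (rk ` set vs) \<in> rk ` set vs" using vs by (intro Max_in) auto
  then obtain v where v: "v \<in> set vs" "rk v = Max (rk ` set vs)" by auto
  then have max: "rk w \<le> rk v" if "w \<in> set vs" for w using that by simp
  obtain m where m: "m < n" "vs ! m = v" using v(1) by (auto simp: in_set_conv_nth n_def)
  \<comment> \<open>By the ranks, an edge at \<open>v\<close> whose other end is not higher must
    have \<open>v\<close> as its head, and at most one arc has.\<close>
  define P where "P e \<longleftrightarrow> (\<exists>w. e = Upair w v \<and> rk w \<le> rk v)" for e
  have "size (filter_mset P (uedges H)) \<le> 1"
  proof (rule length_filter_mset_le_1[OF heads])
    fix h assume h: "h \<in> set H" "P (Upair (tail h) (head h))"
    from h(2) obtain w where w: "Upair (tail h) (head h) = Upair w v" "rk w \<le> rk v" unfolding P_def by blast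
    from w(1) consider "head h = v" | "tail h = v" "head h = w" by auto
    then show "head h = v" using rk[OF h(1)] w(2) by cases simp_all
  qed
  moreover have "size (filter_mset P (mset L)) \<le> size (filter_mset P (uedges H))"
    using sub by (intro size_mset_mono multiset_filter_mono) (simp add: L_def)
  \<comment> \<open>Positions on the cycle are counted instead of edges, so two parallel edges count
    twice.\<close>
  moreover have "size (filter_mset P (mset L)) = card {i. i < n \<and> P (L ! i)}"
    using length_filter_conv_card[of P L] by (simp add: L(1) flip: mset_filter)
  ultimately have card: "card {i. i < n \<and> P (L ! i)} \<le> 1" by simp
  have in_vs: "vs ! i \<in> set vs" if "i < n" for i using that by (simp add: n_def)
  have Pm: "P (L ! m)"
    unfolding P_def using L(2)[OF m(1)] m max[OF in_vs[of "Suc m mod n"]] n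
    by (intro exI[of _ "vs ! (Suc m mod n)"]) (simp add: insert_commute)
  define j where "j = (if m = 0 then n - 1 else m - 1)"
  have j: "j < n" "Suc j mod n = m" using m(1) n by (auto simp: j_def)
  have Pj: "P (L ! j)"
    unfolding P_def using L(2)[OF j(1)] j(2) m(2) max[OF in_vs[OF j(1)]]
    by (intro exI[of _ "vs ! j"]) simp
  \<comment> \<open>The two positions next to \<open>v\<close> coincide only on a cycle of length 1,
    that is at a loop, which ranks exclude.\<close>
  have "j = m"
  proof (rule ccontr)
    assume "j \<noteq> m"
    have "card {j, m} \<le> card {i. i < n \<and> P (L ! i)}" using Pm Pj m(1) j(1) by (intro card_mono) auto
    then show False using card \<open>j \<noteq> m\<close> by simp
  qed
  then have "L ! m = Upair v v" using L(2)[OF j(1)] j(2) m(2) by simp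
  then have "Upair v v \<in># uedges H" using sub m(1) L(1) nth_mem[of m L] unfolding L_def
    by (metis mset_subset_eqD set_mset_mset)
  then obtain h where "h \<in> set H" "Upair v v = Upair (tail h) (head h)" unfolding uedges_mem by (rule bexE)
  then show False using rk[of h] by auto
qed

context oriented
begin

text \<open>Each head is reached by a tree arc, and distinct heads make this the only arc into it.
  So the search tree is all of \<open>H\<close>, and its ranks serve for every arc.\<close>

lemma splits_rank:
  assumes H: "splits H"
  obtains rk :: "'i \<Rightarrow> nat" where "\<And>h. h \<in> set H \<Longrightarrow> rk (tail h) < rk (head h)"
proof -
  obtain rk :: "'i \<Rightarrow> nat" where rk: "\<And>h. h \<in> set (grow \<rho> H) \<Longrightarrow> rk (tail h) < rk (head h)"
    using arborescence_rank[OF arborescence_grow[of \<rho> H]] by blast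
  have "h \<in> set (grow \<rho> H)" if h: "h \<in> set H" for h
  proof -
    have "head h \<in> set names" "head h \<noteq> \<rho>" using splits_names(2)[OF H h] root_id by auto
    moreover have "rooted \<rho> names H" using H unfolding splits_def by (elim conjE)
    ultimately have "head h \<in> set (reached \<rho> H)" unfolding rooted_def by metis
    then have "head h \<in> head ` set (grow \<rho> H)"
      unfolding reached_def list.set set_map using \<open>head h \<noteq> \<rho>\<close> by (elim insertE) simp_all
    then obtain t where t: "head h = head t" "t \<in> set (grow \<rho> H)" by (rule imageE)
    have "t \<in> set H" by (rule subsetD[OF grow_subset t(2)])
    from splits_head_inj[OF H h this t(1)] t(2) show ?thesis by simp
  qed
  then show ?thesis using that rk by blast
qed

lemma splits_tree:
  assumes H: "splits H" and ne: "D \<noteq> []"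
  shows "is_tree \<lparr>verts = set names, edges = uedges H\<rparr>"
proof -
  let ?Q = "\<lparr>verts = set names, edges = uedges H\<rparr>"
  obtain rk :: "'i \<Rightarrow> nat" where rk: "\<And>h. h \<in> set H \<Longrightarrow> rk (tail h) < rk (head h)"
    using splits_rank[OF H] by blast
  have "\<not> is_cycle ?Q vs" for vs
    by (rule ranked_acyclic[OF rk]) (simp_all add: splits_heads[OF H] ids)
  moreover have "is_graph ?Q"
  proof -
    have "card (set names) = length names" using distinct_names by (rule distinct_card)
    moreover have "2 \<le> length names" using ne by (cases D) auto
    ultimately have "2 \<le> card (set names)" by simp
    moreover have "set_uprod e \<subseteq> set names" if e: "e \<in># uedges H" for e
    proof -
      obtain h where "h \<in> set H" "e = Upair (tail h) (head h)" using e unfolding uedges_mem by (rule bexE)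
      then show ?thesis using splits_names(1,2)[OF H, of h] by simp
    qed
    moreover have "connected_graph ?Q"
    proof -
      have "rel H \<subseteq> adj ?Q"
      proof
        fix x assume "x \<in> rel H"
        then obtain h where "h \<in> set H" "x = (tail h, head h)" unfolding rel_def by blast
        then show "x \<in> adj ?Q" by (auto simp: adj_def uedges_mem)
      qed
      then have "(rel H)\<^sup>* \<subseteq> (adj ?Q)\<^sup>*" by (rule rtrancl_mono)
      moreover have "rooted \<rho> names H" using H unfolding splits_def by (elim conjE)
      ultimately have reach: "(\<rho>, p) \<in> (adj ?Q)\<^sup>*" if "p \<in> set names" for p
        using that unfolding rooted_iff by (meson subsetD)
      have swap: "Upair u v = Upair v u" for u v :: 'i by simp
      have "sym (adj ?Q)"
      proof (rule symI)
        fix u v assume "(u, v) \<in> adj ?Q"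
        then show "(v, u) \<in> adj ?Q" unfolding adj_def by (simp only: mem_Collect_eq case_prod_conv swap[of v u])
      qed
      then have sym: "sym ((adj ?Q)\<^sup>*)" by (rule sym_rtrancl)
      show ?thesis unfolding connected_graph_def
      proof (intro ballI)
        fix u v assume "u \<in> verts ?Q" "v \<in> verts ?Q"
        then have "(\<rho>, u) \<in> (adj ?Q)\<^sup>*" "(\<rho>, v) \<in> (adj ?Q)\<^sup>*" by (simp_all only: multigraph.simps reach)
        from rtrancl_trans[OF symD[OF sym this(1)] this(2)] show "(u, v) \<in> (adj ?Q)\<^sup>*" .
      qed
    qed
    ultimately show ?thesis unfolding is_graph_def by auto
  qed
  ultimately show ?thesis unfolding is_tree_def by blast
qed

lemma splits_hom_image:
  assumes H: "splits H" and \<phi>: "\<And>p v. p \<in> set (cp v) \<Longrightarrow> \<phi> p = v"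
    and G: "verts G = set V" "edges G = uedges D"
  shows "hom_image G \<lparr>verts = set names, edges = uedges H\<rparr> \<phi>"
proof -
  have "\<phi> ` set names = set V"
  proof
    show "\<phi> ` set names \<subseteq> set V"
    proof
      fix w assume "w \<in> \<phi> ` set names"
      then obtain p where p: "w = \<phi> p" "p \<in> set names" by (rule imageE)
      from names_cp[OF p(2)] obtain v where "v \<in> set V" "p \<in> set (cp v)" by (rule bexE)
      then show "w \<in> set V" using \<phi>[of p v] p(1) by simp
    qed
    show "set V \<subseteq> \<phi> ` set names"
    proof
      fix v assume v: "v \<in> set V"
      have "\<exists>p. p \<in> set (cp v)"
      proof (cases "v = r")
        case True
        then show ?thesis by (auto simp: in_cp)
      next
        case False
        have "(r, v) \<in> (rel D)\<^sup>*" using root v by (simp add: rooted_iff)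
        from rtrancl_enters[OF this, of "{v}"] False obtain u where "(u, v) \<in> rel D" by auto
        then obtain a where "a \<in> set D" "(u, v) = (tail a, head a)" unfolding rel_def by blast
        then show ?thesis using cp_id[of a v] by (intro exI[of _ "fst a"]) simp
      qed
      then obtain p where p: "p \<in> set (cp v)" by (rule exE)
      show "v \<in> \<phi> ` set names" by (rule image_eqI[where f = \<phi> and x = p]) (simp only: \<phi>[OF p], rule cp_names[OF p])
    qed
  qed
  \<comment> \<open>Arc by arc: the tag of an arc of \<open>H\<close> is the image of its tail, and
    its head is named after the corresponding arc of \<open>D\<close>, whose head is the
    image.\<close>
  moreover have im: "image_mset (map_uprod \<phi>) (uedges H) = uedges D"
  proof -
    have "\<phi> (tail h) = fst h" if "h \<in> set H" for h using \<phi>[OF splits_names(3)[OF H that]] .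
    then have "map (map_uprod \<phi>) (map (\<lambda>h. Upair (tail h) (head h)) H) = map (\<lambda>h. Upair (fst h) (\<phi> (head h))) H"
      by simp
    then have "image_mset (map_uprod \<phi>) (uedges H) = mset (map (\<lambda>h. Upair (fst h) (\<phi> (head h))) H)"
      unfolding uedges_def by (metis mset_map)
    also have "map (\<lambda>h. Upair (fst h) (\<phi> (head h))) H = map (\<lambda>x. Upair (fst x) (\<phi> (snd x))) (map (\<lambda>h. (fst h, head h)) H)"
      by simp
    also have "\<dots> = map (\<lambda>a. Upair (tail a) (\<phi> (fst a))) D" using H unfolding splits_def by simp
    also have "\<dots> = map (\<lambda>a. Upair (tail a) (head a)) D"
    proof (rule map_cong[OF refl])
      fix a assume "a \<in> set D"
      then have "\<phi> (fst a) = head a" by (intro \<phi>) (simp only: cp_id)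
      then show "Upair (tail a) (\<phi> (fst a)) = Upair (tail a) (head a)" by simp
    qed
    finally show ?thesis by (simp add: uedges_def)
  qed
  moreover have "count (uedges D) e = size {#f \<in># uedges H. map_uprod \<phi> f = e#}" for e
  proof -
    have "count (image_mset (map_uprod \<phi>) M) e = size {#f \<in># M. map_uprod \<phi> f = e#}" for M :: "'i uprod multiset"
      by (induction M) auto
    from this[of "uedges H"] show ?thesis unfolding im .
  qed
  ultimately show ?thesis using G by (simp add: hom_image_def)
qed

end

section \<open>Names, the cap and the complete algorithm\<close>

lemma mersenne_inject: "(2 ^ i - 1 :: nat) = 2 ^ j - 1 \<longleftrightarrow> i = j"
proof
  assume "(2 ^ i - 1 :: nat) = 2 ^ j - 1"
  moreover have "(0::nat) < 2 ^ i" "(0::nat) < 2 ^ j" by simp_all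
  ultimately have "(2 ^ i :: nat) = 2 ^ j" by linarith
  then show "i = j" by simp
qed simp

lemma number_props:
  shows "map snd (number xs) = rev xs" "distinct (map fst (number xs))"
    "2 ^ length (number xs) - 1 \<notin> fst ` set (number xs)"
proof -
  have n: "number xs = map (\<lambda>(i, x). (2 ^ i - 1, x)) (rev (zip [0..<length xs] xs))"
    unfolding number_def by (rule number_fold)
  have "map snd (number xs) = map snd (rev (zip [0..<length xs] xs))"
    unfolding n by (simp add: case_prod_unfold comp_def)
  then show "map snd (number xs) = rev xs" by (simp flip: rev_map)
  have f: "map fst (number xs) = map (\<lambda>i. 2 ^ i - 1) (rev [0..<length xs])"
  proof -
    have "map fst (number xs) = map (\<lambda>i. 2 ^ i - 1) (map fst (rev (zip [0..<length xs] xs)))"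
      unfolding n by (simp add: case_prod_unfold comp_def)
    then show ?thesis by (simp flip: rev_map)
  qed
  show "distinct (map fst (number xs))"
    unfolding f distinct_map inj_on_def using mersenne_inject by auto
  have "fst ` set (number xs) = (\<lambda>i. 2 ^ i - 1) ` {0..<length xs}"
    using arg_cong[OF f, of set] by simp
  moreover have "length (number xs) = length xs" unfolding n by simp
  ultimately show "2 ^ length (number xs) - 1 \<notin> fst ` set (number xs)"
    using mersenne_inject by auto
qed

text \<open>The pair holds the weight of the next bit and the value so far, both saturated.
  Saturating intermediate sums does not change the saturated result.\<close>

lemma length_capped: "length (capped L k) = min (length L) k"
proof -
  let ?f = "\<lambda>b s. (clip L (fst s @ fst s), clip L (snd s @ (if b then fst s else [])))"
  have "length (snd (fold ?f (bits k) s)) = min (length L) (a + w * k)"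
    if "length (fst s) = min (length L) w" "length (snd s) = min (length L) a" for s w a
    using that
  proof (induction k arbitrary: s a w rule: less_induct)
    case (less k)
    show ?case
    proof (cases "k = 0")
      case False
      let ?a = "a + (if odd k then w else 0)"
      have "length (snd (fold ?f (bits (k div 2)) (?f (odd k) s))) = min (length L) (?a + 2 * w * (k div 2))"
        by (rule less.IH) (use False less.prems in \<open>auto simp: length_clip min_def\<close>)
      moreover have "?a + 2 * w * (k div 2) = a + w * k"
      proof -
        have "k = 2 * (k div 2) + (if odd k then 1 else 0)" by simp
        then have "w * k = w * (2 * (k div 2) + (if odd k then 1 else 0))" by (rule arg_cong)
        then show ?thesis by (simp add: algebra_simps)
      qed
      ultimately show ?thesis using False by (simp add: bits_pos)
    qed (use less.prems in simp)
  qed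
  from this[of "(clip L [()], [])" 1 0] show ?thesis by (simp add: capped_def length_clip)
qed

lemma graph_of_edges:
  assumes "map snd E = rev es"
  shows "edges (graph_of (vs, es)) = uedges E"
proof -
  have "uedges E = mset (map (\<lambda>p. Upair (fst p) (snd p)) (map snd E))"
    by (simp add: uedges_def tail_def head_def comp_def)
  also have "\<dots> = mset (map (\<lambda>p. Upair (fst p) (snd p)) es)"
    unfolding assms by (simp flip: rev_map)
  finally show ?thesis by (simp add: case_prod_unfold)
qed

lemma solve_correct:
  assumes valid: "valid_pres P" and k: "k > 0"
  shows "case solve (P, k) of
        None \<Rightarrow> \<not> k_trail k (graph_of P)
      | Some (Q, tab) \<Rightarrow>
          k_trail k (graph_of P) \<and>
          valid_pres Q \<and> k_tree k (graph_of Q) \<and>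
          is_table_on (verts (graph_of Q)) tab \<and>
          hom_image (graph_of P) (graph_of Q) (table_fun tab)"
proof -
  obtain vs es where P: "P = (vs, es)" by (cases P)
  let ?G = "graph_of P"
  have G: "is_graph ?G" using valid by (simp add: valid_pres_def)
  have vG: "verts ?G = set vs" by (simp add: P)
  obtain r vs' where vs: "vs = r # vs'" using G by (cases vs) (auto simp: is_graph_def P)
  define E where "E = number es"
  define \<rho> :: nat where "\<rho> = 2 ^ length E - 1"
  define K where "K = capped (() # map (\<lambda>_. ()) (E @ E)) k"
  define D where "D = optimum K \<rho> r vs E"
  define H where "H = splitting K \<rho> r D"
  have eG: "edges ?G = uedges E" unfolding P by (rule graph_of_edges) (simp add: E_def number_props)
  have solve: "solve (P, k) = (if \<forall>v\<in>set vs. enough K \<rho> r D v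
      then Some ((\<rho> # map fst D, map snd H), (\<rho>, r) # map (\<lambda>a. (fst a, head a)) D) else None)"
    unfolding solve_def H_def D_def K_def \<rho>_def E_def by (simp add: P vs Let_def)
  have lK: "length K = min (1 + 2 * length E) k" by (simp add: K_def length_capped)
  then have K: "K \<noteq> []" using k by auto
  have arcsE: "tail a \<in> set vs \<and> head a \<in> set vs" if "a \<in> set E" for a
  proof -
    have "Upair (tail a) (head a) \<in># edges ?G" unfolding eG uedges_mem using that by blast
    then have "set_uprod (Upair (tail a) (head a)) \<subseteq> verts ?G" using G unfolding is_graph_def by blast
    then show ?thesis using vG by simp
  qed
  have rv: "r \<in> set vs" by (simp add: vs)
  have conn: "(r, v) \<in> (rel (E @ map turn E))\<^sup>*" if "v \<in> set vs" for v
  proof -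
    have "adj ?G \<subseteq> rel (E @ map turn E)"
    proof
      fix x assume x: "x \<in> adj ?G"
      obtain u w where uw: "x = (u, w)" by (cases x)
      then have "Upair u w \<in># uedges E" using x eG by (simp add: adj_def)
      then obtain a where a: "a \<in> set E" "Upair u w = Upair (tail a) (head a)" unfolding uedges_mem by (rule bexE)
      from a(2) consider "u = tail a" "w = head a" | "u = tail (turn a)" "w = head (turn a)" by auto
      then show "x \<in> rel (E @ map turn E)"
        unfolding uw rel_def by cases (use a(1) in \<open>auto intro!: image_eqI\<close>)
    qed
    moreover have "(r, v) \<in> (adj ?G)\<^sup>*" using G that rv vG by (auto simp: is_graph_def connected_graph_def)
    ultimately show ?thesis using rtrancl_mono by blast
  qed
  have dE: "distinct (map fst E)" unfolding E_def by (rule number_props)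
  note opt = optimum_props[of E vs r K \<rho>, OF dE arcsE conn K, folded D_def]
  have uD: "uedges D = uedges E" by (rule reorients_uedges[OF opt(1)])
  have fD: "map fst D = map fst E" by (rule reorients_fst[OF opt(1)])
  have arcsD: "tail a \<in> set vs \<and> head a \<in> set vs" if a: "a \<in> set D" for a
  proof -
    obtain b where b: "b \<in> set E" "a = b \<or> a = turn b" using reorients_mem[OF opt(1) a] by blast
    from b(2) arcsE[OF b(1)] show ?thesis by (elim disjE) simp_all
  qed
  have dD: "distinct D" using dE fD by (metis distinct_map)
  have lD: "length D = length E" using arg_cong[OF fD, of length] by simp
  show ?thesis
  proof (cases "\<forall>v\<in>set vs. enough K \<rho> r D v")
    case False
    have "\<not> k_trail k ?G"
    proof
      assume "k_trail k ?G"
      from trail_demand[OF G this] obtain y where y: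
        "\<And>X. X \<subseteq> verts ?G \<Longrightarrow> X \<noteq> {} \<Longrightarrow> size {#e \<in># edges ?G. set_uprod e \<subseteq> X#} + 1 \<le> sum y X"
        "sum y (verts ?G) = size (edges ?G) + 1" "\<And>v. v \<in> verts ?G \<Longrightarrow> vdegree ?G v \<le> k * y v" by blast
      have y1: "inside D X + 1 \<le> sum y X" if "X \<subseteq> set vs" "X \<noteq> {}" for X
        using y(1)[of X] that unfolding inside_uedges uD eG vG .
      have "\<forall>v\<in>set vs. enough K \<rho> r D v"
      proof (rule improve_optimal[OF dD opt(2,3) arcsD rv y1])
        show "sum y (set vs) \<le> length D + 1" using y(2) unfolding vG eG by (simp add: lD length_uedges)
        fix v assume v: "v \<in> set vs"
        have "length (incid D v) \<le> k * y v"
          using y(3)[of v] v vdegree_incid[of ?G D v] eG uD vG by simp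
        \<comment> \<open>This handles the case that \<open>K\<close> is shorter than
          \<open>k\<close>: then already one copy suffices for any degree, and \<open>y v\<close> is
          at least 1.\<close>
        moreover have "length (incid D v) \<le> 2 * length E"
          unfolding incid_def into_def using length_filter_le[of _ D] lD by (metis add_mono length_append mult_2)
        moreover have "1 \<le> y v" using y1[of "{v}"] v by simp
        from mult_le_mono2[OF this, of "1 + 2 * length E"]
        have "1 + 2 * length E \<le> (1 + 2 * length E) * y v" by (simp only: mult_1_right)
        ultimately show "length (incid D v) \<le> length K * y v" unfolding lK min_def by (auto split: if_splits)
      qed
      then show False using False by contradiction
    qed
    then show ?thesis unfolding solve using False by simp
  next
    case True
    interpret oriented K \<rho> r vs D
    proof
      show "distinct (map fst D)" using dE fD by simp
      have "set (map fst D) = fst ` set E" using fD by simp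
      then show "\<rho> \<notin> fst ` set D" using number_props(3)[of es] by (simp add: \<rho>_def E_def)
    qed (use arcsD opt(2) True K rv in auto)
    let ?Q = "(\<rho> # map fst D, map snd H)"
    let ?tab = "(\<rho>, r) # map (\<lambda>a. (fst a, head a)) D"
    have H: "splits H" unfolding H_def by (rule splitting_props(1))
    have Q: "graph_of ?Q = \<lparr>verts = set names, edges = uedges H\<rparr>"
      by (simp add: uedges_def comp_def case_prod_unfold tail_def head_def)
    \<comment> \<open>A tree must have two vertices, and the preimage has one more than
      \<open>D\<close> has arcs.\<close>
    have "D \<noteq> []"
    proof
      assume D0: "D = []"
      have "2 \<le> card (set vs)" using G vG by (simp add: is_graph_def)
      then have "\<not> set vs \<subseteq> {r}" using card_mono[of "{r}" "set vs"] by auto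
      then obtain v where v: "v \<in> set vs" "v \<noteq> r" by blast
      then have "(r, v) \<in> (rel D)\<^sup>*" using opt(2) by (simp add: rooted_iff)
      then show False using v(2) by (simp add: D0 rel_def)
    qed
    then have tree: "is_tree (graph_of ?Q)" unfolding Q by (rule splits_tree[OF H])
    have deg: "max_degree_le (graph_of ?Q) k" unfolding max_degree_le_def
    proof
      fix p assume "p \<in> verts (graph_of ?Q)"
      then have "length (incid H p) \<le> length K" unfolding H_def Q by (intro splitting_props(2)) simp
      moreover have "vdegree (graph_of ?Q) p = length (incid H p)" by (rule vdegree_incid) (simp only: Q multigraph.simps)
      ultimately show "vdegree (graph_of ?Q) p \<le> k" using lK by simp
    qed
    have tabs: "map fst ?tab = names" by simp
    have tab: "is_table_on (verts (graph_of ?Q)) ?tab"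
      unfolding is_table_on_def tabs Q using distinct_names by simp
    have \<phi>: "table_fun ?tab p = v" if "p \<in> set (cp v)" for p v
    proof -
      have "(p, v) \<in> set ?tab" using that unfolding in_cp by auto
      then have "map_of ?tab p = Some v" using distinct_names unfolding tabs[symmetric] by (rule map_of_is_SomeI[rotated])
      then show ?thesis by (simp only: table_fun_def option.sel)
    qed
    have hom: "hom_image ?G (graph_of ?Q) (table_fun ?tab)"
      unfolding Q by (rule splits_hom_image[OF H _ vG]) (simp_all only: \<phi> eG uD)
    have "is_graph (graph_of ?Q)" using tree by (simp add: is_tree_def)
    moreover from this deg hom have "k_trail k ?G" unfolding k_trail_def by blast
    ultimately show ?thesis
      unfolding solve using True tree deg tab hom distinct_names by (simp add: k_tree_def valid_pres_def)
  qed
qed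

lemma poly_time_solvable_FP:
  assumes "FP f" and R: "\<And>i. i \<in> D \<Longrightarrow> R i (f i)"
  shows "poly_time_solvable enc enc D R"
proof -
  obtain T c where T: "pb T" and c: "\<And>n s x. s n = enc x \<Longrightarrow> runs (c n) n s (T x) (enc (f x))"
    using FP_E[OF assms(1)] by blast
  obtain d where d: "\<And>x. T x \<le> (esize x + 2) ^ d" using T unfolding pb_def by blast
  \<comment> \<open>\<open>[:2, 1:]\<close> is the polynomial x + 2, the base of the bounds in
    \<open>pb\<close>.\<close>
  have "\<exists>t a. computes (c 0) (enc i) t (enc a) \<and> t \<le> poly ([:2, 1:] ^ d) (esize i) \<and> R i a" if i: "i \<in> D" for i
  proof -
    have "runs (c 0) 0 ((\<lambda>_. DNil)(0 := enc i)) (T i) (enc (f i))" by (rule c) simp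
    then obtain t s' where t: "exec (c 0) ((\<lambda>_. DNil)(0 := enc i)) t s'" "s' 0 = enc (f i)" "t \<le> T i"
      unfolding runs_def by blast
    have "t \<le> poly ([:2, 1:] ^ d) (esize i)" using order_trans[OF t(3) d] by (simp add: poly_power add.commute)
    moreover have "computes (c 0) (enc i) t (enc (f i))" using t(1,2) unfolding computes_def by blast
    ultimately show ?thesis using R[OF i] by blast
  qed
  then show ?thesis unfolding poly_time_solvable_def by blast
qed

theorem theorem1:
  shows "poly_time_solvable enc_instance enc_answer
    {(P, k). valid_pres P \<and> k > 0}
    (\<lambda>(P, k) ans. case ans of
        None \<Rightarrow> \<not> k_trail k (graph_of P)
      | Some (Q, tab) \<Rightarrow>
          k_trail k (graph_of P) \<and>
          valid_pres Q \<and> k_tree k (graph_of Q) \<and>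
          is_table_on (verts (graph_of Q)) tab \<and>
          hom_image (graph_of P) (graph_of Q) (table_fun tab))"
proof -
  have enc_in: "enc_instance = enc" and enc_out: "enc_answer = enc"
    by (simp_all add: enc_instance_def enc_answer_def enc_pres_def enc_prod_def' enc_list_def' enc_nat_def' enc_option_def')
  show ?thesis
    unfolding enc_in enc_out
  proof (rule poly_time_solvable_FP[OF FP_solve])
    fix i :: "pres \<times> nat" assume i: "i \<in> {(P, k). valid_pres P \<and> k > 0}"
    obtain P k where "i = (P, k)" by (cases i)
    with i show "(case i of (P, k) \<Rightarrow> \<lambda>ans. case ans of
        None \<Rightarrow> \<not> k_trail k (graph_of P)
      | Some (Q, tab) \<Rightarrow>
          k_trail k (graph_of P) \<and>
          valid_pres Q \<and> k_tree k (graph_of Q) \<and>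
          is_table_on (verts (graph_of Q)) tab \<and>
          hom_image (graph_of P) (graph_of Q) (table_fun tab)) (solve i)"
      using solve_correct[of P k] by (simp only: mem_Collect_eq case_prod_conv)
  qed
qed

end
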